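(* Let $\mathrm{NaivePCE}_{\rho,\beta,\kappa}$ be the algorithm which, on input $X_1,\dots,X_n\in\mathbb{R}^d$, sets $S=\{i:\|X_i\|_2^2\le O(d\kappa\log(n/\beta))\}$, $\sigma=\Theta(\frac{d\kappa\log(n/\beta)}{n\rho^{1/2}})$, $M'=\frac1n\sum_{i\in S}X_iX_i^\top+N$ with $N\sim\mathrm{GUE}(\sigma^2)$, and outputs the projection of $M'$ onto the PSD cone. Let $\mathrm{WeakPPC}_{\rho,\beta,\kappa,K}$ be the algorithm which computes $Z\gets\mathrm{NaivePCE}_{\rho,\beta,\kappa}(X_1,\dots,X_n)$, lets $(\lambda_1,v_1),\dots,(\lambda_d,v_d)$ be the eigenvalues and eigenvectors of $Z$, sets $V=\mathrm{span}\{v_i:\lambda_i\ge\kappa/2\}$, and returns $(V,A)$ with $A=\frac{1}{\sqrt K}\Pi_V+\Pi_{V^\perp}$. Then for every $\rho,\beta,\kappa,K>0$, $\mathrm{WeakPPC}_{\rho,\beta,\kappa,K}$ satisfies $\rho$-zCDP and, if $X_1,\dots,X_n$ are sampled i.i.d. from $\mathcal{N}(0,\Sigma)$ for $\mathbb{I}\preceq\Sigma\preceq\kappa\mathbb{I}$ and satisfy conditions (i)–(iii) below, then with probability at least $1-O(\beta)$ it outputs $(V,A)$ such that $$(1-\psi)^2(1-\Gamma)\mathbb{I}\preceq A\Sigma A\preceq(1+\psi)\kappa\left(\max\left(\tfrac1K,\tfrac12\right)+\varphi\right)\mathbb{I},$$ where $\varphi=O\left(\frac{d^{3/2}\log(n/\beta)\log(1/\beta)}{n\rho^{1/2}}\right)$,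 $\psi=O\left(\sqrt{\frac{d+\log(1/\beta)}{n}}\right)$, and $\Gamma=\max\left\{\frac{2K}{(1/2-\varphi)\kappa},\frac{16K\varphi^2}{(1/2-\varphi)^2}\right\}$. In particular, if $\kappa>1000$, $K$ is an appropriate constant, and $n\ge O\left(\frac{d^{3/2}\mathrm{polylog}(\frac{d}{\rho\beta})}{\rho^{1/2}}\right)$, then $1.1A$ satisfies $\mathbb{I}\preceq(1.1A)\Sigma(1.1A)\preceq\frac{7}{10}\kappa\mathbb{I}$. Conditions, with $Y_i=\Sigma^{-1/2}X_i$, $\hat\Sigma_Y=\frac1n\sum_iY_iY_i^\top$: (i) $\|Y_i\|_2^2\le O(d\log(n/\beta))$ for all $i$; (ii) $(1-O(\sqrt{\frac{d+\log(1/\beta)}{n}}))\mathbb{I}\preceq\hat\Sigma_Y\preceq(1+O(\sqrt{\frac{d+\log(1/\beta)}{n}}))\mathbb{I}$; (iii) $\|\mathbb{I}-\hat\Sigma_Y\|_F\le O(\sqrt{\frac{d^2+\log(1/\beta)}{n}})$.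
   Context: $O(\cdot),\Theta(\cdot)$ denote fixed absolute constants. $\Pi_V$ is the orthogonal projection onto subspace $V$. $\mathrm{GUE}(\sigma^2)$ is the distribution over symmetric $d\times d$ matrices with entries $M_{ij}$, $i\le j$, i.i.d. $\mathcal{N}(0,\sigma^2)$. An algorithm $M$ is $\rho$-zCDP if for all datasets $X,X'$ differing in one entry and all $\alpha>1$, the Rényi divergence $D_\alpha(M(X)\|M(X'))\le\rho\alpha$.
   Formalization: The lower bound is stated only for ψ ≤ 1 and φ ≠ 1/2 (it fails for large ψ, and Γ is undefined at φ = 1/2); the "in particular" clause assumes ρ ≤ 1, since for very large ρ its sample-size condition allows n < d and the claim fails. *)

theory Defs
  imports
    "HOL-Probability.Probability"
    "Jordan_Normal_Form.Char_Poly"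
    "Jordan_Normal_Form.Gauss_Jordan_Elimination"
    "Jordan_Normal_Form.VS_Connect"
begin

unbundle no vec_syntax
unbundle no inner_syntax

text \<open>Vectors and matrices are those of Jordan normal form theory, whose dimension is a
  number and not a type: the implicit constants of the theorem have to be chosen
  uniformly in the dimension \<open>d\<close>.\<close>

section \<open>Linear algebra\<close>

definition sym_mats :: "nat \<Rightarrow> real mat set" where
  "sym_mats d = {A \<in> carrier_mat d d. A\<^sup>T = A}"

definition psd_cone :: "nat \<Rightarrow> real mat set" where
  "psd_cone d = {A \<in> sym_mats d. \<forall>v \<in> carrier_vec d. 0 \<le> v \<bullet> (A *\<^sub>v v)}"

definition loewner_le :: "nat \<Rightarrow> real mat \<Rightarrow> real mat \<Rightarrow> bool" where
  "loewner_le d A B \<longleftrightarrow> A \<in> sym_mats d \<and> B \<in> sym_mats d \<and> B - A \<in> psd_cone d"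

definition frob_norm :: "real mat \<Rightarrow> real" where
  "frob_norm A = sqrt (\<Sum>i<dim_row A. \<Sum>j<dim_col A. (A $$ (i, j))\<^sup>2)"

text \<open>Projection onto the PSD cone: the unique nearest point in Frobenius norm.\<close>

definition psd_proj :: "nat \<Rightarrow> real mat \<Rightarrow> real mat" where
  "psd_proj d M = (THE Z. Z \<in> psd_cone d \<and> (\<forall>W \<in> psd_cone d. frob_norm (M - Z) \<le> frob_norm (M - W)))"

definition psd_sqrt :: "nat \<Rightarrow> real mat \<Rightarrow> real mat" where
  "psd_sqrt d A = (THE B. B \<in> psd_cone d \<and> B * B = A)"

definition inv_sqrt :: "nat \<Rightarrow> real mat \<Rightarrow> real mat" where
  "inv_sqrt d A = the (mat_inverse (psd_sqrt d A))"

abbreviation is_subspace :: "nat \<Rightarrow> real vec set \<Rightarrow> bool" where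
  "is_subspace d V \<equiv> VectorSpace.subspace class_ring V (module_vec TYPE(real) d)"

abbreviation vspan :: "nat \<Rightarrow> real vec set \<Rightarrow> real vec set" where
  "vspan d \<equiv> LinearCombinations.module.span class_ring (module_vec TYPE(real) d)"

abbreviation orth_compl :: "nat \<Rightarrow> real vec set \<Rightarrow> real vec set" where
  "orth_compl d V \<equiv> vec_module.orthogonal_complement d V"

definition orth_proj :: "nat \<Rightarrow> real vec set \<Rightarrow> real mat" where
  "orth_proj d V = (THE P. P \<in> carrier_mat d d \<and>
     (\<forall>x \<in> carrier_vec d. P *\<^sub>v x \<in> V \<and> x - P *\<^sub>v x \<in> orth_compl d V))"

text \<open>\<open>(1/n) \<Sum>\<^bsub>k \<in> S\<^esub> X\<^sub>k X\<^sub>k\<^sup>T\<close>\<close>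

definition second_moment :: "nat \<Rightarrow> nat \<Rightarrow> nat set \<Rightarrow> (nat \<Rightarrow> real vec) \<Rightarrow> real mat" where
  "second_moment d n S X = mat d d (\<lambda>(i, j). (\<Sum>k\<in>S. X k $ i * X k $ j) / real n)"

section \<open>Measurable spaces\<close>

definition vec_borel :: "nat \<Rightarrow> real vec measure" where
  "vec_borel d = vimage_algebra (carrier_vec d) (\<lambda>v. \<lambda>i\<in>{..<d}. v $ i) (\<Pi>\<^sub>M i\<in>{..<d}. borel)"

definition sym_borel :: "nat \<Rightarrow> real mat measure" where
  "sym_borel d = vimage_algebra (sym_mats d) (\<lambda>A. \<lambda>p\<in>{..<d} \<times> {..<d}. A $$ p)
     (\<Pi>\<^sub>M p\<in>{..<d} \<times> {..<d}. borel)"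

text \<open>A subspace is identified with its orthogonal projection, which embeds the
  Grassmannian in the symmetric matrices.\<close>

definition subspace_borel :: "nat \<Rightarrow> real vec set measure" where
  "subspace_borel d = vimage_algebra {V. is_subspace d V} (orth_proj d) (sym_borel d)"

section \<open>Gaussian distributions\<close>

text \<open>The case \<open>v = 0\<close> (where \<^const>\<open>normal_density\<close> vanishes) is needed because the noise scale
  of the algorithm is \<open>0\<close> when \<open>\<beta> = n\<close>.\<close>

definition normal_dist :: "real \<Rightarrow> real \<Rightarrow> real measure" where
  "normal_dist \<mu> v = (if v = 0 then return borel \<mu>
     else density lborel (\<lambda>x. ennreal (normal_density \<mu> (sqrt v) x)))"

text \<open>\<open>N(0, \<Sigma>)\<close> as the law of \<open>\<Sigma>\<^sup>1\<^sup>/\<^sup>2 g\<close> for a standard Gaussian vector \<open>g\<close>.\<close>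

definition mv_normal :: "nat \<Rightarrow> real mat \<Rightarrow> real vec measure" where
  "mv_normal d \<Sigma> = distr (\<Pi>\<^sub>M i\<in>{..<d}. normal_dist 0 1) (vec_borel d)
     (\<lambda>g. psd_sqrt d \<Sigma> *\<^sub>v vec d g)"

definition GUE :: "nat \<Rightarrow> real \<Rightarrow> real mat measure" where
  "GUE d v = distr (\<Pi>\<^sub>M p\<in>{(i, j). i \<le> j \<and> j < d}. normal_dist 0 v) (sym_borel d)
     (\<lambda>g. mat d d (\<lambda>(i, j). g (min i j, max i j)))"

section \<open>Zero-concentrated differential privacy\<close>

text \<open>\<open>D\<^sub>\<alpha>(P\<parallel>Q) = ln (\<integral> (dP/dQ)\<^sup>\<alpha> dQ) / (\<alpha> - 1)\<close> for \<open>\<alpha> > 1\<close>, infinite unless \<open>P\<close> is absolutely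
  continuous with respect to \<open>Q\<close>.\<close>

definition renyi_divergence :: "real \<Rightarrow> 'a measure \<Rightarrow> 'a measure \<Rightarrow> ereal" where
  "renyi_divergence \<alpha> P Q =
     (let I = \<integral>\<^sup>+ x. ennreal (enn2real (RN_deriv Q P x) powr \<alpha>) \<partial>Q
      in if absolutely_continuous Q P \<and> I < \<infinity> then ereal (ln (enn2real I) / (\<alpha> - 1)) else \<infinity>)"

text \<open>Datasets are families indexed by \<open>{..<n}\<close> with entries in \<open>U\<close>.\<close>

definition neighbouring :: "nat \<Rightarrow> (nat \<Rightarrow> 'x) \<Rightarrow> (nat \<Rightarrow> 'x) \<Rightarrow> bool" where
  "neighbouring n X X' \<longleftrightarrow> (\<exists>j<n. \<forall>i<n. i \<noteq> j \<longrightarrow> X i = X' i)"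

definition zCDP :: "real \<Rightarrow> nat \<Rightarrow> 'x set \<Rightarrow> ((nat \<Rightarrow> 'x) \<Rightarrow> 'y measure) \<Rightarrow> bool" where
  "zCDP \<rho> n U M \<longleftrightarrow> (\<forall>X \<in> {..<n} \<rightarrow> U. \<forall>X' \<in> {..<n} \<rightarrow> U. neighbouring n X X' \<longrightarrow>
     (\<forall>\<alpha>>1. renyi_divergence \<alpha> (M X) (M X') \<le> ereal (\<rho> * \<alpha>)))"

section \<open>The algorithms\<close>

text \<open>A randomised algorithm maps its input to the distribution of its output. The parameters \<open>cS\<close>
  and \<open>c\<sigma>\<close> are the constants hidden in the \<open>O\<close> of the truncation threshold and in the
  \<open>\<Theta>\<close> of the noise scale.\<close>

definition trunc_set :: "real \<Rightarrow> real \<Rightarrow> real \<Rightarrow> nat \<Rightarrow> nat \<Rightarrow> (nat \<Rightarrow> real vec) \<Rightarrow> nat set" where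
  "trunc_set cS \<beta> \<kappa> d n X = {i \<in> {..<n}. X i \<bullet> X i \<le> cS * (real d * \<kappa> * ln (real n / \<beta>))}"

definition noise_scale :: "real \<Rightarrow> real \<Rightarrow> real \<Rightarrow> real \<Rightarrow> nat \<Rightarrow> nat \<Rightarrow> real" where
  "noise_scale c\<sigma> \<rho> \<beta> \<kappa> d n = c\<sigma> * (real d * \<kappa> * ln (real n / \<beta>) / (real n * sqrt \<rho>))"

definition NaivePCE ::
  "real \<Rightarrow> real \<Rightarrow> real \<Rightarrow> real \<Rightarrow> real \<Rightarrow> nat \<Rightarrow> nat \<Rightarrow> (nat \<Rightarrow> real vec) \<Rightarrow> real mat measure" where
  "NaivePCE cS c\<sigma> \<rho> \<beta> \<kappa> d n X = distr (GUE d ((noise_scale c\<sigma> \<rho> \<beta> \<kappa> d n)\<^sup>2)) (sym_borel d)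
     (\<lambda>N. psd_proj d (second_moment d n (trunc_set cS \<beta> \<kappa> d n X) X + N))"

text \<open>Taking all eigenvectors for eigenvalues \<open>\<ge> \<kappa>/2\<close>, rather than those in a chosen orthonormal
  eigenbasis, spans the same subspace and makes it independent of that choice.\<close>

definition top_eigenspace :: "nat \<Rightarrow> real \<Rightarrow> real mat \<Rightarrow> real vec set" where
  "top_eigenspace d \<kappa> Z = vspan d {v. \<exists>l. eigenvector Z v l \<and> \<kappa> / 2 \<le> l}"

definition precond :: "nat \<Rightarrow> real \<Rightarrow> real vec set \<Rightarrow> real mat" where
  "precond d K V = (1 / sqrt K) \<cdot>\<^sub>m orth_proj d V + orth_proj d (orth_compl d V)"

definition WeakPPC ::
  "real \<Rightarrow> real \<Rightarrow> real \<Rightarrow> real \<Rightarrow> real \<Rightarrow> real \<Rightarrow> nat \<Rightarrow> nat \<Rightarrow> (nat \<Rightarrow> real vec)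
    \<Rightarrow> (real vec set \<times> real mat) measure" where
  "WeakPPC cS c\<sigma> \<rho> \<beta> \<kappa> K d n X =
     distr (NaivePCE cS c\<sigma> \<rho> \<beta> \<kappa> d n X) (subspace_borel d \<Otimes>\<^sub>M sym_borel d)
       (\<lambda>Z. let V = top_eigenspace d \<kappa> Z in (V, precond d K V))"

section \<open>Conditions on the sample\<close>

definition sample_conditions ::
  "real \<Rightarrow> real \<Rightarrow> real \<Rightarrow> real \<Rightarrow> nat \<Rightarrow> nat \<Rightarrow> real mat \<Rightarrow> (nat \<Rightarrow> real vec) \<Rightarrow> bool" where
  "sample_conditions c\<^sub>1 c\<^sub>2 c\<^sub>3 \<beta> d n \<Sigma> X \<longleftrightarrow>
     (let Y = (\<lambda>i. inv_sqrt d \<Sigma> *\<^sub>v X i);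
          S\<^sub>Y = second_moment d n {..<n} Y;
          r = c\<^sub>2 * sqrt ((real d + ln (1 / \<beta>)) / real n)
      in (\<forall>i<n. Y i \<bullet> Y i \<le> c\<^sub>1 * (real d * ln (real n / \<beta>))) \<and>
         loewner_le d ((1 - r) \<cdot>\<^sub>m 1\<^sub>m d) S\<^sub>Y \<and> loewner_le d S\<^sub>Y ((1 + r) \<cdot>\<^sub>m 1\<^sub>m d) \<and>
         frob_norm (1\<^sub>m d - S\<^sub>Y) \<le> c\<^sub>3 * sqrt (((real d)\<^sup>2 + ln (1 / \<beta>)) / real n))"

section \<open>Error terms\<close>

definition err_\<phi> :: "real \<Rightarrow> real \<Rightarrow> real \<Rightarrow> nat \<Rightarrow> nat \<Rightarrow> real" where
  "err_\<phi> c \<rho> \<beta> d n =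
     c * (real d powr (3/2) * ln (real n / \<beta>) * ln (1 / \<beta>) / (real n * sqrt \<rho>))"

definition err_\<psi> :: "real \<Rightarrow> real \<Rightarrow> nat \<Rightarrow> nat \<Rightarrow> real" where
  "err_\<psi> c \<beta> d n = c * sqrt ((real d + ln (1 / \<beta>)) / real n)"

text \<open>Meaningful for \<open>\<phi> \<noteq> 1/2\<close> only: at \<open>\<phi> = 1/2\<close> both quotients are infinite in the intended sense,
  but \<open>x / 0 = 0\<close> here.\<close>

definition err_\<Gamma> :: "real \<Rightarrow> real \<Rightarrow> real \<Rightarrow> real" where
  "err_\<Gamma> K \<kappa> \<phi> = max (2 * K / ((1/2 - \<phi>) * \<kappa>)) (16 * K * \<phi>\<^sup>2 / (1/2 - \<phi>)\<^sup>2)"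

end

theory Submission
  imports Defs "Jordan_Normal_Form.Spectral_Radius"
begin

text \<open>Privacy is the Gaussian mechanism: replacing one sample moves the truncated second moment by at most
  twice the truncation threshold over \<open>n\<close> in Frobenius norm, and everything after adding the noise is
  post-processing. For accuracy, condition (i) makes the truncation inactive and condition (ii) turns the
  empirical second moment into \<open>\<Sigma>\<close> up to factors \<open>1 \<plusminus> r\<close>, so that the noisy matrix \<open>M\<close> is within \<open>\<eta>\<kappa>\<close> of it in
  operator norm. The preconditioner \<open>A\<close> commutes with \<open>M\<close>. For \<open>K > 1\<close> and \<open>r \<le> 1/2\<close> this bounds \<open>A \<Sigma> A\<close> from
  above; otherwise \<open>\<Sigma> \<preceq> \<kappa> I\<close> is enough. For the lower bound split \<open>A x = a + b\<close> along \<open>V\<close> and its complement,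
  and compare \<open>K |a|\<^sup>2\<close> with \<open>\<Gamma> |b|\<^sup>2\<close>: if it is smaller, \<open>\<Sigma> \<succeq> I\<close> suffices, and otherwise the cross term, which
  is pure noise, is absorbed by the large quadratic form on \<open>V\<close>.\<close>


section \<open>Spectral decomposition of real symmetric matrices\<close>

text \<open>Two matters outside that outline shape the development. The outputs are random subspaces
  and matrices, so every spectral construction must be measurable although eigenvectors admit no
  canonical choice. Each construction is therefore identified with f(A) for a scalar function f that
  is a pointwise limit of polynomials, and polynomials in A have measurable entries. The second
  matter is the operator norm of the noise, which has to be of order sqrt d with constants uniform
  in d; bounding the entries alone would lose about another factor sqrt d. Vectors are scaled to
  squared norm d, and the off-diagonal quadratic form, affine in each coordinate, does not decrease
  under a suitable rounding to integer points, of which there are only exponentially many in d.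
  Constants: the noise constant 2 \<open>c\<^sub>1\<close> times the operator norm factor 128,
  doubled because the upper bound spends the noise twice, gives 512 \<open>c\<^sub>1\<close>; the 8
  in \<open>\<psi>\<close> absorbs the inversion of 1 - r. The accuracy fails only through the
  noise, with probability at most 2 \<beta>; for \<beta> \<ge> 1/2 there is nothing to
  prove.\<close>

lemma scalar_prod_self_nonneg: "0 \<le> v \<bullet> (v :: real vec)"
  by (auto simp: scalar_prod_def intro!: sum_nonneg)

lemma scalar_prod_self_eq_0_iff:
  "v \<in> carrier_vec d \<Longrightarrow> v \<bullet> v = 0 \<longleftrightarrow> v = 0\<^sub>v d" for v :: "real vec"
  by (auto simp: scalar_prod_def sum_nonneg_eq_0_iff intro!: eq_vecI)

lemma sym_matsD:
  assumes "A \<in> sym_mats d"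
  shows "A \<in> carrier_mat d d" "A\<^sup>T = A"
  using assms by (auto simp: sym_mats_def)

lemma sym_mats_index:
  "A \<in> sym_mats d \<longleftrightarrow> A \<in> carrier_mat d d \<and> (\<forall>i<d. \<forall>j<d. A $$ (i, j) = A $$ (j, i))"
  by (auto simp: sym_mats_def mat_eq_iff)

lemma sym_mats_scalar_prod:
  assumes "A \<in> sym_mats d" "x \<in> carrier_vec d" "y \<in> carrier_vec d"
  shows "(A *\<^sub>v x) \<bullet> y = x \<bullet> (A *\<^sub>v y)"
  using transpose_vec_mult_scalar[of A d d y x] assms by (simp add: sym_mats_def)

text \<open>A complex eigenvalue exists, and pairing \<open>v\<close> with its conjugate shows that
  it is real. The complex eigenvector need not be real, so the eigenvalue is carried back to the
  real matrix through the characteristic polynomial.\<close>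

lemma real_symmetric_eigenvector:
  assumes A: "A \<in> sym_mats d" and d: "d > 0"
  shows "\<exists>v l. eigenvector A v (l :: real)"
proof -
  let ?B = "map_mat complex_of_real A"
  have Ac: "A \<in> carrier_mat d d" using A by (rule sym_matsD)
  then have Bc: "?B \<in> carrier_mat d d" by auto
  obtain c where "eigenvalue ?B c"
    using spectrum_non_empty[OF Bc] d by (auto simp: spectrum_def)
  then obtain v where v: "v \<in> carrier_vec d" "v \<noteq> 0\<^sub>v d" "?B *\<^sub>v v = c \<cdot>\<^sub>v v"
    using Bc by (auto simp: eigenvalue_def eigenvector_def)
  have Bsym: "?B\<^sup>T = ?B" using sym_matsD(2)[OF A] by (simp add: map_mat_transpose)
  let ?w = "conjugate v"
  have w: "?w \<in> carrier_vec d" using v by simp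
  have Bw: "?B *\<^sub>v ?w = cnj c \<cdot>\<^sub>v ?w"
  proof -
    have "conjugate (?B *\<^sub>v v) = ?B *\<^sub>v ?w"
      using Ac v(1) by (auto intro!: eq_vecI simp: scalar_prod_def)
    then show ?thesis unfolding v(3) by (simp add: conjugate_smult_vec)
  qed
  have "c * (?w \<bullet> v) = ?w \<bullet> (?B *\<^sub>v v)"
    using v w by simp
  also have "\<dots> = (?B *\<^sub>v ?w) \<bullet> v"
    using transpose_vec_mult_scalar[OF Bc v(1) w] Bsym by simp
  also have "\<dots> = cnj c * (?w \<bullet> v)"
    unfolding Bw using v w by simp
  finally have "c * (?w \<bullet> v) = cnj c * (?w \<bullet> v)" .
  moreover have "?w \<bullet> v \<noteq> 0"
    using conjugate_square_eq_0_vec[OF v(1)] v w by (simp add: comm_scalar_prod[OF w v(1)])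
  ultimately have "c = cnj c" by simp
  then obtain l where l: "c = complex_of_real l"
    by (metis Reals_cnj_iff Reals_cases)
  have "poly (char_poly ?B) (complex_of_real l) = 0"
    using \<open>eigenvalue ?B c\<close> l eigenvalue_root_char_poly[OF Bc] by simp
  then have "poly (char_poly A) l = 0"
    by (simp add: of_real_hom.char_poly_hom[OF Ac] of_real_hom.poly_map_poly)
  then have "eigenvalue A l" using eigenvalue_root_char_poly[OF Ac] by simp
  then show ?thesis by (auto simp: eigenvalue_def)
qed

lemma real_symmetric_unit_eigenvector:
  assumes A: "A \<in> sym_mats d" and d: "d > 0"
  shows "\<exists>v \<in> carrier_vec d. \<exists>l. v \<bullet> v = 1 \<and> A *\<^sub>v v = l \<cdot>\<^sub>v (v :: real vec)"
proof -
  obtain v l where v: "v \<in> carrier_vec d" "v \<noteq> 0\<^sub>v d" "A *\<^sub>v v = l \<cdot>\<^sub>v v"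
    using real_symmetric_eigenvector[OF assms] sym_matsD(1)[OF A] by (auto simp: eigenvector_def)
  then have pos: "v \<bullet> v > 0"
    using scalar_prod_self_nonneg[of v] scalar_prod_self_eq_0_iff[of v d] by linarith
  define w where "w = (1 / sqrt (v \<bullet> v)) \<cdot>\<^sub>v v"
  have "w \<bullet> w = 1" using pos v(1) by (simp add: w_def)
  moreover have "A *\<^sub>v w = l \<cdot>\<^sub>v w"
    using mult_mat_vec[OF sym_matsD(1)[OF A] v(1)] v by (simp add: w_def smult_smult_assoc mult.commute)
  ultimately show ?thesis using v(1) by (auto simp: w_def intro!: bexI[of _ w])
qed

lemma eq_mat_mult_vecI:
  assumes "A \<in> carrier_mat m n" "B \<in> carrier_mat m n"
    and "\<And>x. x \<in> carrier_vec n \<Longrightarrow> A *\<^sub>v x = B *\<^sub>v (x :: 'a :: semiring_1 vec)"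
  shows "A = B"
proof (rule eq_matI)
  fix i j assume "i < dim_row B" "j < dim_col B"
  then have ij: "i < m" "j < n" using assms(2) by auto
  have "(C *\<^sub>v unit_vec n j) $ i = C $$ (i, j)" if "C \<in> carrier_mat m n" for C :: "'a mat"
    using that ij by (simp add: carrier_vecD)
  then show "A $$ (i, j) = B $$ (i, j)"
    using assms(3)[of "unit_vec n j"] assms(1,2) by (metis unit_vec_carrier)
qed (use assms in auto)

text \<open>The reflection in the hyperplane orthogonal to v - e exchanges the unit vectors v and e.
  It supplies an orthogonal change of basis in closed form, without completing \<open>v\<close> to
  an orthonormal basis.\<close>

lemma householder:
  assumes v: "v \<in> carrier_vec n" "v \<bullet> v = (1 :: real)" and n: "n > 0"
  shows "\<exists>H \<in> sym_mats n. H * H = 1\<^sub>m n \<and> H *\<^sub>v unit_vec n 0 = v"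
proof -
  let ?e = "unit_vec n 0 :: real vec"
  define w where "w = v - ?e"
  have w: "w \<in> carrier_vec n" using v by (simp add: w_def)
  \<comment> \<open>If \<open>v\<close> is the unit vector itself, \<open>w\<close> is zero and 2 /
    0 = 0 turns \<open>H\<close> into the identity, so one formula covers both cases.\<close>
  define H where "H = mat n n (\<lambda>(i, j). of_bool (i = j) - 2 / (w \<bullet> w) * w $ i * w $ j)"
  have Hc: "H \<in> carrier_mat n n" by (simp add: H_def)
  have Hv: "H *\<^sub>v x = x - (2 * (w \<bullet> x) / (w \<bullet> w)) \<cdot>\<^sub>v w" if x: "x \<in> carrier_vec n" for x
  proof (rule eq_vecI)
    fix i assume "i < dim_vec (x - (2 * (w \<bullet> x) / (w \<bullet> w)) \<cdot>\<^sub>v w)"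
    then have i: "i < n" using w by simp
    have "(H *\<^sub>v x) $ i = (\<Sum>j<n. (of_bool (i = j) - 2 / (w \<bullet> w) * w $ i * w $ j) * x $ j)"
      using i x by (auto simp: H_def scalar_prod_def atLeast0LessThan)
    also have "\<dots> = (\<Sum>j<n. (if j = i then x $ j else 0) - 2 / (w \<bullet> w) * w $ i * (w $ j * x $ j))"
      by (intro sum.cong) (auto simp: left_diff_distrib)
    also have "\<dots> = x $ i - 2 / (w \<bullet> w) * w $ i * (\<Sum>j<n. w $ j * x $ j)"
      using i by (simp add: sum_subtractf sum_distrib_left)
    also have "(\<Sum>j<n. w $ j * x $ j) = w \<bullet> x"
      using x by (simp add: scalar_prod_def atLeast0LessThan)
    finally show "(H *\<^sub>v x) $ i = (x - (2 * (w \<bullet> x) / (w \<bullet> w)) \<cdot>\<^sub>v w) $ i"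
      using i x w by simp
  qed (use w Hc in auto)
  have HH: "H * H = 1\<^sub>m n"
  proof (rule eq_mat_mult_vecI)
    fix x :: "real vec" assume x: "x \<in> carrier_vec n"
    let ?c = "2 * (w \<bullet> x) / (w \<bullet> w)"
    have y: "x - ?c \<cdot>\<^sub>v w \<in> carrier_vec n" using x w by simp
    have "w \<bullet> (x - ?c \<cdot>\<^sub>v w) = (w \<bullet> x) - ?c * (w \<bullet> w)"
      using x w by (simp add: scalar_prod_minus_distrib)
    then have "w = 0\<^sub>v n \<or> w \<bullet> (x - ?c \<cdot>\<^sub>v w) = - (w \<bullet> x)"
      using scalar_prod_self_eq_0_iff[OF w] by (auto simp: field_simps)
    then have "H *\<^sub>v (H *\<^sub>v x) = x"
      unfolding Hv[OF x] Hv[OF y] using x w by (auto intro!: eq_vecI)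
    then show "(H * H) *\<^sub>v x = 1\<^sub>m n *\<^sub>v x"
      using x Hc by simp
  qed (use Hc in auto)
  have "H *\<^sub>v ?e = v"
  proof -
    have we: "w \<bullet> ?e = v $ 0 - 1" using n v by (simp add: w_def minus_scalar_prod_distrib[of _ n])
    have "w \<bullet> w = w \<bullet> v - w \<bullet> ?e" using v w by (simp add: w_def scalar_prod_minus_distrib[of _ n])
    moreover have "w \<bullet> v = 1 - v $ 0"
      using n v by (simp add: w_def minus_scalar_prod_distrib[of _ n])
    ultimately have ww: "w \<bullet> w = - 2 * (w \<bullet> ?e)" using we by simp
    show ?thesis
    proof (cases "w \<bullet> w = 0")
      case True
      then have "w = 0\<^sub>v n" using scalar_prod_self_eq_0_iff[OF w] by simp
      then show ?thesis unfolding Hv[OF unit_vec_carrier]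
        using v by (auto simp: w_def vec_eq_iff)
    next
      case False
      then have "2 * (w \<bullet> ?e) / (w \<bullet> w) = - 1" using ww by (simp add: field_simps)
      then show ?thesis unfolding Hv[OF unit_vec_carrier]
        using v w by (auto simp: w_def vec_eq_iff)
    qed
  qed
  then show ?thesis using HH
    by (intro bexI[of _ H]) (auto simp: sym_mats_index H_def)
qed

text \<open>The decomposition is a parameter and not a choice made inside definitions: what is
  proved here holds for every eigenbasis, which later shows independence of the basis. The
  eigenvalues are unordered.\<close>

locale eigen_system =
  fixes d :: nat and A :: "real mat" and u :: "nat \<Rightarrow> real vec" and l :: "nat \<Rightarrow> real"
  assumes sym: "A \<in> sym_mats d"
    and u_carrier: "k < d \<Longrightarrow> u k \<in> carrier_vec d"
    and eigen: "k < d \<Longrightarrow> A *\<^sub>v u k = l k \<cdot>\<^sub>v u k"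
    and orthonormal: "i < d \<Longrightarrow> j < d \<Longrightarrow> u i \<bullet> u j = of_bool (i = j)"

text \<open>Deflation: a Householder reflection moves a unit eigenvector to the first coordinate
  vector, so the conjugated matrix \<open>B\<close> has first column \<open>l0\<close> times that
  vector. Symmetry clears the first row as well, and the induction hypothesis diagonalises the
  remaining block \<open>C\<close>.\<close>

theorem spectral_theorem:
  "A \<in> sym_mats d \<Longrightarrow> \<exists>u l. eigen_system d A u l"
proof (induction d arbitrary: A)
  case 0
  then show ?case by (auto simp: eigen_system_def)
next
  case (Suc d)
  let ?n = "Suc d"
  let ?e = "unit_vec ?n 0 :: real vec"
  note A = sym_matsD[OF Suc.prems]
  obtain v l0 where v: "v \<in> carrier_vec ?n" "v \<bullet> v = 1" "A *\<^sub>v v = l0 \<cdot>\<^sub>v v"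
    using real_symmetric_unit_eigenvector[OF Suc.prems] by auto
  obtain H where H: "H \<in> sym_mats ?n" "H * H = 1\<^sub>m ?n" "H *\<^sub>v ?e = v"
    using householder[OF v(1,2)] by auto
  note Hc = sym_matsD[OF H(1)]
  have HHx: "H *\<^sub>v (H *\<^sub>v x) = x" if "x \<in> carrier_vec ?n" for x
    using that H(2) by (simp flip: assoc_mult_mat_vec[OF Hc(1) Hc(1)])
  define B where "B = H * A * H"
  have Bv: "B *\<^sub>v x = H *\<^sub>v (A *\<^sub>v (H *\<^sub>v x))" if "x \<in> carrier_vec ?n" for x
    using that Hc(1) A(1) by (simp add: B_def assoc_mult_mat_vec[of _ ?n ?n _ ?n])
  have Bc: "B \<in> carrier_mat ?n ?n" using Hc A by (simp add: B_def)
  have "B\<^sup>T = B" using Hc A by (simp add: B_def transpose_mult[of _ ?n ?n _ ?n])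
  then have Bsym: "B \<in> sym_mats ?n" using Bc by (simp add: sym_mats_def)
  have Be: "B *\<^sub>v ?e = l0 \<cdot>\<^sub>v ?e"
  proof -
    have "B *\<^sub>v ?e = H *\<^sub>v (l0 \<cdot>\<^sub>v v)" using Bv[of ?e] H(3) v(3) by simp
    also have "\<dots> = l0 \<cdot>\<^sub>v (H *\<^sub>v (H *\<^sub>v ?e))"
      using mult_mat_vec[OF Hc(1) v(1)] H(3) by simp
    finally show ?thesis using HHx by simp
  qed
  have Bi0: "B $$ (i, 0) = (if i = 0 then l0 else 0)" if "i < ?n" for i
  proof -
    have "B $$ (i, 0) = (B *\<^sub>v ?e) $ i" using that Bc by simp
    then show ?thesis unfolding Be using that by simp
  qed
  then have B0i: "B $$ (0, i) = (if i = 0 then l0 else 0)" if "i < ?n" for i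
    using that Bsym by (auto simp: sym_mats_index)
  define C where "C = mat d d (\<lambda>(i, j). B $$ (Suc i, Suc j))"
  have "C \<in> sym_mats d" using Bsym by (auto simp: sym_mats_index C_def)
  then obtain w m where wm: "eigen_system d C w m" using Suc.IH by blast
  \<comment> \<open>Eigenvectors of \<open>C\<close> receive a leading zero and are reflected back;
    \<open>H\<close> is symmetric and its own inverse, so inner products are preserved.\<close>
  define u where "u k = H *\<^sub>v (case k of 0 \<Rightarrow> ?e | Suc k \<Rightarrow> vCons 0 (w k))" for k
  define l where "l k = (case k of 0 \<Rightarrow> l0 | Suc k \<Rightarrow> m k)" for k
  let ?w = "\<lambda>k. case k of 0 \<Rightarrow> ?e | Suc k \<Rightarrow> vCons 0 (w k)"
  have wc: "?w k \<in> carrier_vec ?n" if "k < ?n" for k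
    using that wm by (auto simp: eigen_system_def split: nat.split)
  have e: "?e = vCons 1 (0\<^sub>v d)"
    by (auto simp: vec_eq_iff vec_index_vCons)
  have Bw: "B *\<^sub>v ?w k = l k \<cdot>\<^sub>v ?w k" if "k < ?n" for k
  proof (cases k)
    case 0
    then show ?thesis using Be by (simp add: l_def)
  next
    case (Suc k')
    then have k': "w k' \<in> carrier_vec d" "C *\<^sub>v w k' = m k' \<cdot>\<^sub>v w k'"
      using that wm by (auto simp: eigen_system_def)
    have row: "row B i = vCons (B $$ (i, 0)) (vec d (\<lambda>j. B $$ (i, Suc j)))" if "i < ?n" for i
      using that Bc by (auto simp: vec_eq_iff vec_index_vCons)
    have "(B *\<^sub>v vCons 0 (w k')) $ i = (m k' \<cdot>\<^sub>v vCons 0 (w k')) $ i" if "i < ?n" for i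
    proof (cases i)
      case 0
      have "vec d (\<lambda>j. B $$ (0, Suc j)) = 0\<^sub>v d" using B0i by (auto simp: vec_eq_iff)
      then show ?thesis using 0 Bc k'(1) by (simp add: row)
    next
      case (Suc i')
      then have "vec d (\<lambda>j. B $$ (i, Suc j)) = row C i'" using that by (auto simp: C_def vec_eq_iff)
      then have "(B *\<^sub>v vCons 0 (w k')) $ i = (C *\<^sub>v w k') $ i'"
        using Suc that Bc k'(1) by (simp add: row C_def)
      then show ?thesis using Suc that k' by simp
    qed
    then show ?thesis using Suc k'(1) Bc by (auto simp: l_def intro!: eq_vecI)
  qed
  have ww: "?w i \<bullet> ?w j = of_bool (i = j)" if "i < ?n" "j < ?n" for i j
    using that wm unfolding e by (auto simp: eigen_system_def split: nat.split)
  have "u i \<bullet> u j = of_bool (i = j)" if "i < ?n" "j < ?n" for i j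
    unfolding u_def
    using sym_mats_scalar_prod[OF H(1) wc[OF that(1)], of "H *\<^sub>v ?w j"] wc[OF that(2)] Hc(1)
      HHx[OF wc[OF that(2)]] ww[OF that] by simp
  moreover have "A *\<^sub>v u k = l k \<cdot>\<^sub>v u k" if "k < ?n" for k
  proof -
    have "H *\<^sub>v (B *\<^sub>v ?w k) = A *\<^sub>v u k"
      unfolding Bv[OF wc[OF that]] using wc[OF that] A Hc by (simp add: HHx u_def)
    then show ?thesis
      unfolding Bw[OF that] using mult_mat_vec[OF Hc(1) wc[OF that]] by (simp add: u_def)
  qed
  moreover have "u k \<in> carrier_vec ?n" if "k < ?n" for k
    unfolding u_def using wc[OF that] Hc(1) by simp
  ultimately show ?case using Suc.prems unfolding eigen_system_def by blast
qed


section \<open>Functional calculus for symmetric matrices\<close>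

definition spectral_map ::
  "nat \<Rightarrow> (nat \<Rightarrow> real vec) \<Rightarrow> (nat \<Rightarrow> real) \<Rightarrow> (real \<Rightarrow> real) \<Rightarrow> real mat" where
  "spectral_map d u l f = mat d d (\<lambda>(i, j). \<Sum>k<d. f (l k) * u k $ i * u k $ j)"

lemma spectral_map_carrier [simp]: "spectral_map d u l f \<in> carrier_mat d d"
  by (simp add: spectral_map_def)

lemma dim_spectral_map [simp]:
  "dim_row (spectral_map d u l f) = d" "dim_col (spectral_map d u l f) = d"
  by (simp_all add: spectral_map_def)

lemma spectral_map_sym [simp]: "spectral_map d u l f \<in> sym_mats d"
  by (auto simp: spectral_map_def sym_mats_index mult_ac)

lemma index_mult_mat_vec_sum:
  "A \<in> carrier_mat m n \<Longrightarrow> x \<in> carrier_vec n \<Longrightarrow> i < m \<Longrightarrow> (A *\<^sub>v x) $ i = (\<Sum>j<n. A $$ (i, j) * x $ j)"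
  by (auto simp: scalar_prod_def atLeast0LessThan)

lemma scalar_prod_sum: "y \<in> carrier_vec n \<Longrightarrow> x \<bullet> y = (\<Sum>i<n. x $ i * y $ i)"
  by (auto simp: scalar_prod_def atLeast0LessThan)

lemma scalar_prod_mat_sum:
  fixes A :: "real mat"
  assumes "A \<in> carrier_mat m n" "x \<in> carrier_vec m" "y \<in> carrier_vec n"
  shows "x \<bullet> (A *\<^sub>v y) = (\<Sum>i<m. \<Sum>j<n. A $$ (i, j) * x $ i * y $ j)"
proof -
  have "x \<bullet> (A *\<^sub>v y) = (\<Sum>i<m. x $ i * (A *\<^sub>v y) $ i)"
    using assms by (simp add: scalar_prod_sum[of _ m])
  also have "\<dots> = (\<Sum>i<m. \<Sum>j<n. A $$ (i, j) * x $ i * y $ j)"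
    using assms by (intro sum.cong refl)
      (simp add: index_mult_mat_vec_sum[of _ m n] sum_distrib_left mult_ac del: index_mult_mat_vec)
  finally show ?thesis .
qed

context eigen_system
begin

abbreviation smap :: "(real \<Rightarrow> real) \<Rightarrow> real mat" where
  "smap \<equiv> spectral_map d u l"

lemma A_carrier: "A \<in> carrier_mat d d"
  using sym by (rule sym_matsD)

lemma scalar_prod_smap:
  assumes x: "x \<in> carrier_vec d" and y: "y \<in> carrier_vec d"
  shows "x \<bullet> (smap f *\<^sub>v y) = (\<Sum>k<d. f (l k) * (u k \<bullet> x) * (u k \<bullet> y))"
proof -
  have "x \<bullet> (smap f *\<^sub>v y) = (\<Sum>i<d. \<Sum>j<d. \<Sum>k<d. f (l k) * (u k $ i * x $ i) * (u k $ j * y $ j))"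
    unfolding scalar_prod_mat_sum[OF spectral_map_carrier x y]
    by (intro sum.cong refl)
      (simp add: spectral_map_def sum_distrib_right, intro sum.cong refl, simp)
  also have "\<dots> = (\<Sum>i<d. \<Sum>k<d. \<Sum>j<d. f (l k) * (u k $ i * x $ i) * (u k $ j * y $ j))"
    by (intro sum.cong refl sum.swap)
  also have "\<dots> = (\<Sum>k<d. \<Sum>i<d. \<Sum>j<d. f (l k) * (u k $ i * x $ i) * (u k $ j * y $ j))"
    by (rule sum.swap)
  also have "\<dots> = (\<Sum>k<d. f (l k) * (u k \<bullet> x) * (u k \<bullet> y))"
    using x y by (simp add: scalar_prod_sum[of _ d] sum_product sum_distrib_left sum_distrib_right mult_ac)
  finally show ?thesis .
qed

text \<open>Completeness of the eigenbasis: orthonormality says that the transpose of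
  \<open>U\<close> is a left inverse, and for square matrices a left inverse is a right
  inverse.\<close>

lemma smap_1: "smap (\<lambda>_. 1) = 1\<^sub>m d"
proof -
  define U where "U = mat d d (\<lambda>(i, k). u k $ i)"
  have Uc: "U \<in> carrier_mat d d" by (simp add: U_def)
  have col: "col U k = u k" if "k < d" for k
    using that u_carrier[OF that] by (auto simp: U_def vec_eq_iff)
  have "U\<^sup>T * U = 1\<^sub>m d"
    using Uc col orthonormal by (intro eq_matI) auto
  then have "U * U\<^sup>T = 1\<^sub>m d"
    using mat_mult_left_right_inverse[of "U\<^sup>T" d U] Uc by simp
  moreover have "U * U\<^sup>T = smap (\<lambda>_. 1)"
    using Uc by (intro eq_matI) (auto simp: spectral_map_def U_def scalar_prod_def atLeast0LessThan)
  ultimately show ?thesis by simp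
qed

lemma parseval:
  assumes "x \<in> carrier_vec d" "y \<in> carrier_vec d"
  shows "x \<bullet> y = (\<Sum>k<d. (u k \<bullet> x) * (u k \<bullet> y))"
  using scalar_prod_smap[OF assms, of "\<lambda>_. 1"] assms by (simp add: smap_1)

lemma vec_eqI:
  assumes "x \<in> carrier_vec d" "y \<in> carrier_vec d" "\<And>k. k < d \<Longrightarrow> u k \<bullet> x = u k \<bullet> y"
  shows "x = y"
proof -
  have "z \<bullet> (x - y) = 0" if "z \<in> carrier_vec d" for z
    using that assms parseval[OF that, of x] parseval[OF that, of y]
    by (simp add: scalar_prod_minus_distrib[of _ d])
  then have "x - y = 0\<^sub>v d"
    using assms(1,2) by (subst scalar_prod_self_eq_0_iff[symmetric]) auto
  then have "(x - y) $ i = 0" if "i < d" for i using that by simp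
  then show ?thesis using assms(1,2) by (auto simp: vec_eq_iff)
qed

lemma mat_eqI:
  assumes "B \<in> carrier_mat d d" "C \<in> carrier_mat d d"
    and "\<And>k x. k < d \<Longrightarrow> x \<in> carrier_vec d \<Longrightarrow> u k \<bullet> (B *\<^sub>v x) = u k \<bullet> (C *\<^sub>v x)"
  shows "B = C"
  using assms by (intro eq_mat_mult_vecI[of _ d d]) (auto intro!: vec_eqI)

lemma coeff_A:
  assumes "k < d" "x \<in> carrier_vec d"
  shows "u k \<bullet> (A *\<^sub>v x) = l k * (u k \<bullet> x)"
  using sym_mats_scalar_prod[OF sym u_carrier[OF assms(1)] assms(2)] u_carrier[OF assms(1)] assms
  by (simp add: eigen)

lemma coeff_smap:
  assumes "k < d" "x \<in> carrier_vec d"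
  shows "u k \<bullet> (smap f *\<^sub>v x) = f (l k) * (u k \<bullet> x)"
proof -
  have "u k \<bullet> (smap f *\<^sub>v x) = (\<Sum>j<d. if j = k then f (l k) * (u k \<bullet> x) else 0)"
    unfolding scalar_prod_smap[OF u_carrier[OF assms(1)] assms(2)]
    using assms by (intro sum.cong) (auto simp: orthonormal)
  then show ?thesis using assms by simp
qed

lemma smap_id: "smap (\<lambda>x. x) = A"
  by (rule mat_eqI) (auto simp: A_carrier coeff_A coeff_smap)

lemma smap_cong: "(\<And>k. k < d \<Longrightarrow> f (l k) = g (l k)) \<Longrightarrow> smap f = smap g"
  by (auto simp: spectral_map_def)

lemma smap_mult: "smap f * smap g = smap (\<lambda>x. f x * g x)"
  proof (rule mat_eqI)
  fix k and x :: "real vec" assume kx: "k < d" "x \<in> carrier_vec d"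
  have "smap g *\<^sub>v x \<in> carrier_vec d" using kx by (intro mult_mat_vec_carrier) auto
  then show "u k \<bullet> (smap f * smap g *\<^sub>v x) = u k \<bullet> (smap (\<lambda>x. f x * g x) *\<^sub>v x)"
    using kx by (simp add: coeff_smap assoc_mult_mat_vec[of _ d d _ d])
qed (auto intro!: mult_carrier_mat[of _ d d _ d])

lemma smap_power: "smap (\<lambda>x. x ^ k) = A ^\<^sub>m k"
proof (induction k)
  case 0
  then show ?case using A_carrier by (simp add: smap_1)
next
  case (Suc k)
  have "smap (\<lambda>x. x ^ Suc k) = smap (\<lambda>x. x ^ k) * smap (\<lambda>x. x)"
    by (simp add: smap_mult mult.commute)
  then show ?case by (simp add: Suc.IH smap_id)
qed

lemma smap_psd:
  assumes "\<And>k. k < d \<Longrightarrow> 0 \<le> f (l k)"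
  shows "smap f \<in> psd_cone d"
  using assms by (auto simp: psd_cone_def scalar_prod_smap mult.assoc intro!: sum_nonneg)

lemma smap_diff: "smap f - smap g = smap (\<lambda>x. f x - g x)"
  by (intro eq_matI) (auto simp: spectral_map_def sum_subtractf left_diff_distrib)

lemma quadratic_form: "x \<in> carrier_vec d \<Longrightarrow> x \<bullet> (A *\<^sub>v x) = (\<Sum>k<d. l k * (u k \<bullet> x)\<^sup>2)"
  using scalar_prod_smap[of x x "\<lambda>x. x"] by (simp add: smap_id power2_eq_square mult.assoc)

lemma eigenvalue_eq: "k < d \<Longrightarrow> u k \<bullet> (A *\<^sub>v u k) = l k"
  by (simp add: coeff_A u_carrier orthonormal)

text \<open>Applying f keeps the basis and changes only the eigenvalues, so the lemmas of this
  locale can be reused for the PSD projection of the noisy matrix.\<close>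

lemma eigen_system_smap: "eigen_system d (smap f) u (\<lambda>k. f (l k))"
proof
  fix k assume k: "k < d"
  show "smap f *\<^sub>v u k = f (l k) \<cdot>\<^sub>v u k"
    using k by (intro vec_eqI) (auto simp: u_carrier coeff_smap orthonormal scalar_prod_smult_distrib[of _ d]
          intro!: mult_mat_vec_carrier[of _ d d])
qed (auto simp: u_carrier orthonormal)

end

lemma psd_coneD: "A \<in> psd_cone d \<Longrightarrow> A \<in> sym_mats d"
  by (simp add: psd_cone_def)

lemma (in eigen_system) psd_eigenvalue:
  "A \<in> psd_cone d \<Longrightarrow> k < d \<Longrightarrow> 0 \<le> l k"
  using eigenvalue_eq[of k] u_carrier[of k] by (auto simp: psd_cone_def)

section \<open>Projections expressed through an eigenbasis\<close>

definition frob_inner :: "nat \<Rightarrow> real mat \<Rightarrow> real mat \<Rightarrow> real" where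
  "frob_inner d A B = (\<Sum>i<d. \<Sum>j<d. A $$ (i, j) * B $$ (i, j))"

lemma frob_norm_nonneg: "0 \<le> frob_norm A"
  by (simp add: frob_norm_def sum_nonneg)

lemma frob_norm_sq:
  "A \<in> carrier_mat d d \<Longrightarrow> (frob_norm A)\<^sup>2 = frob_inner d A A"
  by (simp add: frob_norm_def frob_inner_def sum_nonneg power2_eq_square)

lemma frob_inner_self_eq_0:
  assumes "A \<in> carrier_mat d d" "frob_inner d A A \<le> 0"
  shows "A = 0\<^sub>m d d"
proof -
  have "frob_inner d A A = 0" using assms(2) by (intro antisym) (auto simp: frob_inner_def sum_nonneg)
  then have "\<forall>i<d. \<forall>j<d. A $$ (i, j) = 0"
    by (simp add: frob_inner_def sum_nonneg_eq_0_iff sum_nonneg)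
  then show ?thesis using assms(1) by (intro eq_matI) auto
qed

context eigen_system
begin

text \<open>Frobenius inner products are traces, evaluated here in the eigenbasis; this exposes the
  sign of the inner product between a negative part and a PSD matrix.\<close>

lemma frob_inner_smap:
  assumes "B \<in> carrier_mat d d"
  shows "frob_inner d (smap f) B = (\<Sum>k<d. f (l k) * (u k \<bullet> (B *\<^sub>v u k)))"
proof -
  have "frob_inner d (smap f) B = (\<Sum>i<d. \<Sum>j<d. \<Sum>k<d. f (l k) * (B $$ (i, j) * u k $ i * u k $ j))"
    by (simp add: frob_inner_def spectral_map_def sum_distrib_right, intro sum.cong refl, simp)
  also have "\<dots> = (\<Sum>i<d. \<Sum>k<d. \<Sum>j<d. f (l k) * (B $$ (i, j) * u k $ i * u k $ j))"
    by (intro sum.cong refl sum.swap)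
  also have "\<dots> = (\<Sum>k<d. \<Sum>i<d. \<Sum>j<d. f (l k) * (B $$ (i, j) * u k $ i * u k $ j))"
    by (rule sum.swap)
  also have "\<dots> = (\<Sum>k<d. f (l k) * (u k \<bullet> (B *\<^sub>v u k)))"
    by (simp add: scalar_prod_mat_sum[OF assms u_carrier u_carrier] sum_distrib_left)
  finally show ?thesis .
qed

text \<open>The positive part \<open>A\<^sub>+\<close> is the nearest point of the cone because \<open>A - A\<^sub>+\<close> is orthogonal to
  \<open>A\<^sub>+\<close> and has nonpositive inner product with every element of the cone.\<close>

lemma psd_proj_eq: "psd_proj d A = smap (\<lambda>x. max x 0)"
proof -
  let ?Z = "smap (\<lambda>x. max x 0)"
  have Z: "?Z \<in> psd_cone d" by (rule smap_psd) simp
  have AZ: "A - ?Z = smap (\<lambda>x. min x 0)"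
  proof -
    have "A - ?Z = smap (\<lambda>x. x) - ?Z" by (simp add: smap_id)
    also have "\<dots> = smap (\<lambda>x. x - max x 0)" by (rule smap_diff)
    finally show ?thesis by (simp add: max_def min_def if_distrib cong: if_cong)
  qed
  \<comment> \<open>The obtuse-angle inequality is kept with its quadratic remainder. Dropping the
    remainder gives minimality; a second minimiser forces it to vanish, which gives the uniqueness
    that \<open>THE\<close> needs.\<close>
  have le: "(frob_norm (A - ?Z))\<^sup>2 + frob_inner d (?Z - W) (?Z - W) \<le> (frob_norm (A - W))\<^sup>2"
    if W: "W \<in> psd_cone d" for W
  proof -
    have Wc: "W \<in> carrier_mat d d" using W by (auto simp: psd_cone_def sym_mats_def)
    have "frob_inner d (A - ?Z) ?Z = 0"
      unfolding AZ frob_inner_smap[OF spectral_map_carrier]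
      by (intro sum.neutral) (auto simp: coeff_smap u_carrier max_def min_def)
    moreover have "frob_inner d (A - ?Z) W \<le> 0"
      unfolding AZ frob_inner_smap[OF Wc] using W u_carrier
      by (intro sum_nonpos mult_nonpos_nonneg) (auto simp: psd_cone_def)
    moreover have "(frob_norm (A - W))\<^sup>2 = frob_inner d (A - W) (A - W)"
      "(frob_norm (A - ?Z))\<^sup>2 = frob_inner d (A - ?Z) (A - ?Z)"
      using A_carrier Wc by (auto intro!: frob_norm_sq minus_carrier_mat)
    moreover have "frob_inner d (A - W) (A - W) = frob_inner d (A - ?Z) (A - ?Z)
       + 2 * (frob_inner d (A - ?Z) ?Z - frob_inner d (A - ?Z) W) + frob_inner d (?Z - W) (?Z - W)"
      unfolding frob_inner_def sum_distrib_left sum.distrib[symmetric] sum_subtractf[symmetric]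
      using A_carrier Wc
      by (intro sum.cong refl) (simp add: algebra_simps)
    ultimately have "(frob_norm (A - W))\<^sup>2 = (frob_norm (A - ?Z))\<^sup>2
        + 2 * (0 - frob_inner d (A - ?Z) W) + frob_inner d (?Z - W) (?Z - W)"
      by (simp only:)
    then show ?thesis using \<open>frob_inner d (A - ?Z) W \<le> 0\<close> by simp
  qed
  show ?thesis unfolding psd_proj_def
  proof (rule the_equality)
    show "?Z \<in> psd_cone d \<and> (\<forall>W\<in>psd_cone d. frob_norm (A - ?Z) \<le> frob_norm (A - W))"
    proof (intro conjI ballI Z)
      fix W assume W: "W \<in> psd_cone d"
      have "0 \<le> frob_inner d (?Z - W) (?Z - W)" by (auto simp: frob_inner_def sum_nonneg)
      with le[OF W] have "(frob_norm (A - ?Z))\<^sup>2 \<le> (frob_norm (A - W))\<^sup>2" by linarith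
      then show "frob_norm (A - ?Z) \<le> frob_norm (A - W)"
        by (rule power2_le_imp_le) (rule frob_norm_nonneg)
    qed
  next
    fix W assume "W \<in> psd_cone d \<and> (\<forall>W'\<in>psd_cone d. frob_norm (A - W) \<le> frob_norm (A - W'))"
    then have W: "W \<in> psd_cone d" and min: "frob_norm (A - W) \<le> frob_norm (A - ?Z)" using Z by auto
    have "(frob_norm (A - W))\<^sup>2 \<le> (frob_norm (A - ?Z))\<^sup>2"
      using min by (intro power_mono) (simp_all add: frob_norm_nonneg)
    with le[OF W] have "frob_inner d (?Z - W) (?Z - W) \<le> 0" by linarith
    moreover have Wc: "W \<in> carrier_mat d d" using W by (auto simp: psd_cone_def sym_mats_def)
    ultimately have "?Z - W = 0\<^sub>m d d" by (intro frob_inner_self_eq_0) auto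
    then have "(?Z - W) $$ (i, j) = 0" if "i < d" "j < d" for i j using that by simp
    then show "W = ?Z" using Wc by (intro eq_matI) auto
  qed
qed

text \<open>For uniqueness, an eigenvector of a competing root \<open>C\<close> with eigenvalue m is
  an eigenvector of \<open>A\<close> for m^2. It has components only along those \<open>u j\<close>
  with \<open>sqrt (l j) = m\<close>, where \<open>smap sqrt\<close> also acts as m; nonnegativity
  of m excludes the other sign.\<close>

lemma psd_sqrt_eq:
  assumes "A \<in> psd_cone d"
  shows "psd_sqrt d A = smap sqrt"
proof -
  have lk: "0 \<le> l k" if "k < d" for k using psd_eigenvalue assms that .
  show ?thesis unfolding psd_sqrt_def
  proof (rule the_equality)
    have "smap sqrt * smap sqrt = smap (\<lambda>x. x)"
      unfolding smap_mult by (rule smap_cong) (simp add: lk)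
    then show "smap sqrt \<in> psd_cone d \<and> smap sqrt * smap sqrt = A"
      by (auto simp: smap_id lk intro!: smap_psd)
  next
    fix C assume C: "C \<in> psd_cone d \<and> C * C = A"
    then obtain w m where "eigen_system d C w m" using spectral_theorem psd_coneD by blast
    then interpret C: eigen_system d C w m .
    have "smap sqrt *\<^sub>v w k = m k \<cdot>\<^sub>v w k" if k: "k < d" for k
    proof (rule vec_eqI)
      fix j assume j: "j < d"
      note wk = C.u_carrier[OF k]
      have m: "0 \<le> m k" using C.psd_eigenvalue C k by blast
      have "A *\<^sub>v w k = C *\<^sub>v (C *\<^sub>v w k)"
        using C wk C.A_carrier by (metis assoc_mult_mat_vec)
      also have "\<dots> = (m k * m k) \<cdot>\<^sub>v w k"
        using C.eigen[OF k] mult_mat_vec[OF C.A_carrier wk] by (simp add: smult_smult_assoc)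
      finally have "l j * (u j \<bullet> w k) = m k * m k * (u j \<bullet> w k)"
        using coeff_A[OF j wk] u_carrier[OF j] wk by auto
      then have "u j \<bullet> w k = 0 \<or> l j = m k * m k"
        by (metis mult_cancel_right)
      then have "u j \<bullet> w k = 0 \<or> sqrt (l j) = m k" using m by auto
      then show "u j \<bullet> (smap sqrt *\<^sub>v w k) = u j \<bullet> (m k \<cdot>\<^sub>v w k)"
        using coeff_smap[OF j wk] u_carrier[OF j] wk by auto
    qed (use C.u_carrier[OF k] mult_mat_vec_carrier[OF spectral_map_carrier] in auto)
    then have *: "w k \<bullet> (smap sqrt *\<^sub>v x) = m k * (w k \<bullet> x)" if "k < d" "x \<in> carrier_vec d" for k x
      using sym_mats_scalar_prod[OF spectral_map_sym C.u_carrier[OF that(1)] that(2), of u l sqrt]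
        that C.u_carrier by simp
    show "C = smap sqrt"
      by (rule C.mat_eqI) (auto simp: C.A_carrier C.coeff_A *)
  qed
qed

text \<open>Membership is expressed by vanishing coefficients and not by a span, so that the
  orthogonal complement becomes the negation of \<open>p\<close> and the projection becomes an
  indicator function of the spectrum.\<close>

definition spectral_space :: "(real \<Rightarrow> bool) \<Rightarrow> real vec set" where
  "spectral_space p = {x \<in> carrier_vec d. \<forall>k<d. \<not> p (l k) \<longrightarrow> u k \<bullet> x = 0}"

lemma orth_compl_spectral_space:
  "orth_compl d (spectral_space p) = spectral_space (\<lambda>x. \<not> p x)"
proof -
  have "u k \<in> spectral_space p" if "k < d" "p (l k)" for k
    using that by (auto simp: spectral_space_def u_carrier orthonormal)
  then have "orth_compl d (spectral_space p) \<subseteq> spectral_space (\<lambda>x. \<not> p x)"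
    unfolding vec_module.orthogonal_complement_def
    by (auto simp: spectral_space_def u_carrier comm_scalar_prod[of _ d])
  moreover have "spectral_space (\<lambda>x. \<not> p x) \<subseteq> orth_compl d (spectral_space p)"
  proof
    fix x assume x: "x \<in> spectral_space (\<lambda>x. \<not> p x)"
    have "x \<bullet> y = 0" if "y \<in> spectral_space p" for y
      using that x by (subst parseval) (auto simp: spectral_space_def intro!: sum.neutral)
    then show "x \<in> orth_compl d (spectral_space p)"
      using x unfolding vec_module.orthogonal_complement_def spectral_space_def by blast
  qed
  ultimately show ?thesis by (rule equalityI)
qed

lemma orth_proj_spectral_space:
  "orth_proj d (spectral_space p) = smap (\<lambda>x. of_bool (p x))"
proof -
  let ?P = "smap (\<lambda>x. of_bool (p x))"
  have P: "?P *\<^sub>v x \<in> spectral_space p" "x - ?P *\<^sub>v x \<in> orth_compl d (spectral_space p)"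
    if x: "x \<in> carrier_vec d" for x
  proof -
    have "?P *\<^sub>v x \<in> carrier_vec d" using mult_mat_vec_carrier[OF spectral_map_carrier x] .
    then show "?P *\<^sub>v x \<in> spectral_space p" "x - ?P *\<^sub>v x \<in> orth_compl d (spectral_space p)"
      using x unfolding orth_compl_spectral_space
      by (auto simp: spectral_space_def coeff_smap u_carrier scalar_prod_minus_distrib[of _ d])
  qed
  show ?thesis unfolding orth_proj_def
  proof (rule the_equality)
    show "?P \<in> carrier_mat d d \<and> (\<forall>x\<in>carrier_vec d. ?P *\<^sub>v x \<in> spectral_space p \<and>
        x - ?P *\<^sub>v x \<in> orth_compl d (spectral_space p))" using P by simp
  next
    fix Q assume Q: "Q \<in> carrier_mat d d \<and> (\<forall>x\<in>carrier_vec d. Q *\<^sub>v x \<in> spectral_space p \<and>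
        x - Q *\<^sub>v x \<in> orth_compl d (spectral_space p))"
    show "Q = ?P"
    proof (rule mat_eqI)
      fix k and x :: "real vec" assume k: "k < d" and x: "x \<in> carrier_vec d"
      have "Q *\<^sub>v x \<in> spectral_space p" "x - Q *\<^sub>v x \<in> spectral_space (\<lambda>x. \<not> p x)"
        using Q x by (auto simp: orth_compl_spectral_space)
      then show "u k \<bullet> (Q *\<^sub>v x) = u k \<bullet> (?P *\<^sub>v x)"
        using k x u_carrier[OF k] by (auto simp: spectral_space_def coeff_smap scalar_prod_minus_distrib[of _ d])
    qed (use Q in auto)
  qed
qed

text \<open>An eigenvector for an eigenvalue at least \<kappa>/2 is orthogonal to each
  \<open>u k\<close> with \<open>l k\<close> below \<kappa>/2, because eigenvectors of a symmetric
  matrix for different eigenvalues are orthogonal. The remaining \<open>u k\<close> are themselves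
  among the generators.\<close>

lemma top_eigenspace_eq: "top_eigenspace d \<kappa> A = spectral_space (\<lambda>x. \<kappa> / 2 \<le> x)"
proof -
  interpret V: vec_space "TYPE(real)" d .
  let ?S = "{v. \<exists>e. eigenvector A v e \<and> \<kappa> / 2 \<le> e}"
  have S: "?S \<subseteq> carrier_vec d" using A_carrier by (auto simp: eigenvector_def)
  have uS: "u k \<in> ?S" if "k < d" "\<kappa> / 2 \<le> l k" for k
  proof -
    have "u k \<noteq> 0\<^sub>v d" using orthonormal[of k k] that by auto
    then show ?thesis using that eigen u_carrier A_carrier by (auto simp: eigenvector_def)
  qed
  show ?thesis unfolding top_eigenspace_def
  proof (intro equalityI subsetI)
    fix x assume x: "x \<in> V.span ?S"
    then have xc: "x \<in> carrier_vec d" using V.span_is_subset2[OF S] by auto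
    have "u k \<bullet> x = 0" if k: "k < d" "l k < \<kappa> / 2" for k
    proof -
      have "u k \<bullet> v = 0" if vS: "v \<in> ?S" for v
      proof -
        have v: "v \<in> carrier_vec d" using vS S by auto
        obtain e where e: "A *\<^sub>v v = e \<cdot>\<^sub>v v" "\<kappa> / 2 \<le> e" using vS unfolding eigenvector_def by blast
        have "l k * (u k \<bullet> v) = e * (u k \<bullet> v)"
          using coeff_A[OF k(1) v] v u_carrier[OF k(1)] by (auto simp: e)
        then show ?thesis using e(2) k(2) by auto
      qed
      then have "u k \<in> V.orthogonal_complement ?S"
        using u_carrier[OF k(1)] by (auto simp: V.orthogonal_complement_def)
      then have "u k \<in> V.orthogonal_complement (V.span ?S)"
        using V.in_orthogonal_complement_span[OF S] by simp
      then show ?thesis using x by (auto simp: V.orthogonal_complement_def)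
    qed
    then show "x \<in> spectral_space (\<lambda>x. \<kappa> / 2 \<le> x)" using xc by (auto simp: spectral_space_def)
  next
    fix x assume x: "x \<in> spectral_space (\<lambda>x. \<kappa> / 2 \<le> x)"
    then have xc: "x \<in> carrier_vec d" by (simp add: spectral_space_def)
    \<comment> \<open>The expansion of \<open>x\<close> in the eigenbasis is assembled one term at a
      time, using closure of the span under addition and scaling.\<close>
    have "\<exists>y \<in> V.span ?S. \<forall>k<d. u k \<bullet> y = (if k < m then u k \<bullet> x else 0)" if "m \<le> d" for m
      using that
    proof (induction m)
      case 0
      have "0\<^sub>v d \<in> V.span ?S" using V.span_zero by simp
      then show ?case using u_carrier by (auto intro!: bexI[of _ "0\<^sub>v d"])
    next
      case (Suc m)
      then obtain y where y: "y \<in> V.span ?S" "\<forall>k<d. u k \<bullet> y = (if k < m then u k \<bullet> x else 0)" by auto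
      have yc: "y \<in> carrier_vec d" using y(1) V.span_is_subset2[OF S] by auto
      have m: "m < d" using Suc.prems by simp
      show ?case
      proof (cases "\<kappa> / 2 \<le> l m")
        case True
        let ?z = "(u m \<bullet> x) \<cdot>\<^sub>v u m + y"
        have "(u m \<bullet> x) \<cdot>\<^sub>v u m \<in> V.span ?S"
          by (intro V.smult_in_span[OF S] subsetD[OF V.in_own_span[OF S]] uS[OF m True])
        then have "?z \<in> V.span ?S" using V.span_add1[OF S _ y(1)] by simp
        moreover have "u k \<bullet> ?z = (if k < Suc m then u k \<bullet> x else 0)" if k: "k < d" for k
        proof -
          have "u k \<bullet> ?z = (u m \<bullet> x) * (u k \<bullet> u m) + u k \<bullet> y"
            using k m yc u_carrier by (simp add: scalar_prod_add_distrib[of _ d] scalar_prod_smult_distrib[of _ d])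
          then show ?thesis using k m y(2) orthonormal by (auto simp: less_Suc_eq)
        qed
        ultimately show ?thesis by blast
      next
        case False
        then have "u m \<bullet> x = 0" using x m by (auto simp: spectral_space_def)
        then show ?thesis using y by (intro bexI[of _ y]) (auto simp: less_Suc_eq)
      qed
    qed
    from this[OF order_refl] obtain y where "y \<in> V.span ?S" "\<forall>k<d. u k \<bullet> y = u k \<bullet> x" by auto
    then show "x \<in> V.span ?S"
      using vec_eqI[of y x] xc V.span_is_subset2[OF S] by auto
  qed
qed

lemma precond_eq:
  "precond d K (top_eigenspace d \<kappa> A) = smap (\<lambda>x. if \<kappa> / 2 \<le> x then 1 / sqrt K else 1)"
  unfolding precond_def top_eigenspace_eq orth_compl_spectral_space orth_proj_spectral_space
proof (rule eq_matI)
  fix i j assume "i < dim_row (smap (\<lambda>x. if \<kappa> / 2 \<le> x then 1 / sqrt K else 1))"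
    "j < dim_col (smap (\<lambda>x. if \<kappa> / 2 \<le> x then 1 / sqrt K else 1))"
  then have ij: "i < d" "j < d" by (simp_all add: spectral_map_def)
  have "1 / sqrt K * (\<Sum>k<d. of_bool (\<kappa> / 2 \<le> l k) * u k $ i * u k $ j)
      + (\<Sum>k<d. of_bool (\<not> \<kappa> / 2 \<le> l k) * u k $ i * u k $ j)
    = (\<Sum>k<d. (if \<kappa> / 2 \<le> l k then 1 / sqrt K else 1) * u k $ i * u k $ j)"
    unfolding sum_distrib_left sum.distrib[symmetric] by (intro sum.cong) auto
  then show "((1 / sqrt K) \<cdot>\<^sub>m smap (\<lambda>x. of_bool (\<kappa> / 2 \<le> x)) + smap (\<lambda>x. of_bool (\<not> \<kappa> / 2 \<le> x))) $$ (i, j)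
    = smap (\<lambda>x. if \<kappa> / 2 \<le> x then 1 / sqrt K else 1) $$ (i, j)"
    using ij by (simp add: spectral_map_def)
qed (simp_all add: spectral_map_def)

lemma top_eigenspace_subspace: "is_subspace d (top_eigenspace d \<kappa> A)"
proof -
  interpret V: vec_space "TYPE(real)" d .
  show ?thesis unfolding top_eigenspace_def
    using A_carrier by (intro V.span_is_subspace) (auto simp: eigenvector_def)
qed

end

section \<open>Measurability of the spectral constructions\<close>

lemma space_sym_borel [simp]: "space (sym_borel d) = sym_mats d"
  by (simp add: sym_borel_def)

lemma measurable_sym_borel_index [measurable (raw)]:
  assumes "f \<in> N \<rightarrow>\<^sub>M sym_borel d" "i < d" "j < d"
  shows "(\<lambda>x. f x $$ (i, j)) \<in> borel_measurable N"
proof -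
  have "(\<lambda>A. \<lambda>p\<in>{..<d} \<times> {..<d}. A $$ p) \<in> sym_borel d \<rightarrow>\<^sub>M (\<Pi>\<^sub>M p\<in>{..<d} \<times> {..<d}. borel)"
    unfolding sym_borel_def
    by (rule measurable_vimage_algebra1) (auto simp: space_PiM)
  from measurable_compose[OF this measurable_component_singleton[of "(i, j)"]]
  have "(\<lambda>A. A $$ (i, j)) \<in> borel_measurable (sym_borel d)" using assms(2,3) by simp
  with assms(1) show ?thesis by (rule measurable_compose)
qed

lemma measurable_sym_borelI:
  assumes "\<And>x. x \<in> space N \<Longrightarrow> f x \<in> sym_mats d"
    and "\<And>i j. i < d \<Longrightarrow> j < d \<Longrightarrow> (\<lambda>x. f x $$ (i, j)) \<in> borel_measurable N"
  shows "f \<in> N \<rightarrow>\<^sub>M sym_borel d"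
  unfolding sym_borel_def
proof (rule measurable_vimage_algebra2)
  show "f \<in> space N \<rightarrow> sym_mats d" using assms(1) by auto
  show "(\<lambda>x. \<lambda>p\<in>{..<d} \<times> {..<d}. f x $$ p) \<in> N \<rightarrow>\<^sub>M (\<Pi>\<^sub>M p\<in>{..<d} \<times> {..<d}. borel)"
    using assms(2) by (intro measurable_restrict) auto
qed

lemma measurable_matrix_power_index:
  "i < d \<Longrightarrow> j < d \<Longrightarrow> (\<lambda>A. (A ^\<^sub>m k) $$ (i, j)) \<in> borel_measurable (sym_borel d)"
proof (induction k arbitrary: j)
  case 0
  have "(\<lambda>A. (A ^\<^sub>m 0) $$ (i, j)) \<in> borel_measurable (sym_borel d)
    \<longleftrightarrow> (\<lambda>A. of_bool (i = j) :: real) \<in> borel_measurable (sym_borel d)"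
    using 0 by (intro measurable_cong) (auto simp: sym_mats_def)
  then show ?case by simp
next
  case (Suc k)
  have "(\<lambda>A. (A ^\<^sub>m Suc k) $$ (i, j)) \<in> borel_measurable (sym_borel d)
    \<longleftrightarrow> (\<lambda>A. \<Sum>m<d. (A ^\<^sub>m k) $$ (i, m) * A $$ (m, j)) \<in> borel_measurable (sym_borel d)"
  proof (rule measurable_cong)
    fix A assume "A \<in> space (sym_borel d)"
    then have A: "A \<in> carrier_mat d d" by (simp add: sym_matsD)
    then have "A ^\<^sub>m k \<in> carrier_mat d d" by (rule pow_carrier_mat)
    then show "(A ^\<^sub>m Suc k) $$ (i, j) = (\<Sum>m<d. (A ^\<^sub>m k) $$ (i, m) * A $$ (m, j))"
      using A Suc.prems by (simp add: scalar_prod_def atLeast0LessThan carrier_matD)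
  qed
  also have "\<dots>"
    using Suc.prems by (intro borel_measurable_sum borel_measurable_times Suc.IH) auto
  finally show ?case .
qed

text \<open>The functions f for which f(A) is measurable without a measurable choice of
  eigenvectors. Convergence is required on the whole line because the spectrum of A is not confined
  to a bounded set.\<close>

definition polynomial_limit :: "(real \<Rightarrow> real) \<Rightarrow> bool" where
  "polynomial_limit f \<longleftrightarrow> (\<exists>p. (\<forall>n. real_polynomial_function (p n)) \<and> (\<forall>x. (\<lambda>n. p n x) \<longlonglongrightarrow> f x))"

text \<open>Weierstrass approximation holds on compact sets only, so the n-th polynomial is taken
  close to \<open>g n\<close> between -n and n, with error 1/(n+1); a given point lies in all but
  finitely many of these intervals.\<close>

lemma polynomial_limitI:
  assumes cont: "\<And>n. continuous_on UNIV (g n)" and lim: "\<And>x. (\<lambda>n. g n x) \<longlonglongrightarrow> f x"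
  shows "polynomial_limit f"
proof -
  have "\<exists>p. real_polynomial_function p \<and> (\<forall>x\<in>{- real n..real n}. \<bar>g n x - p x\<bar> < 1 / real (Suc n))" for n
  proof -
    have "continuous_on {- real n..real n} (g n)" using cont continuous_on_subset by blast
    then obtain p where "real_polynomial_function p" "\<And>x. x \<in> {- real n..real n} \<Longrightarrow> \<bar>g n x - p x\<bar> < 1 / real (Suc n)"
      by (rule Stone_Weierstrass_real_polynomial_function[OF compact_Icc, where e = "1 / real (Suc n)"]) auto
    then show ?thesis by blast
  qed
  then obtain p where p: "\<And>n. real_polynomial_function (p n)"
    "\<And>n x. x \<in> {- real n..real n} \<Longrightarrow> \<bar>g n x - p n x\<bar> < 1 / real (Suc n)" by metis
  have "(\<lambda>n. p n x) \<longlonglongrightarrow> f x" for x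
  proof -
    have "\<forall>\<^sub>F n in sequentially. \<bar>x\<bar> \<le> real n"
      using eventually_ge_at_top[of "nat \<lceil>\<bar>x\<bar>\<rceil>"] by eventually_elim linarith
    then have "\<forall>\<^sub>F n in sequentially. norm (g n x - p n x) \<le> 1 / real (Suc n)"
    proof eventually_elim
      case (elim n)
      then have "x \<in> {- real n..real n}" by auto
      from p(2)[OF this] show ?case by simp
    qed
    then have "(\<lambda>n. g n x - p n x) \<longlonglongrightarrow> 0"
      by (rule Lim_null_comparison) (rule LIMSEQ_Suc[OF lim_1_over_n])
    from tendsto_diff[OF lim[of x] this] show ?thesis by simp
  qed
  then show ?thesis using p(1) unfolding polynomial_limit_def by blast
qed

lemma polynomial_limit_continuous: "continuous_on UNIV f \<Longrightarrow> polynomial_limit f"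
  by (rule polynomial_limitI[of "\<lambda>_. f"]) auto

lemma polynomial_limit_step: "polynomial_limit (\<lambda>x. if c \<le> x then a else b)"
proof (rule polynomial_limitI)
  \<comment> \<open>The ramp passes from \<open>b\<close> to \<open>a\<close> to the left of
    \<open>c\<close>, on an interval of length 1/n, so that the limit has the value \<open>a\<close>
    at \<open>c\<close> itself, as the closed inequality \<open>c \<le> x\<close> demands.\<close>
  let ?g = "\<lambda>n x. b + (a - b) * max 0 (min 1 (1 + real n * (x - c)))"
  show "continuous_on UNIV (?g n)" for n by (intro continuous_intros)
  show "(\<lambda>n. ?g n x) \<longlonglongrightarrow> (if c \<le> x then a else b)" for x
  proof (cases "c \<le> x")
    case True
    then have "?g n x = a" for n by simp
    then show ?thesis using True by simp
  next
    case False
    have "\<forall>\<^sub>F n in sequentially. real n \<ge> 1 / (c - x)"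
      using eventually_ge_at_top[of "nat \<lceil>1 / (c - x)\<rceil>"] by eventually_elim linarith
    then have "\<forall>\<^sub>F n in sequentially. ?g n x = b"
    proof eventually_elim
      case (elim n)
      then have "1 \<le> real n * (c - x)" using False by (simp add: pos_divide_le_eq)
      then have "1 + real n * (x - c) \<le> 0" by (simp add: algebra_simps)
      then show ?case by simp
    qed
    then show ?thesis using False by (simp add: tendsto_eventually)
  qed
qed

text \<open>For a polynomial p the entries of p(A) are polynomials in the entries of A, and f(A) is
  a pointwise limit of such matrices. The hypothesis on \<open>F\<close> ranges over all eigenbases,
  so any one of them may be taken for a given A.\<close>

lemma measurable_spectral_map:
  assumes F: "\<And>A u l. eigen_system d A u l \<Longrightarrow> F A = spectral_map d u l f"
    and f: "polynomial_limit f"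
  shows "F \<in> sym_borel d \<rightarrow>\<^sub>M sym_borel d"
proof (rule measurable_sym_borelI)
  fix A assume "A \<in> space (sym_borel d)"
  then show "F A \<in> sym_mats d" using spectral_theorem[of A d] F by auto
next
  fix i j assume ij: "i < d" "j < d"
  obtain p where p: "\<And>n. real_polynomial_function (p n)" "\<And>x. (\<lambda>n. p n x) \<longlonglongrightarrow> f x"
    using f unfolding polynomial_limit_def by blast
  have "\<exists>a m. p n = (\<lambda>x. \<Sum>q\<le>m. a q * x ^ q)" for n
    using p(1)[of n] unfolding real_polynomial_function_iff_sum .
  then obtain a m where am: "\<And>n. p n = (\<lambda>x. \<Sum>q\<le>m n. a n q * x ^ q)" by metis
  show "(\<lambda>A. F A $$ (i, j)) \<in> borel_measurable (sym_borel d)"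
  proof (rule borel_measurable_LIMSEQ_real)
    show "(\<lambda>A. \<Sum>q\<le>m n. a n q * (A ^\<^sub>m q) $$ (i, j)) \<in> borel_measurable (sym_borel d)" for n
      using ij by (intro borel_measurable_sum borel_measurable_times measurable_matrix_power_index) auto
  next
    fix A assume "A \<in> space (sym_borel d)"
    then obtain u l where es: "eigen_system d A u l" using spectral_theorem[of A d] by auto
    then interpret eigen_system d A u l .
    have "(\<Sum>q\<le>m n. a n q * (A ^\<^sub>m q) $$ (i, j)) = (\<Sum>k<d. p n (l k) * u k $ i * u k $ j)" for n
    proof -
      have "(\<Sum>q\<le>m n. a n q * (A ^\<^sub>m q) $$ (i, j))
        = (\<Sum>q\<le>m n. \<Sum>k<d. a n q * (l k ^ q * u k $ i * u k $ j))"
        using ij by (simp add: smap_power[symmetric] spectral_map_def sum_distrib_left)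
      also have "\<dots> = (\<Sum>k<d. \<Sum>q\<le>m n. a n q * (l k ^ q * u k $ i * u k $ j))"
        by (rule sum.swap)
      also have "\<dots> = (\<Sum>k<d. p n (l k) * u k $ i * u k $ j)"
        unfolding am sum_distrib_right by (intro sum.cong refl) simp
      finally show ?thesis .
    qed
    moreover have "(\<lambda>n. \<Sum>k<d. p n (l k) * u k $ i * u k $ j) \<longlonglongrightarrow> F A $$ (i, j)"
      using ij unfolding F[OF es] spectral_map_def by (simp, intro tendsto_intros p(2))
    ultimately show "(\<lambda>n. \<Sum>q\<le>m n. a n q * (A ^\<^sub>m q) $$ (i, j)) \<longlonglongrightarrow> F A $$ (i, j)"
      by simp
  qed
qed

lemma measurable_psd_proj [measurable]: "psd_proj d \<in> sym_borel d \<rightarrow>\<^sub>M sym_borel d"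
  by (rule measurable_spectral_map[where f = "\<lambda>x. max x 0"])
    (auto intro!: eigen_system.psd_proj_eq polynomial_limit_continuous continuous_intros)

lemma measurable_top_eigenspace: "top_eigenspace d \<kappa> \<in> sym_borel d \<rightarrow>\<^sub>M subspace_borel d"
  unfolding subspace_borel_def
proof (rule measurable_vimage_algebra2)
  show "top_eigenspace d \<kappa> \<in> space (sym_borel d) \<rightarrow> {V. is_subspace d V}"
    using spectral_theorem eigen_system.top_eigenspace_subspace by fastforce
  show "(\<lambda>A. orth_proj d (top_eigenspace d \<kappa> A)) \<in> sym_borel d \<rightarrow>\<^sub>M sym_borel d"
    by (rule measurable_spectral_map[OF _ polynomial_limit_step[of "\<kappa> / 2" 1 0]])
      (simp add: eigen_system.top_eigenspace_eq eigen_system.orth_proj_spectral_space of_bool_def)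
qed

lemma measurable_precond:
  "(\<lambda>A. precond d K (top_eigenspace d \<kappa> A)) \<in> sym_borel d \<rightarrow>\<^sub>M sym_borel d"
  by (rule measurable_spectral_map[OF eigen_system.precond_eq polynomial_limit_step])

definition weak_output ::
  "nat \<Rightarrow> real \<Rightarrow> real \<Rightarrow> real mat \<Rightarrow> real vec set \<times> real mat" where
  "weak_output d \<kappa> K M = (let V = top_eigenspace d \<kappa> (psd_proj d M) in (V, precond d K V))"

lemma measurable_weak_output [measurable]:
  "weak_output d \<kappa> K \<in> sym_borel d \<rightarrow>\<^sub>M subspace_borel d \<Otimes>\<^sub>M sym_borel d"
  unfolding weak_output_def Let_def
  using measurable_compose[OF measurable_psd_proj measurable_top_eigenspace]
    measurable_compose[OF measurable_psd_proj measurable_precond]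
  by (rule measurable_Pair)

text \<open>By definition the cone is an intersection over uncountably many vectors; as the fixed
  point set of the measurable map \<open>psd_proj\<close> it takes only finitely many comparisons of
  entries.\<close>

lemma sets_psd_cone: "psd_cone d \<in> sets (sym_borel d)"
proof -
  have "psd_cone d = {A \<in> space (sym_borel d). \<forall>i\<in>{..<d}. \<forall>j\<in>{..<d}. psd_proj d A $$ (i, j) = A $$ (i, j)}"
  proof (intro equalityI subsetI)
    fix A assume A: "A \<in> psd_cone d"
    then obtain u l where "eigen_system d A u l" using spectral_theorem psd_coneD by blast
    then interpret eigen_system d A u l .
    have "psd_proj d A = smap (\<lambda>x. x)"
      unfolding psd_proj_eq by (rule smap_cong) (simp add: psd_eigenvalue[OF A])
    then show "A \<in> {A \<in> space (sym_borel d). \<forall>i\<in>{..<d}. \<forall>j\<in>{..<d}. psd_proj d A $$ (i, j) = A $$ (i, j)}"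
      using sym by (simp add: smap_id)
  next
    fix A assume A: "A \<in> {A \<in> space (sym_borel d). \<forall>i\<in>{..<d}. \<forall>j\<in>{..<d}. psd_proj d A $$ (i, j) = A $$ (i, j)}"
    then obtain u l where "eigen_system d A u l" using spectral_theorem[of A d] by auto
    then interpret eigen_system d A u l .
    have "A = psd_proj d A"
      using A A_carrier by (intro eq_matI) (auto simp: psd_proj_eq)
    moreover have "psd_proj d A \<in> psd_cone d" unfolding psd_proj_eq by (rule smap_psd) simp
    ultimately show "A \<in> psd_cone d" by simp
  qed
  also have "\<dots> \<in> sets (sym_borel d)"
    by (intro sets.sets_Collect_finite_All borel_measurable_eq) auto
  finally show ?thesis .
qed

section \<open>Gaussian products and data processing for the Renyi divergence\<close>

lemma sets_normal_dist [simp]: "sets (normal_dist \<mu> v) = sets borel"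
  by (simp add: normal_dist_def)

lemma space_normal_dist [simp]: "space (normal_dist \<mu> v) = UNIV"
  using sets_eq_imp_space_eq[OF sets_normal_dist] by simp

lemma measurable_normal_dist [simp]: "measurable (normal_dist \<mu> v) N = measurable borel N"
  by (rule measurable_cong_sets) simp_all

lemma measurable_into_normal_dist [simp]: "measurable N (normal_dist \<mu> v) = measurable N borel"
  by (rule measurable_cong_sets) simp_all

lemma prob_space_normal_dist: "v \<ge> 0 \<Longrightarrow> prob_space (normal_dist \<mu> v)"
  by (cases "v = 0")
    (auto simp: normal_dist_def intro!: prob_space_return prob_space_normal_density)

text \<open>One-dimensional Cameron-Martin formula: completing the square turns the exponential tilt
  into a translation by \<open>\<delta>\<close>.\<close>

lemma normal_dist_exp_tilt:
  assumes v: "v > 0"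
  shows "density (normal_dist 0 v) (\<lambda>x. ennreal (exp (\<delta> / v * x - \<delta>\<^sup>2 / (2 * v))))
    = distr (normal_dist 0 v) borel (\<lambda>x. x + \<delta>)"
proof -
  let ?N = "normal_dist 0 v"
  let ?n = "\<lambda>\<mu>. normal_density \<mu> (sqrt v)"
  interpret prob_space ?N using v by (intro prob_space_normal_dist) simp
  have N: "?N = density lborel (?n 0)" using v by (simp add: normal_dist_def)
  have "distr ?N lborel (\<lambda>x. x) = ?N" by (rule distr_id2) simp
  then have "distributed ?N lborel (\<lambda>x. x) (?n 0)"
    by (auto simp: distributed_def N)
  from normal_density_affine[OF this, of 1 \<delta>] v
  have "distr ?N lborel (\<lambda>x. \<delta> + x) = density lborel (?n \<delta>)"
    by (simp add: distributed_def)
  moreover have "distr ?N lborel (\<lambda>x. \<delta> + x) = distr ?N borel (\<lambda>x. x + \<delta>)"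
    by (intro distr_cong) (auto simp: add.commute)
  moreover have "density ?N (\<lambda>x. ennreal (exp (\<delta> / v * x - \<delta>\<^sup>2 / (2 * v)))) = density lborel (?n \<delta>)"
  proof -
    have "?n 0 x * exp (\<delta> / v * x - \<delta>\<^sup>2 / (2 * v)) = ?n \<delta> x" for x
    proof -
      have "- x\<^sup>2 / (2 * v) + (\<delta> / v * x - \<delta>\<^sup>2 / (2 * v)) = - (x - \<delta>)\<^sup>2 / (2 * v)"
        using v by (simp add: field_simps power2_eq_square)
      then show ?thesis using v by (simp add: normal_density_def mult_exp_exp)
    qed
    then have "ennreal (?n 0 x) * ennreal (exp (\<delta> / v * x - \<delta>\<^sup>2 / (2 * v))) = ennreal (?n \<delta> x)" for x
      by (simp flip: ennreal_mult)
    then show ?thesis unfolding N by (simp add: density_density_eq)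
  qed
  ultimately show ?thesis by simp
qed

text \<open>For v > 0, the tilt with \<delta> = v t is a translate and so has total mass 1; that
  mass is the moment generating function divided by exp(v t^2 / 2), so no integral has to be
  computed.\<close>

lemma normal_dist_mgf:
  assumes v: "v \<ge> 0"
  shows "(\<integral>\<^sup>+ x. ennreal (exp (t * x)) \<partial>normal_dist 0 v) = ennreal (exp (v * t\<^sup>2 / 2))"
proof (cases "v = 0")
  case True
  then show ?thesis by (simp add: normal_dist_def nn_integral_return)
next
  case False
  let ?\<delta> = "v * t"
  have "ennreal (exp (t * x)) = ennreal (exp (v * t\<^sup>2 / 2)) * ennreal (exp (?\<delta> / v * x - ?\<delta>\<^sup>2 / (2 * v)))" for x
    using False by (simp add: power2_eq_square mult_exp_exp flip: ennreal_mult)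
  then have "(\<integral>\<^sup>+ x. ennreal (exp (t * x)) \<partial>normal_dist 0 v)
    = ennreal (exp (v * t\<^sup>2 / 2)) * (\<integral>\<^sup>+ x. ennreal (exp (?\<delta> / v * x - ?\<delta>\<^sup>2 / (2 * v))) \<partial>normal_dist 0 v)"
    by (simp add: nn_integral_cmult)
  also have "(\<integral>\<^sup>+ x. ennreal (exp (?\<delta> / v * x - ?\<delta>\<^sup>2 / (2 * v))) \<partial>normal_dist 0 v)
    = emeasure (density (normal_dist 0 v) (\<lambda>x. ennreal (exp (?\<delta> / v * x - ?\<delta>\<^sup>2 / (2 * v))))) UNIV"
    by (simp add: emeasure_density)
  also have "\<dots> = 1"
  proof -
    interpret prob_space "normal_dist 0 v" using v by (rule prob_space_normal_dist)
    show ?thesis using False v normal_dist_exp_tilt[of v ?\<delta>] emeasure_space_1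
      by (simp add: emeasure_distr)
  qed
  finally show ?thesis by simp
qed

abbreviation normal_prod :: "'i set \<Rightarrow> real \<Rightarrow> ('i \<Rightarrow> real) measure" where
  "normal_prod I v \<equiv> \<Pi>\<^sub>M i\<in>I. normal_dist 0 v"

lemma product_prob_space_normal: "v \<ge> 0 \<Longrightarrow> product_prob_space (\<lambda>_. normal_dist 0 v)"
  using prob_space_normal_dist
  by (auto simp: product_prob_space_def product_prob_space_axioms_def product_sigma_finite_def
      intro: prob_space_imp_sigma_finite)

lemma prob_space_normal_prod: "v \<ge> 0 \<Longrightarrow> prob_space (normal_prod I v)"
  by (intro prob_space_PiM prob_space_normal_dist)

lemma measurable_normal_prod_component:
  "i \<in> I \<Longrightarrow> (\<lambda>x. x i) \<in> borel_measurable (normal_prod I v)"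
  using measurable_component_singleton[of i I "\<lambda>_. normal_dist 0 v"]
  by (simp cong: measurable_cong_sets)

lemma normal_prod_mgf:
  assumes I: "finite I" and v: "v \<ge> 0"
  shows "(\<integral>\<^sup>+ x. ennreal (exp (\<Sum>i\<in>I. t i * x i)) \<partial>normal_prod I v)
    = ennreal (exp (v * (\<Sum>i\<in>I. (t i)\<^sup>2) / 2))"
proof -
  interpret product_prob_space "\<lambda>_. normal_dist 0 v" I using v by (rule product_prob_space_normal)
  have "(\<integral>\<^sup>+ x. ennreal (exp (\<Sum>i\<in>I. t i * x i)) \<partial>normal_prod I v)
    = (\<integral>\<^sup>+ x. (\<Prod>i\<in>I. ennreal (exp (t i * x i))) \<partial>normal_prod I v)"
    using I by (simp add: exp_sum prod_ennreal)
  also have "\<dots> = (\<Prod>i\<in>I. \<integral>\<^sup>+ x. ennreal (exp (t i * x)) \<partial>normal_dist 0 v)"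
    using I by (intro product_nn_integral_prod) (auto cong: measurable_cong_sets)
  also have "\<dots> = (\<Prod>i\<in>I. ennreal (exp (v * (t i)\<^sup>2 / 2)))"
    using v by (simp add: normal_dist_mgf)
  also have "\<dots> = ennreal (exp (v * (\<Sum>i\<in>I. (t i)\<^sup>2) / 2))"
    using I by (simp add: prod_ennreal exp_sum[symmetric] sum_distrib_left sum_divide_distrib)
  finally show ?thesis .
qed

text \<open>It suffices to compare both measures on boxes, where the product density factorises and
  each factor is the one-dimensional tilt.\<close>

lemma normal_prod_exp_tilt:
  assumes I: "finite I" and v: "v > 0"
  shows "density (normal_prod I v) (\<lambda>x. ennreal (exp (\<Sum>i\<in>I. \<delta> i / v * x i - (\<delta> i)\<^sup>2 / (2 * v))))
    = distr (normal_prod I v) (normal_prod I v) (\<lambda>x. \<lambda>i\<in>I. x i + \<delta> i)"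
    (is "?D = ?S")
proof -
  let ?N = "normal_dist 0 v"
  let ?f = "\<lambda>i x. ennreal (exp (\<delta> i / v * x - (\<delta> i)\<^sup>2 / (2 * v)))"
  note [measurable] = measurable_normal_prod_component
  interpret product_prob_space "\<lambda>_. ?N" I using v by (intro product_prob_space_normal) simp
  have shift [measurable]: "(\<lambda>x. \<lambda>i\<in>I. x i + \<delta> i) \<in> normal_prod I v \<rightarrow>\<^sub>M normal_prod I v"
    by (intro measurable_restrict) simp
  have "?S = ?D"
  proof (rule measure_eqI_PiM_finite[OF I])
    show "range (\<lambda>_::nat. space (normal_prod I v)) \<subseteq> prod_algebra I (\<lambda>_. ?N)"
      using I by (auto simp: space_PiM intro!: prod_algebraI_finite)
    show "emeasure ?S (space (normal_prod I v)) \<noteq> \<infinity>" for n :: nat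
      using v prob_space.emeasure_space_1[OF prob_space.prob_space_distr[OF prob_space_normal_prod shift]]
      by simp
  next
    fix A assume A: "\<And>i. i \<in> I \<Longrightarrow> A i \<in> sets ?N"
    have [measurable]: "Pi\<^sub>E I A \<in> sets (normal_prod I v)" using I A by (intro sets_PiM_I_finite) auto
    let ?B = "\<lambda>i. (\<lambda>x. x + \<delta> i) -` A i"
    have B: "?B i \<in> sets ?N" if "i \<in> I" for i
      using A[OF that] measurable_sets[of "\<lambda>x. x + \<delta> i" borel borel "A i"] by simp
    have "emeasure ?S (Pi\<^sub>E I A) = emeasure (normal_prod I v) (Pi\<^sub>E I ?B)"
    proof -
      have "(\<lambda>x. \<lambda>i\<in>I. x i + \<delta> i) -` Pi\<^sub>E I A \<inter> space (normal_prod I v) = Pi\<^sub>E I ?B"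
        by (auto simp: space_PiM PiE_iff)
      then show ?thesis using emeasure_distr[OF shift, of "Pi\<^sub>E I A"] by simp
    qed
    also have "\<dots> = (\<Prod>i\<in>I. emeasure ?N (?B i))"
      using I B by (intro emeasure_PiM) auto
    also have "\<dots> = (\<Prod>i\<in>I. emeasure (distr ?N borel (\<lambda>x. x + \<delta> i)) (A i))"
      using A by (intro prod.cong refl) (subst emeasure_distr, auto)
    also have "\<dots> = (\<Prod>i\<in>I. emeasure (density ?N (?f i)) (A i))"
      by (simp only: normal_dist_exp_tilt[OF v])
    also have "\<dots> = (\<Prod>i\<in>I. \<integral>\<^sup>+ x. ?f i x * indicator (A i) x \<partial>?N)"
      using A by (intro prod.cong) (auto simp: emeasure_density)
    also have "\<dots> = (\<integral>\<^sup>+ x. (\<Prod>i\<in>I. ?f i (x i) * indicator (A i) (x i)) \<partial>normal_prod I v)"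
      using I A by (intro product_nn_integral_prod[symmetric]) auto
    also have "\<dots> = (\<integral>\<^sup>+ x. ennreal (exp (\<Sum>i\<in>I. \<delta> i / v * x i - (\<delta> i)\<^sup>2 / (2 * v))) * indicator (Pi\<^sub>E I A) x \<partial>normal_prod I v)"
    proof (rule nn_integral_cong)
      fix x assume x: "x \<in> space (normal_prod I v)"
      have "(\<Prod>i\<in>I. indicator (A i) (x i) :: ennreal) = indicator (Pi\<^sub>E I A) x"
      proof (cases "x \<in> Pi\<^sub>E I A")
        case True
        then show ?thesis by (auto intro!: prod.neutral simp: PiE_def Pi_def)
      next
        case False
        then obtain i where "i \<in> I" "x i \<notin> A i" using x by (auto simp: space_PiM PiE_def)
        then show ?thesis using I False by (auto intro!: prod_zero bexI[of _ i])
      qed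
      then show "(\<Prod>i\<in>I. ?f i (x i) * indicator (A i) (x i))
        = ennreal (exp (\<Sum>i\<in>I. \<delta> i / v * x i - (\<delta> i)\<^sup>2 / (2 * v))) * indicator (Pi\<^sub>E I A) x"
        using I by (simp add: prod.distrib exp_sum prod_ennreal)
    qed
    also have "\<dots> = emeasure ?D (Pi\<^sub>E I A)"
      by (subst emeasure_density) auto
    finally show "emeasure ?S (Pi\<^sub>E I A) = emeasure ?D (Pi\<^sub>E I A)" .
  qed auto
  then show ?thesis by simp
qed

section \<open>Data processing for the Renyi divergence\<close>

lemma Youngs_inequality_powr:
  assumes "\<alpha> > 1" "a \<ge> 0" "b \<ge> (0::real)"
  shows "\<alpha> * (b powr (\<alpha> - 1) * a) \<le> a powr \<alpha> + (\<alpha> - 1) * b powr \<alpha>"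
proof -
  have "a * b powr (\<alpha> - 1) \<le> a powr \<alpha> / \<alpha> + (b powr (\<alpha> - 1)) powr (\<alpha> / (\<alpha> - 1)) / (\<alpha> / (\<alpha> - 1))"
    using assms by (intro Youngs_inequality) (auto simp: field_simps)
  also have "(b powr (\<alpha> - 1)) powr (\<alpha> / (\<alpha> - 1)) = b powr \<alpha>"
    using assms by (simp add: powr_powr)
  finally have "\<alpha> * (a * b powr (\<alpha> - 1)) \<le> \<alpha> * (a powr \<alpha> / \<alpha> + b powr \<alpha> / (\<alpha> / (\<alpha> - 1)))"
    using assms by (intro mult_left_mono) auto
  also have "\<dots> = a powr \<alpha> + (\<alpha> - 1) * b powr \<alpha>"
    using assms by (simp add: distrib_left)
  finally show ?thesis by (simp add: mult_ac)
qed

lemma measurable_ennreal_powr: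
  assumes [measurable]: "g \<in> borel_measurable N"
  shows "(\<lambda>x. ennreal (g x powr c)) \<in> borel_measurable N"
  by measurable

text \<open>Data processing: integrating Young's inequality \<open>\<alpha> h\<^sup>\<alpha>\<^sup>-\<^sup>1 f \<le> f\<^sup>\<alpha> + (\<alpha> - 1) h\<^sup>\<alpha>\<close> for (truncations of) the density
  \<open>h\<close> of the images, whose \<open>\<alpha>\<close>-moment reappears on the left-hand side.\<close>

lemma renyi_divergence_distr_le:
  assumes Q: "prob_space Q" and F: "F \<in> Q \<rightarrow>\<^sub>M N"
    and f: "f \<in> borel_measurable Q" and f0: "\<And>x. 0 \<le> f x"
    and \<alpha>: "\<alpha> > 1" and C: "C \<ge> 1"
    and moment: "(\<integral>\<^sup>+ x. ennreal (f x powr \<alpha>) \<partial>Q) \<le> ennreal C"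
  shows "renyi_divergence \<alpha> (distr (density Q (\<lambda>x. ennreal (f x))) N F) (distr Q N F)
    \<le> ereal (ln C / (\<alpha> - 1))"
proof -
  let ?P = "density Q (\<lambda>x. ennreal (f x))"
  let ?P' = "distr ?P N F" and ?Q' = "distr Q N F"
  have FP: "F \<in> ?P \<rightarrow>\<^sub>M N" using F by simp
  have fe: "(\<lambda>x. ennreal (f x)) \<in> borel_measurable Q" using f by simp
  interpret Q': prob_space ?Q' using Q F by (rule prob_space.prob_space_distr)
  have ac: "absolutely_continuous ?Q' ?P'"
    unfolding absolutely_continuous_def
  proof
    fix A assume A: "A \<in> null_sets ?Q'"
    have null: "F -` A \<inter> space Q \<in> null_sets Q"
      using A unfolding null_sets_distr_iff[OF F] by simp
    have "emeasure ?P (F -` A \<inter> space Q) = (\<integral>\<^sup>+ x. ennreal (f x) * indicator (F -` A \<inter> space Q) x \<partial>Q)"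
      by (rule emeasure_density[OF fe null_setsD2[OF null]])
    then have "emeasure ?P (F -` A \<inter> space Q) = 0"
      by (simp only: nn_integral_null_set[OF null])
    then have "F -` A \<inter> space ?P \<in> null_sets ?P" using null_setsD2[OF null] by (intro null_setsI) simp_all
    then show "A \<in> null_sets ?P'" using null_setsD2[OF A]
      unfolding null_sets_distr_iff[OF FP] by simp
  qed
  define h where "h = RN_deriv ?Q' ?P'"
  have h: "h \<in> borel_measurable N"
    using borel_measurable_RN_deriv[of ?Q' ?P'] by (simp add: h_def)
  \<comment> \<open>Truncation at \<open>k\<close> makes the moment \<open>J k\<close> finite, so
    that it can later be subtracted from both sides. \<open>enn2real\<close> sends an infinite
    density value to 0, which keeps \<open>g k\<close> below \<open>h\<close>.\<close>
  define g where "g k x = min (enn2real (h x)) (real k)" for k x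
  have g: "g k \<in> borel_measurable N" for k using h unfolding g_def by measurable
  note gp = measurable_ennreal_powr[OF g]
  note gpF = measurable_compose[OF F gp]
  have g0: "0 \<le> g k x" for k x by (simp add: g_def)
  define J where "J k = (\<integral>\<^sup>+ x. ennreal (g k x powr \<alpha>) \<partial>?Q')" for k
  have J: "J k \<le> ennreal C" for k
  proof -
    have "J k \<le> (\<integral>\<^sup>+ x. ennreal (real k powr \<alpha>) \<partial>?Q')"
      unfolding J_def using \<alpha> g0 by (intro nn_integral_mono ennreal_leI powr_mono2) (auto simp: g_def)
    then have Jfin: "J k < \<infinity>" using Q'.emeasure_space_1 by (simp add: le_less_trans)
    have "ennreal \<alpha> * J k \<le> ennreal \<alpha> * (\<integral>\<^sup>+ x. h x * ennreal (g k x powr (\<alpha> - 1)) \<partial>?Q')"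
      unfolding J_def
    proof (intro mult_left_mono nn_integral_mono)
      fix x
      have "ennreal (g k x powr \<alpha>) = ennreal (g k x) * ennreal (g k x powr (\<alpha> - 1))"
        using g0[of k x] \<alpha> by (simp add: ennreal_mult[symmetric] powr_mult_base)
      also have "ennreal (g k x) \<le> h x"
        by (cases "h x") (auto simp: g_def intro!: ennreal_leI)
      finally show "ennreal (g k x powr \<alpha>) \<le> h x * ennreal (g k x powr (\<alpha> - 1))"
        by (simp add: mult_right_mono)
    qed simp
    also have "(\<integral>\<^sup>+ x. h x * ennreal (g k x powr (\<alpha> - 1)) \<partial>?Q') = (\<integral>\<^sup>+ x. ennreal (g k x powr (\<alpha> - 1)) \<partial>?P')"
    proof -
      have m: "(\<lambda>x. ennreal (g k x powr (\<alpha> - 1))) \<in> borel_measurable ?Q'"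
        unfolding measurable_distr_eq1 by (rule gp)
      have s: "sets ?P' = sets ?Q'" by (simp only: sets_distr)
      show ?thesis
        unfolding h_def by (rule Q'.RN_deriv_nn_integral[OF ac s m, symmetric])
    qed
    also have "\<dots> = (\<integral>\<^sup>+ x. ennreal (g k (F x) powr (\<alpha> - 1)) \<partial>?P)"
      by (rule nn_integral_distr[OF FP]) (simp only: measurable_distr_eq1 gp)
    also have "\<dots> = (\<integral>\<^sup>+ x. ennreal (f x) * ennreal (g k (F x) powr (\<alpha> - 1)) \<partial>Q)"
      by (rule nn_integral_density[OF fe gpF])
    also have "ennreal \<alpha> * \<dots> = (\<integral>\<^sup>+ x. ennreal \<alpha> * (ennreal (f x) * ennreal (g k (F x) powr (\<alpha> - 1))) \<partial>Q)"
      by (rule nn_integral_cmult[symmetric]) (rule borel_measurable_times_ennreal[OF fe gpF])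
    also have "\<dots> \<le> (\<integral>\<^sup>+ x. ennreal (f x powr \<alpha>) + ennreal (\<alpha> - 1) * ennreal (g k (F x) powr \<alpha>) \<partial>Q)"
    proof (rule nn_integral_mono)
      fix x
      have "ennreal (\<alpha> * (g k (F x) powr (\<alpha> - 1) * f x)) \<le> ennreal (f x powr \<alpha> + (\<alpha> - 1) * g k (F x) powr \<alpha>)"
        using Youngs_inequality_powr[OF \<alpha> f0 g0] by (intro ennreal_leI)
      then show "ennreal \<alpha> * (ennreal (f x) * ennreal (g k (F x) powr (\<alpha> - 1)))
        \<le> ennreal (f x powr \<alpha>) + ennreal (\<alpha> - 1) * ennreal (g k (F x) powr \<alpha>)"
        using \<alpha> f0[of x] by (simp add: ennreal_mult ennreal_plus mult_ac)
    qed
    also have "\<dots> = (\<integral>\<^sup>+ x. ennreal (f x powr \<alpha>) \<partial>Q) + ennreal (\<alpha> - 1) * (\<integral>\<^sup>+ x. ennreal (g k (F x) powr \<alpha>) \<partial>Q)"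
      using measurable_ennreal_powr[OF f] gpF by (subst nn_integral_add) (auto simp: nn_integral_cmult)
    also have "(\<integral>\<^sup>+ x. ennreal (g k (F x) powr \<alpha>) \<partial>Q) = J k"
      unfolding J_def by (rule nn_integral_distr[OF F, symmetric]) (simp only: measurable_distr_eq1 gp)
    finally have "ennreal \<alpha> * J k \<le> ennreal C + ennreal (\<alpha> - 1) * J k"
      using moment by (meson add_right_mono order_trans)
    moreover obtain j where j: "J k = ennreal j" "j \<ge> 0" using Jfin by (cases "J k") auto
    ultimately have "ennreal (\<alpha> * j) \<le> ennreal (C + (\<alpha> - 1) * j)"
      using \<alpha> C by (simp add: ennreal_mult ennreal_plus)
    then have "\<alpha> * j \<le> C + (\<alpha> - 1) * j" using \<alpha> C j(2) by (subst (asm) ennreal_le_iff) auto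
    \<comment> \<open>The weights \<alpha> and \<alpha> - 1 differ by exactly 1, so cancelling
      leaves \<open>j\<close> alone on the left.\<close>
    then have "j \<le> C" by (simp add: algebra_simps)
    then show ?thesis using j by (simp add: ennreal_leI)
  qed
  let ?I = "\<integral>\<^sup>+ x. ennreal (enn2real (h x) powr \<alpha>) \<partial>?Q'"
  have "?I = (\<integral>\<^sup>+ x. (SUP k. ennreal (g k x powr \<alpha>)) \<partial>?Q')"
  proof (rule nn_integral_cong)
    fix x
    show "ennreal (enn2real (h x) powr \<alpha>) = (SUP k. ennreal (g k x powr \<alpha>))"
    proof (rule antisym)
      obtain k where "enn2real (h x) \<le> real k" using real_arch_simple by blast
      then have "g k x = enn2real (h x)" by (simp add: g_def)
      then show "ennreal (enn2real (h x) powr \<alpha>) \<le> (SUP k. ennreal (g k x powr \<alpha>))"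
        by (metis SUP_upper UNIV_I)
      show "(SUP k. ennreal (g k x powr \<alpha>)) \<le> ennreal (enn2real (h x) powr \<alpha>)"
        using \<alpha> g0 by (intro SUP_least ennreal_leI powr_mono2) (auto simp: g_def)
    qed
  qed
  also have "\<dots> = (SUP k. J k)"
    unfolding J_def
  proof (rule nn_integral_monotone_convergence_SUP)
    show "incseq (\<lambda>k x. ennreal (g k x powr \<alpha>))"
      using \<alpha> g0 by (auto simp: mono_def le_fun_def intro!: ennreal_leI powr_mono2) (auto simp: g_def)
  qed (simp only: measurable_distr_eq1 gp)
  also have "\<dots> \<le> ennreal C" using J by (intro SUP_least)
  finally have I: "?I \<le> ennreal C" .
  then have fin: "?I < \<infinity>" by (simp add: le_less_trans)
  have "enn2real ?I \<le> C" using I C by (intro enn2real_leI) auto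
  \<comment> \<open>A vanishing integral would give the value \<open>ln 0 = 0\<close>, which
    \<open>C \<ge> 1\<close> covers.\<close>
  then have "ln (enn2real ?I) \<le> ln C"
    using C by (cases "enn2real ?I = 0") (auto simp: less_le)
  then have "ln (enn2real ?I) / (\<alpha> - 1) \<le> ln C / (\<alpha> - 1)" using \<alpha> by (simp add: divide_right_mono)
  then show ?thesis
    using ac fin unfolding renyi_divergence_def Let_def h_def[symmetric] by simp
qed

section \<open>Privacy\<close>

abbreviation upper_index :: "nat \<Rightarrow> (nat \<times> nat) set" where
  "upper_index d \<equiv> {(i, j). i \<le> j \<and> j < d}"

lemma finite_upper_index [simp]: "finite (upper_index d)"
  by (rule finite_subset[of _ "{..<d} \<times> {..<d}"]) auto

definition sym_mat_of :: "nat \<Rightarrow> (nat \<times> nat \<Rightarrow> real) \<Rightarrow> real mat" where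
  "sym_mat_of d g = mat d d (\<lambda>(i, j). g (min i j, max i j))"

lemma sym_mat_of_sym [simp]: "sym_mat_of d g \<in> sym_mats d"
  by (auto simp: sym_mat_of_def sym_mats_index min.commute max.commute)

lemma sum_sym_index:
  fixes d :: nat and F :: "nat \<Rightarrow> nat \<Rightarrow> real"
  assumes "\<And>i j. F i j = F j i"
  shows "(\<Sum>i<d. \<Sum>j<d. F i j) = (\<Sum>(i, j)\<in>upper_index d. if i = j then F i i else 2 * F i j)"
proof (induction d)
  case (Suc d)
  have U: "upper_index (Suc d) = upper_index d \<union> (\<lambda>i. (i, d)) ` {..d}"
    by (auto simp: less_Suc_eq)
  have "(\<Sum>(i, j)\<in>upper_index (Suc d). if i = j then F i i else 2 * F i j)
    = (\<Sum>(i, j)\<in>upper_index d. if i = j then F i i else 2 * F i j)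
    + (\<Sum>i\<le>d. if i = d then F i i else 2 * F i d)"
    unfolding U by (subst sum.union_disjoint) (auto simp: sum.reindex inj_on_def)
  also have "(\<Sum>i\<le>d. if i = d then F i i else 2 * F i d) = (\<Sum>i<d. 2 * F i d) + F d d"
    by (simp flip: lessThan_Suc_atMost)
  also have "(\<Sum>i<d. 2 * F i d) = (\<Sum>i<d. F i d) + (\<Sum>j<d. F d j)"
  proof -
    have "(\<Sum>j<d. F d j) = (\<Sum>i<d. F i d)" by (intro sum.cong refl assms)
    then show ?thesis by (simp flip: sum_distrib_left)
  qed
  finally show ?case using Suc.IH by (simp add: sum.distrib)
qed simp

lemma sym_mats_add: "A \<in> sym_mats d \<Longrightarrow> B \<in> sym_mats d \<Longrightarrow> A + B \<in> sym_mats d"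
  by (auto simp: sym_mats_index)

lemma sym_mats_diff: "A \<in> sym_mats d \<Longrightarrow> B \<in> sym_mats d \<Longrightarrow> A - B \<in> sym_mats d"
  by (auto simp: sym_mats_index)

lemma second_moment_sym [simp]: "second_moment d n S X \<in> sym_mats d"
  by (auto simp: second_moment_def sym_mats_index mult.commute)

lemma measurable_sym_mat_of:
  "sym_mat_of d \<in> normal_prod (upper_index d) v \<rightarrow>\<^sub>M sym_borel d"
proof (rule measurable_sym_borelI)
  fix i j assume "i < d" "j < d"
  then show "(\<lambda>g. sym_mat_of d g $$ (i, j)) \<in> borel_measurable (normal_prod (upper_index d) v)"
    unfolding sym_mat_of_def by (simp, intro measurable_normal_prod_component) auto
qed simp

lemma measurable_add_sym_mat:
  assumes "A \<in> sym_mats d"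
  shows "(\<lambda>B. A + B) \<in> sym_borel d \<rightarrow>\<^sub>M sym_borel d"
proof (rule measurable_sym_borelI)
  fix i j assume ij: "i < d" "j < d"
  have "(\<lambda>B. (A + B) $$ (i, j)) \<in> borel_measurable (sym_borel d)
    \<longleftrightarrow> (\<lambda>B. A $$ (i, j) + B $$ (i, j)) \<in> borel_measurable (sym_borel d)"
    using ij by (intro measurable_cong) (auto simp: sym_mats_def)
  also have "\<dots>" using ij by (intro borel_measurable_add) auto
  finally show "(\<lambda>B. (A + B) $$ (i, j)) \<in> borel_measurable (sym_borel d)" .
qed (use assms sym_mats_add in auto)

abbreviation output_space :: "nat \<Rightarrow> (real vec set \<times> real mat) measure" where
  "output_space d \<equiv> subspace_borel d \<Otimes>\<^sub>M sym_borel d"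

lemma measurable_noisy_output:
  assumes "A \<in> sym_mats d"
  shows "(\<lambda>g. weak_output d \<kappa> K (A + sym_mat_of d g))
    \<in> normal_prod (upper_index d) v \<rightarrow>\<^sub>M output_space d"
  using measurable_compose[OF measurable_compose[OF measurable_sym_mat_of measurable_add_sym_mat[OF assms]]
    measurable_weak_output] .

text \<open>Everything downstream of the Gaussian coordinates becomes one measurable function of
  them. In this post-processing form two datasets differ only by the symmetric matrix added inside
  that function.\<close>

lemma WeakPPC_eq:
  "WeakPPC cS c\<sigma> \<rho> \<beta> \<kappa> K d n X =
    distr (normal_prod (upper_index d) ((noise_scale c\<sigma> \<rho> \<beta> \<kappa> d n)\<^sup>2)) (output_space d)
      (\<lambda>g. weak_output d \<kappa> K (second_moment d n (trunc_set cS \<beta> \<kappa> d n X) X + sym_mat_of d g))"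
proof -
  let ?m = "second_moment d n (trunc_set cS \<beta> \<kappa> d n X) X"
  let ?v = "(noise_scale c\<sigma> \<rho> \<beta> \<kappa> d n)\<^sup>2"
  let ?T = "\<lambda>Z. let V = top_eigenspace d \<kappa> Z in (V, precond d K V)"
  have T: "?T \<in> sym_borel d \<rightarrow>\<^sub>M output_space d"
    unfolding Let_def using measurable_top_eigenspace measurable_precond by (rule measurable_Pair)
  have N: "(\<lambda>N. psd_proj d (?m + N)) \<in> sym_borel d \<rightarrow>\<^sub>M sym_borel d"
    by (rule measurable_compose[OF measurable_add_sym_mat measurable_psd_proj]) simp
  have "WeakPPC cS c\<sigma> \<rho> \<beta> \<kappa> K d n X
    = distr (GUE d ?v) (output_space d) (?T \<circ> (\<lambda>N. psd_proj d (?m + N)))"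
    unfolding WeakPPC_def NaivePCE_def
    by (rule distr_distr) (use T N in \<open>auto simp: GUE_def\<close>)
  also have "GUE d ?v = distr (normal_prod (upper_index d) ?v) (sym_borel d) (sym_mat_of d)"
    unfolding GUE_def sym_mat_of_def[abs_def] ..
  also have "distr \<dots> (output_space d) (?T \<circ> (\<lambda>N. psd_proj d (?m + N)))
    = distr (normal_prod (upper_index d) ?v) (output_space d) ((?T \<circ> (\<lambda>N. psd_proj d (?m + N))) \<circ> sym_mat_of d)"
    using measurable_comp[OF N T] measurable_sym_mat_of by (rule distr_distr)
  finally show ?thesis by (simp add: comp_def weak_output_def)
qed

lemma measurable_exp_linear [simp]:
  assumes "finite I"
  shows "(\<lambda>x. exp (\<Sum>i\<in>I. t i * x i - c i)) \<in> borel_measurable (normal_prod I v)"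
proof -
  have [measurable]: "(\<lambda>x. \<Sum>i\<in>I. t i * x i - c i) \<in> borel_measurable (normal_prod I v)"
    by (intro borel_measurable_sum borel_measurable_diff borel_measurable_times
        measurable_normal_prod_component) auto
  show ?thesis by measurable
qed

text \<open>Adding \<open>A\<close> in place of \<open>B\<close> amounts to shifting the noise
  coordinates by the difference, hence to tilting the Gaussian product; data processing then removes
  the common map. The sum in \<open>close\<close> runs over the upper triangle because the other
  entries repeat the same noise.\<close>

lemma gaussian_mechanism:
  assumes A: "A \<in> sym_mats d" and B: "B \<in> sym_mats d" and v: "v > 0" and \<alpha>: "\<alpha> > 1"
    and close: "(\<Sum>p\<in>upper_index d. (A $$ p - B $$ p)\<^sup>2) / (2 * v) \<le> \<rho>"
  shows "renyi_divergence \<alpha>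
      (distr (normal_prod (upper_index d) v) (output_space d) (\<lambda>g. weak_output d \<kappa> K (A + sym_mat_of d g)))
      (distr (normal_prod (upper_index d) v) (output_space d) (\<lambda>g. weak_output d \<kappa> K (B + sym_mat_of d g)))
    \<le> ereal (\<rho> * \<alpha>)"
proof -
  let ?I = "upper_index d"
  let ?Q = "normal_prod ?I v"
  define \<delta> where "\<delta> p = A $$ p - B $$ p" for p
  define f where "f x = exp (\<Sum>p\<in>?I. \<delta> p / v * x p - (\<delta> p)\<^sup>2 / (2 * v))" for x
  define D where "D = (\<Sum>p\<in>?I. (\<delta> p)\<^sup>2)"
  let ?F = "\<lambda>g. weak_output d \<kappa> K (B + sym_mat_of d g)"
  let ?s = "\<lambda>x. \<lambda>p\<in>?I. x p + \<delta> p"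
  note F = measurable_noisy_output[OF B, of \<kappa> K v]
  have s: "?s \<in> ?Q \<rightarrow>\<^sub>M ?Q"
    by (intro measurable_restrict) (auto intro!: borel_measurable_add measurable_normal_prod_component)
  have "A + sym_mat_of d g = B + sym_mat_of d (?s g)" for g
    using A B by (intro eq_matI) (auto simp: sym_mats_index sym_mat_of_def \<delta>_def min_def max_def)
  then have "distr ?Q (output_space d) (\<lambda>g. weak_output d \<kappa> K (A + sym_mat_of d g))
    = distr ?Q (output_space d) (?F \<circ> ?s)" by (simp add: comp_def)
  also have "\<dots> = distr (distr ?Q ?Q ?s) (output_space d) ?F"
    by (rule distr_distr[OF F s, symmetric])
  also have "distr ?Q ?Q ?s = density ?Q (\<lambda>x. ennreal (f x))"
    unfolding f_def using v by (intro normal_prod_exp_tilt[symmetric]) auto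
  finally have eq: "distr ?Q (output_space d) (\<lambda>g. weak_output d \<kappa> K (A + sym_mat_of d g))
    = distr (density ?Q (\<lambda>x. ennreal (f x))) (output_space d) ?F" .
  \<comment> \<open>The \<alpha>-moment of the tilt is exp(-\<alpha> D / (2v)) from its
    normalisation times exp(\<alpha>^2 D / (2v)) from the moment generating function; dividing the
    total exponent by \<alpha> - 1 leaves \<alpha> D / (2v).\<close>
  let ?C = "exp (\<alpha> * (\<alpha> - 1) * (D / (2 * v)))"
  have D0: "0 \<le> D" by (simp add: D_def sum_nonneg)
  have "(\<integral>\<^sup>+ x. ennreal (f x powr \<alpha>) \<partial>?Q)
    = (\<integral>\<^sup>+ x. ennreal (exp (- (\<alpha> * D / (2 * v)))) * ennreal (exp (\<Sum>p\<in>?I. (\<alpha> * \<delta> p / v) * x p)) \<partial>?Q)"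
  proof (rule nn_integral_cong)
    fix x
    have "\<alpha> * (\<Sum>p\<in>?I. \<delta> p / v * x p - (\<delta> p)\<^sup>2 / (2 * v)) = - (\<alpha> * D / (2 * v)) + (\<Sum>p\<in>?I. (\<alpha> * \<delta> p / v) * x p)"
      by (simp add: sum_subtractf right_diff_distrib D_def sum_distrib_left sum_divide_distrib mult.assoc)
    moreover have "f x powr \<alpha> = exp (\<alpha> * (\<Sum>p\<in>?I. \<delta> p / v * x p - (\<delta> p)\<^sup>2 / (2 * v)))"
      by (simp add: f_def powr_def)
    ultimately have "f x powr \<alpha> = exp (- (\<alpha> * D / (2 * v))) * exp (\<Sum>p\<in>?I. (\<alpha> * \<delta> p / v) * x p)"
      by (simp only: exp_add)
    then show "ennreal (f x powr \<alpha>)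
      = ennreal (exp (- (\<alpha> * D / (2 * v)))) * ennreal (exp (\<Sum>p\<in>?I. (\<alpha> * \<delta> p / v) * x p))"
      by (simp only: ennreal_mult exp_ge_zero)
  qed
  also have "\<dots> = ennreal (exp (- (\<alpha> * D / (2 * v)))) * (\<integral>\<^sup>+ x. ennreal (exp (\<Sum>p\<in>?I. (\<alpha> * \<delta> p / v) * x p)) \<partial>?Q)"
    using measurable_exp_linear[OF finite_upper_index, of "\<lambda>p. \<alpha> * \<delta> p / v" "\<lambda>_. 0" d v]
    by (intro nn_integral_cmult measurable_compose[OF _ measurable_ennreal]) simp
  also have "(\<integral>\<^sup>+ x. ennreal (exp (\<Sum>p\<in>?I. (\<alpha> * \<delta> p / v) * x p)) \<partial>?Q)
    = ennreal (exp (v * (\<Sum>p\<in>?I. (\<alpha> * \<delta> p / v)\<^sup>2) / 2))"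
    using v by (intro normal_prod_mgf) auto
  also have "ennreal (exp (- (\<alpha> * D / (2 * v)))) * \<dots> = ennreal ?C"
  proof -
    have "v * (\<Sum>p\<in>?I. (\<alpha> * \<delta> p / v)\<^sup>2) / 2 = \<alpha>\<^sup>2 * (D / (2 * v))"
    proof -
      have "(\<Sum>p\<in>?I. (\<alpha> * \<delta> p / v)\<^sup>2) = (\<alpha> / v)\<^sup>2 * D"
        unfolding D_def sum_distrib_left by (intro sum.cong) (auto simp: power2_eq_square)
      then show ?thesis using v by (simp add: power2_eq_square)
    qed
    moreover have "- (\<alpha> * D / (2 * v)) + \<alpha>\<^sup>2 * (D / (2 * v)) = \<alpha> * (\<alpha> - 1) * (D / (2 * v))"
      using v by (simp add: field_simps power2_eq_square)
    ultimately show ?thesis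
      by (simp only: ennreal_mult[symmetric] exp_ge_zero mult_exp_exp)
  qed
  finally have "(\<integral>\<^sup>+ x. ennreal (f x powr \<alpha>) \<partial>?Q) \<le> ennreal ?C" by simp
  moreover have "f \<in> borel_measurable ?Q"
    unfolding f_def[abs_def] by (rule measurable_exp_linear) simp
  moreover have "1 \<le> ?C" using \<alpha> D0 v by simp
  moreover have "0 \<le> f x" for x by (simp add: f_def)
  ultimately have "renyi_divergence \<alpha> (distr (density ?Q (\<lambda>x. ennreal (f x))) (output_space d) ?F)
      (distr ?Q (output_space d) ?F) \<le> ereal (ln ?C / (\<alpha> - 1))"
    using v \<alpha> by (intro renyi_divergence_distr_le F prob_space_normal_prod) auto
  also have "ln ?C / (\<alpha> - 1) = D / (2 * v) * \<alpha>" using \<alpha> by simp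
  also have "\<dots> \<le> \<rho> * \<alpha>" using close \<alpha> by (intro mult_right_mono) (auto simp: D_def \<delta>_def)
  finally show ?thesis unfolding eq by simp
qed

lemma renyi_divergence_refl:
  assumes "prob_space P" "\<alpha> > 1"
  shows "renyi_divergence \<alpha> P P \<le> 0"
proof -
  have "renyi_divergence \<alpha> (distr (density P (\<lambda>x. ennreal 1)) P (\<lambda>x. x)) (distr P P (\<lambda>x. x))
    \<le> ereal (ln 1 / (\<alpha> - 1))"
    using assms by (intro renyi_divergence_distr_le) (auto simp: prob_space.emeasure_space_1)
  then show ?thesis by (simp add: density_1 zero_ereal_def)
qed

text \<open>Truncation inspects each sample separately, so replacing sample \<open>m\<close> changes
  a single rank-one term. A kept term has Frobenius norm \<open>X m \<bullet> X m\<close>, hence at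
  most \<open>T\<close>; two such terms and (a - b)^2 \<le> 2 a^2 + 2 b^2 give the factor 4.\<close>

lemma sensitivity:
  assumes X: "X \<in> {..<n} \<rightarrow> carrier_vec d" and X': "X' \<in> {..<n} \<rightarrow> carrier_vec d"
    and nb: "neighbouring n X X'"
    and T: "T = cS * (real d * \<kappa> * ln (real n / \<beta>))" "T \<ge> 0"
  shows "(\<Sum>p\<in>upper_index d. (second_moment d n (trunc_set cS \<beta> \<kappa> d n X) X $$ p
      - second_moment d n (trunc_set cS \<beta> \<kappa> d n X') X' $$ p)\<^sup>2) \<le> 4 * T\<^sup>2 / (real n)\<^sup>2"
proof -
  let ?A = "second_moment d n (trunc_set cS \<beta> \<kappa> d n X) X"
  let ?B = "second_moment d n (trunc_set cS \<beta> \<kappa> d n X') X'"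
  obtain m where m: "m < n" "\<And>i. i < n \<Longrightarrow> i \<noteq> m \<Longrightarrow> X i = X' i"
    using nb by (auto simp: neighbouring_def)
  define w :: "(nat \<Rightarrow> real vec) \<Rightarrow> real" where "w Y = of_bool (Y m \<bullet> Y m \<le> T)" for Y
  have entry: "second_moment d n (trunc_set cS \<beta> \<kappa> d n Y) Y $$ (i, j)
    = (w Y * (Y m $ i * Y m $ j) + (\<Sum>k\<in>{..<n} - {m}. of_bool (Y k \<bullet> Y k \<le> T) * (Y k $ i * Y k $ j))) / n"
    if "i < d" "j < d" for Y i j
  proof -
    have "(\<Sum>k\<in>trunc_set cS \<beta> \<kappa> d n Y. Y k $ i * Y k $ j)
      = (\<Sum>k<n. of_bool (Y k \<bullet> Y k \<le> T) * (Y k $ i * Y k $ j))"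
      unfolding trunc_set_def T(1) by (intro sum.mono_neutral_cong_left) auto
    also have "\<dots> = w Y * (Y m $ i * Y m $ j) + (\<Sum>k\<in>{..<n} - {m}. of_bool (Y k \<bullet> Y k \<le> T) * (Y k $ i * Y k $ j))"
      using m(1) by (subst sum.remove[of _ m]) (simp_all add: w_def)
    finally show ?thesis using that by (simp add: second_moment_def)
  qed
  have "(\<Sum>k\<in>{..<n} - {m}. of_bool (X k \<bullet> X k \<le> T) * (X k $ i * X k $ j))
    = (\<Sum>k\<in>{..<n} - {m}. of_bool (X' k \<bullet> X' k \<le> T) * (X' k $ i * X' k $ j))" for i j
    using m(2) by (intro sum.cong) auto
  then have diff: "?A $$ (i, j) - ?B $$ (i, j)
    = (w X * (X m $ i * X m $ j) - w X' * (X' m $ i * X' m $ j)) / n" if "i < d" "j < d" for i j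
    unfolding entry[OF that] by (simp add: diff_divide_distrib[symmetric])
  have fourth: "(\<Sum>i<d. \<Sum>j<d. (w Y * (Y m $ i * Y m $ j))\<^sup>2) \<le> T\<^sup>2" if "Y m \<in> carrier_vec d" for Y
  proof -
    have "(\<Sum>i<d. \<Sum>j<d. (w Y * (Y m $ i * Y m $ j))\<^sup>2)
      = (\<Sum>i<d. \<Sum>j<d. (w Y * (Y m $ i * Y m $ i)) * (w Y * (Y m $ j * Y m $ j)))"
      by (simp add: power2_eq_square mult_ac)
    also have "\<dots> = (\<Sum>i<d. w Y * (Y m $ i * Y m $ i))\<^sup>2"
      by (simp only: power2_eq_square sum_product)
    also have "(\<Sum>i<d. w Y * (Y m $ i * Y m $ i)) = w Y * (Y m \<bullet> Y m)"
      unfolding scalar_prod_sum[OF that] by (rule sum_distrib_left[symmetric])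
    also have "(w Y * (Y m \<bullet> Y m))\<^sup>2 \<le> T\<^sup>2"
      using T(2) scalar_prod_self_nonneg[of "Y m"] by (intro power_mono) (auto simp: w_def)
    finally show ?thesis .
  qed
  have "(\<Sum>p\<in>upper_index d. (?A $$ p - ?B $$ p)\<^sup>2) \<le> (\<Sum>p\<in>{..<d} \<times> {..<d}. (?A $$ p - ?B $$ p)\<^sup>2)"
    by (intro sum_mono2) auto
  also have "\<dots> = (\<Sum>i<d. \<Sum>j<d. (?A $$ (i, j) - ?B $$ (i, j))\<^sup>2)"
    by (simp add: sum.cartesian_product)
  also have "\<dots> = (\<Sum>i<d. \<Sum>j<d. (w X * (X m $ i * X m $ j) - w X' * (X' m $ i * X' m $ j))\<^sup>2) / (real n)\<^sup>2"
    by (simp add: diff power_divide sum_divide_distrib)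
  also have "\<dots> \<le> (\<Sum>i<d. \<Sum>j<d. 2 * (w X * (X m $ i * X m $ j))\<^sup>2 + 2 * (w X' * (X' m $ i * X' m $ j))\<^sup>2) / (real n)\<^sup>2"
  proof (intro divide_right_mono sum_mono)
    fix i j
    have "(a - b)\<^sup>2 \<le> 2 * a\<^sup>2 + 2 * b\<^sup>2" for a b :: real
      using zero_le_power2[of "a + b"] by (simp add: power2_eq_square algebra_simps)
    then show "(w X * (X m $ i * X m $ j) - w X' * (X' m $ i * X' m $ j))\<^sup>2
      \<le> 2 * (w X * (X m $ i * X m $ j))\<^sup>2 + 2 * (w X' * (X' m $ i * X' m $ j))\<^sup>2" .
  qed simp
  also have "\<dots> = (2 * (\<Sum>i<d. \<Sum>j<d. (w X * (X m $ i * X m $ j))\<^sup>2)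
      + 2 * (\<Sum>i<d. \<Sum>j<d. (w X' * (X' m $ i * X' m $ j))\<^sup>2)) / (real n)\<^sup>2"
    by (simp only: sum.distrib sum_distrib_left)
  also have "\<dots> \<le> (2 * T\<^sup>2 + 2 * T\<^sup>2) / (real n)\<^sup>2"
    using X X' m(1) by (intro divide_right_mono add_mono mult_left_mono fourth) auto
  finally show ?thesis by simp
qed

text \<open>With the constant 2 \<open>cS\<close> the noise variance is 4 T^2 / (n^2 \<rho>), so the
  sensitivity bound divided by twice the variance equals \<rho>/2.\<close>

lemma WeakPPC_zCDP:
  assumes cS: "cS > 0" and pos: "d > 0" "n > 0" "\<rho> > 0" "\<beta> > 0" "\<kappa> > 0"
  shows "zCDP \<rho> n (carrier_vec d) (WeakPPC cS (2 * cS) \<rho> \<beta> \<kappa> K d n)"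
  unfolding zCDP_def
proof (intro ballI allI impI)
  fix X X' :: "nat \<Rightarrow> real vec" and \<alpha> :: real
  assume X: "X \<in> {..<n} \<rightarrow> carrier_vec d" and X': "X' \<in> {..<n} \<rightarrow> carrier_vec d"
    and nb: "neighbouring n X X'" and \<alpha>: "1 < \<alpha>"
  define T where "T = cS * (real d * \<kappa> * ln (real n / \<beta>))"
  let ?m = "\<lambda>X. second_moment d n (trunc_set cS \<beta> \<kappa> d n X) X"
  let ?v = "(noise_scale (2 * cS) \<rho> \<beta> \<kappa> d n)\<^sup>2"
  have noise: "noise_scale (2 * cS) \<rho> \<beta> \<kappa> d n = 2 * T / (real n * sqrt \<rho>)"
    by (simp add: noise_scale_def T_def)
  show "renyi_divergence \<alpha> (WeakPPC cS (2 * cS) \<rho> \<beta> \<kappa> K d n X) (WeakPPC cS (2 * cS) \<rho> \<beta> \<kappa> K d n X')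
    \<le> ereal (\<rho> * \<alpha>)"
  proof (cases "T > 0")
    case True
    then have v: "?v > 0" using pos by (simp add: noise)
    have "(\<Sum>p\<in>upper_index d. (?m X $$ p - ?m X' $$ p)\<^sup>2) / (2 * ?v) \<le> (4 * T\<^sup>2 / (real n)\<^sup>2) / (2 * ?v)"
      using sensitivity[OF X X' nb T_def] True v by (intro divide_right_mono) auto
    also have "\<dots> = \<rho> / 2" using True pos unfolding noise by (simp add: power_divide power_mult_distrib field_simps)
    finally have "(\<Sum>p\<in>upper_index d. (?m X $$ p - ?m X' $$ p)\<^sup>2) / (2 * ?v) \<le> \<rho>"
      using pos by simp
    then show ?thesis unfolding WeakPPC_eq using v \<alpha> by (intro gaussian_mechanism) auto
  next
    \<comment> \<open>Here \<beta> \<ge> n and the threshold is not positive: only zero vectors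
      survive truncation, both second moments vanish, and the two output laws coincide even when the
      noise is degenerate.\<close>
    case False
    have "?m Y = 0\<^sub>m d d" if Y: "Y \<in> {..<n} \<rightarrow> carrier_vec d" for Y
    proof -
      have "Y k = 0\<^sub>v d" if "k \<in> trunc_set cS \<beta> \<kappa> d n Y" for k
      proof -
        have "Y k \<bullet> Y k \<le> 0" "Y k \<in> carrier_vec d"
          using that False Y by (auto simp: trunc_set_def T_def)
        then show ?thesis using scalar_prod_self_nonneg[of "Y k"] scalar_prod_self_eq_0_iff by fastforce
      qed
      then show ?thesis by (intro eq_matI) (auto simp: second_moment_def)
    qed
    then have "?m X = ?m X'" using X X' by simp
    then have "WeakPPC cS (2 * cS) \<rho> \<beta> \<kappa> K d n X = WeakPPC cS (2 * cS) \<rho> \<beta> \<kappa> K d n X'"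
      unfolding WeakPPC_eq by simp
    moreover have "prob_space (WeakPPC cS (2 * cS) \<rho> \<beta> \<kappa> K d n X')"
      unfolding WeakPPC_eq
      by (intro prob_space.prob_space_distr prob_space_normal_prod measurable_noisy_output) auto
    ultimately have "renyi_divergence \<alpha> (WeakPPC cS (2 * cS) \<rho> \<beta> \<kappa> K d n X) (WeakPPC cS (2 * cS) \<rho> \<beta> \<kappa> K d n X') \<le> 0"
      using renyi_divergence_refl \<alpha> by metis
    also have "0 \<le> ereal (\<rho> * \<alpha>)" using pos \<alpha> by simp
    finally show ?thesis .
  qed
qed

section \<open>Operator norm of the noise\<close>

lemma normal_prod_chernoff:
  assumes I: "finite I" and v: "v > 0" and w: "(\<Sum>i\<in>I. (a i)\<^sup>2) \<le> w" "w > 0" and x: "x \<ge> 0"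
  shows "measure (normal_prod I v) {g \<in> space (normal_prod I v). x \<le> (\<Sum>i\<in>I. a i * g i)}
    \<le> exp (- x\<^sup>2 / (2 * v * w))" (is "measure ?Q ?E \<le> _")
proof -
  interpret prob_space ?Q using v by (intro prob_space_normal_prod) simp
  \<comment> \<open>This value minimises the exponent -t x + v w t^2 / 2 of the exponential Markov
    bound.\<close>
  define t where "t = x / (v * w)"
  have t: "t \<ge> 0" using v w x by (simp add: t_def)
  have S: "(\<lambda>g. \<Sum>i\<in>I. a i * g i) \<in> borel_measurable ?Q"
    by (intro borel_measurable_sum borel_measurable_times measurable_normal_prod_component) auto
  have E: "?E \<in> sets ?Q" using S by measurable
  have ex: "(\<lambda>g. exp (\<Sum>i\<in>I. (t * a i) * g i)) \<in> borel_measurable ?Q"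
    using measurable_exp_linear[OF I, of "\<lambda>i. t * a i" "\<lambda>_. 0"] by simp
  have "emeasure ?Q ?E = (\<integral>\<^sup>+ g. indicator ?E g \<partial>?Q)" using E by simp
  also have "\<dots> \<le> (\<integral>\<^sup>+ g. ennreal (exp (- t * x)) * ennreal (exp (\<Sum>i\<in>I. (t * a i) * g i)) \<partial>?Q)"
  proof (rule nn_integral_mono)
    fix g assume "g \<in> space ?Q"
    show "indicator ?E g \<le> ennreal (exp (- t * x)) * ennreal (exp (\<Sum>i\<in>I. (t * a i) * g i))"
    proof (cases "g \<in> ?E")
      case True
      then have "t * x \<le> t * (\<Sum>i\<in>I. a i * g i)" using t by (intro mult_left_mono) auto
      then have "0 \<le> - t * x + (\<Sum>i\<in>I. (t * a i) * g i)" by (simp add: sum_distrib_left mult.assoc)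
      then have "1 \<le> exp (- t * x) * exp (\<Sum>i\<in>I. (t * a i) * g i)" by (simp only: mult_exp_exp one_le_exp_iff)
      then have "ennreal 1 \<le> ennreal (exp (- t * x) * exp (\<Sum>i\<in>I. (t * a i) * g i))" by (rule ennreal_leI)
      then show ?thesis using True by (simp add: ennreal_mult)
    qed simp
  qed
  also have "\<dots> = ennreal (exp (- t * x)) * ennreal (exp (v * (\<Sum>i\<in>I. (t * a i)\<^sup>2) / 2))"
    using ex I v by (subst nn_integral_cmult) (auto simp: normal_prod_mgf)
  also have "\<dots> = ennreal (exp (- t * x + v * (\<Sum>i\<in>I. (t * a i)\<^sup>2) / 2))"
    by (simp only: ennreal_mult[symmetric] exp_ge_zero mult_exp_exp)
  also have "\<dots> \<le> ennreal (exp (- x\<^sup>2 / (2 * v * w)))"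
  proof (intro ennreal_leI exp_le_cancel_iff[THEN iffD2])
    have "(\<Sum>i\<in>I. (t * a i)\<^sup>2) = t\<^sup>2 * (\<Sum>i\<in>I. (a i)\<^sup>2)" by (simp add: power_mult_distrib sum_distrib_left)
    also have "\<dots> \<le> t\<^sup>2 * w" using w by (intro mult_left_mono) auto
    finally have "v * (\<Sum>i\<in>I. (t * a i)\<^sup>2) / 2 \<le> v * (t\<^sup>2 * w) / 2"
      using v by (intro divide_right_mono mult_left_mono) auto
    also have "v * (t\<^sup>2 * w) / 2 = t * x + - x\<^sup>2 / (2 * v * w)"
      using v w by (simp add: t_def power2_eq_square field_simps)
    finally show "- t * x + v * (\<Sum>i\<in>I. (t * a i)\<^sup>2) / 2 \<le> - x\<^sup>2 / (2 * v * w)" by simp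
  qed
  finally show ?thesis by (simp add: emeasure_eq_measure)
qed

lemma normal_prod_union_bound:
  assumes I: "finite I" and v: "v > 0" and J: "finite J"
    and w: "\<And>a. a \<in> J \<Longrightarrow> (\<Sum>i\<in>I. (a i)\<^sup>2) \<le> w" "w > 0" and x: "x \<ge> 0"
  shows "\<exists>E \<in> sets (normal_prod I v). 1 - 2 * real (card J) * exp (- x\<^sup>2 / (2 * v * w)) \<le> measure (normal_prod I v) E
    \<and> (\<forall>g\<in>E. \<forall>a\<in>J. \<bar>\<Sum>i\<in>I. a i * g i\<bar> \<le> x)"
proof -
  let ?Q = "normal_prod I v"
  interpret prob_space ?Q using v by (intro prob_space_normal_prod) simp
  let ?B = "\<lambda>a. {g \<in> space ?Q. x \<le> (\<Sum>i\<in>I. a i * g i)}"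
  \<comment> \<open>Adding the negated forms turns one-sided tails into bounds on absolute values
    and accounts for the factor 2.\<close>
  let ?K = "J \<union> (\<lambda>a i. - a i) ` J"
  let ?e = "exp (- x\<^sup>2 / (2 * v * w))"
  have B: "?B a \<in> sets ?Q" for a
  proof -
    have "(\<lambda>g. \<Sum>i\<in>I. a i * g i) \<in> borel_measurable ?Q"
      by (intro borel_measurable_sum borel_measurable_times measurable_normal_prod_component) auto
    then show ?thesis by measurable
  qed
  have "prob (\<Union>a\<in>?K. ?B a) \<le> (\<Sum>a\<in>?K. prob (?B a))"
  proof (rule finite_measure_subadditive_finite)
    show "finite ?K" using J by simp
    show "?B ` ?K \<subseteq> events" by (rule image_subsetI) (rule B)
  qed
  also have "\<dots> \<le> (\<Sum>a\<in>?K. ?e)"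
    using I v w x by (intro sum_mono normal_prod_chernoff) auto
  also have "\<dots> = real (card ?K) * ?e" by simp
  also have "\<dots> \<le> 2 * real (card J) * ?e"
  proof -
    have "card ?K \<le> card J + card ((\<lambda>a i. - a i) ` J)" by (rule card_Un_le)
    also have "\<dots> \<le> 2 * card J" using card_image_le[OF J, of "\<lambda>a i. - a i"] by simp
    finally have "real (card ?K) \<le> 2 * real (card J)" by linarith
    then show ?thesis by (intro mult_right_mono) auto
  qed
  finally have bad: "prob (\<Union>a\<in>?K. ?B a) \<le> 2 * real (card J) * ?e" .
  let ?E = "space ?Q - (\<Union>a\<in>?K. ?B a)"
  have "finite ?K" using J by simp
  then have U: "(\<Union>a\<in>?K. ?B a) \<in> sets ?Q" using B by (intro sets.finite_UN)
  show ?thesis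
  proof (intro bexI[of _ ?E] conjI ballI)
    show "?E \<in> sets ?Q" using U by auto
    show "1 - 2 * real (card J) * ?e \<le> prob ?E" using prob_compl[OF U] bad by simp
    fix g a assume g: "g \<in> ?E" and a: "a \<in> J"
    have "\<not> x \<le> (\<Sum>i\<in>I. a i * g i)" "\<not> x \<le> (\<Sum>i\<in>I. - a i * g i)"
      using g a by auto
    then show "\<bar>\<Sum>i\<in>I. a i * g i\<bar> \<le> x" by (simp add: sum_negf)
  qed
qed

text \<open>This replaces an \<open>\<epsilon>\<close>-net of the sphere by lattice points.\<close>

lemma multiaffine_rounding:
  fixes F :: "(nat \<Rightarrow> real) \<Rightarrow> real"
  assumes affine: "\<And>i z. \<exists>a b. \<forall>x. F (z(i := x)) = a + b * x"
  shows "\<exists>z::nat \<Rightarrow> real. (\<forall>i<k. z i = real_of_int \<lfloor>y i\<rfloor> \<or> z i = real_of_int \<lceil>y i\<rceil>) \<and> (\<forall>i\<ge>k. z i = y i) \<and> F y \<le> F z"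
proof (induction k)
  case 0
  then show ?case by (intro exI[of _ y]) auto
next
  case (Suc k)
  then obtain z where z: "\<forall>i<k. z i = real_of_int \<lfloor>y i\<rfloor> \<or> z i = real_of_int \<lceil>y i\<rceil>" "\<forall>i\<ge>k. z i = y i" "F y \<le> F z" by blast
  obtain a b where ab: "\<And>x. F (z(k := x)) = a + b * x" using affine by blast
  have Fz: "F z = a + b * y k" using ab[of "y k"] z(2) by (simp add: fun_upd_idem)
  \<comment> \<open>Along one coordinate the function is affine, so rounding in the direction given
    by the sign of the slope cannot decrease it.\<close>
  define r where "r = real_of_int (if b \<ge> 0 then \<lceil>y k\<rceil> else \<lfloor>y k\<rfloor>)"
  have "b * y k \<le> b * r"
    by (auto simp: r_def mult_left_mono mult_left_mono_neg)
  then have "F y \<le> F (z(k := r))" using z(3) Fz ab by simp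
  moreover have "\<forall>i<Suc k. (z(k := r)) i = real_of_int \<lfloor>y i\<rfloor> \<or> (z(k := r)) i = real_of_int \<lceil>y i\<rceil>"
    using z(1) by (auto simp: r_def less_Suc_eq)
  moreover have "\<forall>i\<ge>Suc k. (z(k := r)) i = y i" using z(2) by auto
  ultimately show ?case by blast
qed

lemma sum_half_power_abs: "(\<Sum>k\<in>{- int M..int M}. (1/2 :: real) ^ nat \<bar>k\<bar>) = 3 - 2 * (1/2) ^ M"
proof (induction M)
  case (Suc M)
  have "{- int (Suc M)..int (Suc M)} = insert (- int (Suc M)) (insert (int (Suc M)) {- int M..int M})"
    by auto
  then have "(\<Sum>k\<in>{- int (Suc M)..int (Suc M)}. (1/2 :: real) ^ nat \<bar>k\<bar>)
    = 2 * (1/2) ^ Suc M + (\<Sum>k\<in>{- int M..int M}. (1/2 :: real) ^ nat \<bar>k\<bar>)"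
    by (simp add: nat_add_distrib)
  then show ?case using Suc.IH by simp
qed simp

text \<open>The integer points of the l1-ball of radius 2d, a region reached by rounding vectors of
  squared Euclidean norm \<open>d\<close>. The coordinate box follows from the norm bound and places
  the set inside a finite product.\<close>

definition lattice_points :: "nat \<Rightarrow> (nat \<Rightarrow> int) set" where
  "lattice_points d = {z \<in> {..<d} \<rightarrow>\<^sub>E {- int (2 * d)..int (2 * d)}. (\<Sum>i<d. nat \<bar>z i\<bar>) \<le> 2 * d}"

lemma finite_lattice_points: "finite (lattice_points d)"
  by (rule finite_subset[of _ "{..<d} \<rightarrow>\<^sub>E {- int (2 * d)..int (2 * d)}"])
    (auto simp: lattice_points_def intro!: finite_PiE)

text \<open>Exponential weighting: on the l1-ball, 4^d times the product of all 2^(-|z_i|) is at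
  least 1, and over the whole box this weight factorises into one-dimensional sums below 3. The
  total is at most 4^d 3^d.\<close>

lemma card_lattice_points: "card (lattice_points d) \<le> 12 ^ d"
proof -
  let ?P = "{..<d} \<rightarrow>\<^sub>E {- int (2 * d)..int (2 * d)}"
  have "real (card (lattice_points d)) = (\<Sum>z\<in>lattice_points d. 1)" by simp
  also have "\<dots> \<le> (\<Sum>z\<in>lattice_points d. 4 ^ d * (\<Prod>i<d. (1/2) ^ nat \<bar>z i\<bar>))"
  proof (rule sum_mono)
    fix z assume "z \<in> lattice_points d"
    then have "(\<Sum>i<d. nat \<bar>z i\<bar>) \<le> 2 * d" by (simp add: lattice_points_def)
    then have "(1/2 :: real) ^ (2 * d) \<le> (1/2) ^ (\<Sum>i<d. nat \<bar>z i\<bar>)"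
      by (intro power_decreasing) auto
    then have "4 ^ d * (1/2 :: real) ^ (2 * d) \<le> 4 ^ d * (\<Prod>i<d. (1/2) ^ nat \<bar>z i\<bar>)"
      by (simp add: power_sum)
    moreover have "4 ^ d * (1/2 :: real) ^ (2 * d) = 1"
      by (simp add: power_mult power_divide flip: power_mult_distrib)
    ultimately show "1 \<le> 4 ^ d * (\<Prod>i<d. (1/2 :: real) ^ nat \<bar>z i\<bar>)" by simp
  qed
  also have "\<dots> \<le> (\<Sum>z\<in>?P. 4 ^ d * (\<Prod>i<d. (1/2) ^ nat \<bar>z i\<bar>))"
  proof (rule sum_mono2)
    show "finite ?P" by (intro finite_PiE) auto
    show "lattice_points d \<subseteq> ?P" unfolding lattice_points_def by (rule Collect_restrict)
  qed (intro mult_nonneg_nonneg prod_nonneg, simp_all)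
  also have "\<dots> = 4 ^ d * (\<Prod>i<d. \<Sum>k\<in>{- int (2 * d)..int (2 * d)}. (1/2) ^ nat \<bar>k\<bar>)"
    unfolding sum_distrib_left[symmetric] by (subst prod_sum_PiE) auto
  also have "\<dots> \<le> 4 ^ d * 3 ^ d"
  proof (rule mult_left_mono)
    have "(\<Prod>i<d. \<Sum>k\<in>{- int (2 * d)..int (2 * d)}. (1/2 :: real) ^ nat \<bar>k\<bar>) \<le> (\<Prod>i<d. 3)"
      unfolding sum_half_power_abs
      by (intro prod_mono) (auto simp: power_le_one intro: order_trans[of _ 2])
    then show "(\<Prod>i<d. \<Sum>k\<in>{- int (2 * d)..int (2 * d)}. (1/2 :: real) ^ nat \<bar>k\<bar>) \<le> 3 ^ d" by simp
  qed simp
  also have "\<dots> = 12 ^ d" by (simp flip: power_mult_distrib)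
  finally have "real (card (lattice_points d)) \<le> real (12 ^ d)" by simp
  then show ?thesis by (simp only: of_nat_le_iff)
qed

text \<open>The off-diagonal part of a symmetric quadratic form at z, read as a linear form in the
  noise coordinates. Without the squares z_i^2 it is affine in each z_i separately, as rounding
  requires; the factor 2 accounts for the lower triangle.\<close>

definition offdiag_coeff :: "(nat \<Rightarrow> real) \<Rightarrow> nat \<times> nat \<Rightarrow> real" where
  "offdiag_coeff z = (\<lambda>(i, j). if i < j then 2 * z i * z j else 0)"

lemma sum_offdiag_coeff_sq:
  "(\<Sum>p\<in>upper_index d. (offdiag_coeff z p)\<^sup>2) \<le> 4 * (\<Sum>i<d. (z i)\<^sup>2)\<^sup>2"
proof -
  have "(\<Sum>p\<in>upper_index d. (offdiag_coeff z p)\<^sup>2) \<le> (\<Sum>p\<in>upper_index d. 4 * ((z (fst p))\<^sup>2 * (z (snd p))\<^sup>2))"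
    by (intro sum_mono) (auto simp: offdiag_coeff_def power2_eq_square)
  also have "\<dots> \<le> (\<Sum>p\<in>{..<d} \<times> {..<d}. 4 * ((z (fst p))\<^sup>2 * (z (snd p))\<^sup>2))"
    by (intro sum_mono2) auto
  also have "\<dots> = (\<Sum>i<d. \<Sum>j<d. 4 * ((z i)\<^sup>2 * (z j)\<^sup>2))"
    unfolding sum.cartesian_product case_prod_unfold ..
  also have "\<dots> = 4 * (\<Sum>i<d. \<Sum>j<d. (z i)\<^sup>2 * (z j)\<^sup>2)"
    by (simp only: sum_distrib_left)
  also have "(\<Sum>i<d. \<Sum>j<d. (z i)\<^sup>2 * (z j)\<^sup>2) = (\<Sum>i<d. (z i)\<^sup>2)\<^sup>2"
    by (simp only: power2_eq_square[of "\<Sum>i<d. (z i)\<^sup>2"] sum_product)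
  finally show ?thesis .
qed

lemma sym_mat_of_quadratic_form:
  assumes u: "u \<in> carrier_vec d"
  shows "u \<bullet> (sym_mat_of d g *\<^sub>v u)
    = (\<Sum>i<d. g (i, i) * (u $ i)\<^sup>2) + (\<Sum>p\<in>upper_index d. offdiag_coeff (\<lambda>i. u $ i) p * g p)"
proof -
  let ?N = "sym_mat_of d g"
  let ?F = "\<lambda>i j. g (min i j, max i j) * u $ i * u $ j"
  have "u \<bullet> (?N *\<^sub>v u) = (\<Sum>i<d. \<Sum>j<d. ?F i j)"
    using u by (subst scalar_prod_mat_sum[of _ d d]) (auto simp: sym_mat_of_def)
  also have "\<dots> = (\<Sum>(i, j)\<in>upper_index d. if i = j then ?F i i else 2 * ?F i j)"
    by (rule sum_sym_index) (simp add: min.commute max.commute mult_ac)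
  also have "\<dots> = (\<Sum>(i, j)\<in>upper_index d. (if i = j then g (i, i) * (u $ i)\<^sup>2 else 0) + offdiag_coeff (\<lambda>i. u $ i) (i, j) * g (i, j))"
    by (intro sum.cong) (auto simp: offdiag_coeff_def power2_eq_square min_def max_def)
  also have "\<dots> = (\<Sum>(i, j)\<in>upper_index d. if i = j then g (i, i) * (u $ i)\<^sup>2 else 0)
      + (\<Sum>p\<in>upper_index d. offdiag_coeff (\<lambda>i. u $ i) p * g p)"
    by (simp add: sum.distrib case_prod_unfold)
  also have "(\<Sum>(i, j)\<in>upper_index d. if i = j then g (i, i) * (u $ i)\<^sup>2 else 0)
    = (\<Sum>p\<in>(\<lambda>i. (i, i)) ` {..<d}. g p * (u $ fst p)\<^sup>2)"
    by (rule sum.mono_neutral_cong_right) (auto split: if_splits)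
  also have "\<dots> = (\<Sum>i<d. g (i, i) * (u $ i)\<^sup>2)"
    by (subst sum.reindex) (auto simp: inj_on_def)
  finally show ?thesis .
qed

text \<open>At squared norm \<open>d\<close> the coordinates have mean square 1, so rounding costs
  only constant factors: the squared norm is at most 4d by (|y| + 1)^2 \<le> 2 y^2 + 2, and the
  l1-norm at most 2d by |y| + 1 \<le> y^2/2 + 3/2.\<close>

lemma offdiag_rounding:
  fixes g :: "nat \<times> nat \<Rightarrow> real"
  assumes y: "(\<Sum>i<d. (y i)\<^sup>2) = real d"
  shows "\<exists>z\<in>lattice_points d. (\<Sum>i<d. (real_of_int (z i))\<^sup>2) \<le> 4 * real d \<and>
    (\<Sum>p\<in>upper_index d. offdiag_coeff y p * g p) \<le> (\<Sum>p\<in>upper_index d. offdiag_coeff (\<lambda>i. real_of_int (z i)) p * g p)"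
proof -
  let ?F = "\<lambda>z. \<Sum>p\<in>upper_index d. offdiag_coeff z p * g p"
  have "\<exists>a b. \<forall>x. ?F (z(k := x)) = a + b * x" for k z
  proof (intro exI allI)
    fix x
    let ?a = "\<lambda>(i, j). if i = k \<or> j = k then 0 else offdiag_coeff z (i, j) * g (i, j)"
    let ?b = "\<lambda>(i, j). if i < j then 2 * g (i, j) * (if i = k then z j else if j = k then z i else 0) else 0"
    have "?F (z(k := x)) = (\<Sum>p\<in>upper_index d. ?a p + ?b p * x)"
      by (intro sum.cong) (auto simp: offdiag_coeff_def)
    then show "?F (z(k := x)) = sum ?a (upper_index d) + sum ?b (upper_index d) * x"
      by (simp add: sum.distrib sum_distrib_right)
  qed
  from multiaffine_rounding[of ?F, OF this, of d y]
  obtain z' where z': "\<And>i. i < d \<Longrightarrow> z' i = real_of_int \<lfloor>y i\<rfloor> \<or> z' i = real_of_int \<lceil>y i\<rceil>" "?F y \<le> ?F z'" by blast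
  define z where "z = (\<lambda>i\<in>{..<d}. \<lfloor>z' i\<rfloor>)"
  have zz: "real_of_int (z i) = z' i" if "i < d" for i
    using z'(1)[OF that] that by (auto simp: z_def)
  have abs: "\<bar>real_of_int (z i)\<bar> \<le> \<bar>y i\<bar> + 1" if "i < d" for i
    unfolding zz[OF that] using z'(1)[OF that] by linarith
  have "(\<Sum>i<d. (real_of_int (z i))\<^sup>2) \<le> (\<Sum>i<d. 2 * (y i)\<^sup>2 + 2)"
  proof (rule sum_mono)
    fix i assume "i \<in> {..<d}"
    then have "(real_of_int (z i))\<^sup>2 \<le> (\<bar>y i\<bar> + 1)\<^sup>2" using abs[of i] by (simp add: abs_le_square_iff[symmetric])
    also have "\<dots> \<le> 2 * (y i)\<^sup>2 + 2"
      using zero_le_power2[of "\<bar>y i\<bar> - 1"] by (simp add: power2_eq_square algebra_simps)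
    finally show "(real_of_int (z i))\<^sup>2 \<le> 2 * (y i)\<^sup>2 + 2" .
  qed
  also have "\<dots> = 4 * real d" by (simp add: sum.distrib y flip: sum_distrib_left)
  finally have sq: "(\<Sum>i<d. (real_of_int (z i))\<^sup>2) \<le> 4 * real d" .
  have "real (\<Sum>i<d. nat \<bar>z i\<bar>) = (\<Sum>i<d. \<bar>real_of_int (z i)\<bar>)" by simp
  also have "\<dots> \<le> (\<Sum>i<d. (y i)\<^sup>2 / 2 + 3/2)"
  proof (rule sum_mono)
    fix i assume "i \<in> {..<d}"
    moreover have "\<bar>y i\<bar> \<le> (y i)\<^sup>2 / 2 + 1/2"
      using zero_le_power2[of "\<bar>y i\<bar> - 1"] by (simp add: power2_eq_square algebra_simps)
    ultimately show "\<bar>real_of_int (z i)\<bar> \<le> (y i)\<^sup>2 / 2 + 3/2" using abs[of i] by simp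
  qed
  also have "\<dots> = 2 * real d" by (simp add: sum.distrib y flip: sum_divide_distrib)
  finally have l1: "(\<Sum>i<d. nat \<bar>z i\<bar>) \<le> 2 * d" by linarith
  have "z i \<in> {- int (2 * d)..int (2 * d)}" if "i < d" for i
  proof -
    have "nat \<bar>z i\<bar> \<le> (\<Sum>i<d. nat \<bar>z i\<bar>)" using that by (intro member_le_sum) auto
    then show ?thesis using l1 by auto
  qed
  then have "z \<in> lattice_points d" using l1 by (auto simp: lattice_points_def z_def)
  moreover have "?F z' = ?F (\<lambda>i. real_of_int (z i))"
  proof (rule sum.cong[OF refl])
    fix p assume "p \<in> upper_index d"
    then obtain i j where "p = (i, j)" "i < d" "j < d" by (cases p) auto
    then show "offdiag_coeff z' p * g p = offdiag_coeff (\<lambda>i. real_of_int (z i)) p * g p"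
      by (simp add: offdiag_coeff_def zz)
  qed
  ultimately show ?thesis using sq z'(2) by auto
qed

text \<open>A union bound over the rounded off-diagonal forms and the \<open>d\<close> diagonal
  entries, at most exp(5d) linear forms of the noise in all. The estimate is linear in
  \<open>L\<close> and not in its square root, which produces the factor ln(1/\<beta>) of
  \<open>err_\<phi>\<close>.\<close>

lemma gaussian_operator_norm:
  assumes d: "d > 0" and v: "v > 0" and L: "L \<ge> 1/2"
  defines "B \<equiv> 128 * sqrt v * sqrt (real d) * L"
  shows "\<exists>E \<in> sets (normal_prod (upper_index d) v). 1 - 2 * exp (- L) \<le> measure (normal_prod (upper_index d) v) E \<and>
    (\<forall>g\<in>E. \<forall>u\<in>carrier_vec d. \<bar>u \<bullet> (sym_mat_of d g *\<^sub>v u)\<bar> \<le> B * (u \<bullet> u))"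
proof -
  let ?I = "upper_index d"
  let ?Q = "normal_prod ?I v"
  define T where "T = {z \<in> lattice_points d. (\<Sum>i<d. (real_of_int (z i))\<^sup>2) \<le> 4 * real d}"
  \<comment> \<open>The diagonal forms are scaled by \<open>d\<close> so that one threshold
    \<open>x\<close> serves all forms. They yield |g(i,i)| \<le> x/d, which contributes
    \<open>x\<close> when summed against a vector of squared norm \<open>d\<close>.\<close>
  define J where "J = (\<lambda>z. offdiag_coeff (\<lambda>i. real_of_int (z i))) ` T
    \<union> (\<lambda>i p. if p = (i, i) then real d else 0) ` {..<d}"
  \<comment> \<open>With the variance proxy \<open>w\<close>, which is 4 times (4d)^2, the Gaussian
    exponent becomes 32 d L^2. Since L \<ge> 1/2, it pays for the 5d of the union bound and for
    \<open>L\<close> itself.\<close>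
  define x where "x = 64 * sqrt v * (real d * sqrt (real d)) * L"
  define w where "w = 64 * (real d)\<^sup>2"
  have finT: "finite T" using finite_lattice_points by (auto simp: T_def)
  have finJ: "finite J" using finT by (simp add: J_def)
  have w: "w > 0" using d by (simp add: w_def)
  have x: "x \<ge> 0" using v L by (simp add: x_def)
  have Jw: "(\<Sum>p\<in>?I. (a p)\<^sup>2) \<le> w" if "a \<in> J" for a
  proof -
    from that consider z where "z \<in> T" "a = offdiag_coeff (\<lambda>i. real_of_int (z i))"
      | i where "i < d" "a = (\<lambda>p. if p = (i, i) then real d else 0)" by (auto simp: J_def)
    then show ?thesis
    proof cases
      case 1
      have "(\<Sum>p\<in>?I. (a p)\<^sup>2) \<le> 4 * (\<Sum>i<d. (real_of_int (z i))\<^sup>2)\<^sup>2"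
        unfolding 1(2) by (rule sum_offdiag_coeff_sq)
      also have "\<dots> \<le> 4 * (4 * real d)\<^sup>2"
        using 1(1) by (intro mult_left_mono power_mono) (auto simp: T_def sum_nonneg)
      finally show ?thesis by (simp add: w_def power_mult_distrib)
    next
      case 2
      have "(\<Sum>p\<in>?I. (a p)\<^sup>2) = (\<Sum>p\<in>?I. if p = (i, i) then (real d)\<^sup>2 else 0)"
        unfolding 2(2) by (intro sum.cong) auto
      also have "\<dots> \<le> w" by (simp add: w_def)
      finally show ?thesis .
    qed
  qed
  have "real (card J) \<le> exp (5 * real d)"
  proof -
    have "card J \<le> card ((\<lambda>z. offdiag_coeff (\<lambda>i. real_of_int (z i))) ` T)
        + card ((\<lambda>i p. if p = (i, i) then real d else 0) ` {..<d})"
      unfolding J_def by (rule card_Un_le)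
    also have "\<dots> \<le> card T + d"
      using card_image_le[OF finT] card_image_le[of "{..<d}"] by (intro add_mono) force+
    also have "card T \<le> 12 ^ d"
      using card_mono[OF finite_lattice_points, of T d] card_lattice_points[of d] by (auto simp: T_def)
    also have "(12::nat) ^ d + d \<le> 12 ^ d + 12 ^ d"
      using less_exp[of d] power_mono[of "2::nat" 12 d] by linarith
    also have "\<dots> = 2 ^ 1 * 12 ^ d" by simp
    also have "\<dots> \<le> 2 ^ d * 12 ^ d" using d by (intro mult_right_mono power_increasing) auto
    also have "\<dots> = 24 ^ d" by (simp flip: power_mult_distrib)
    finally have "real (card J) \<le> real (24 ^ d)" by (simp only: of_nat_le_iff)
    also have "real (24 ^ d) = 24 ^ d" by simp
    also have "\<dots> \<le> (exp 5) ^ d"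
    proof (rule power_mono)
      have "(24 :: real) \<le> 2 ^ 5" by simp
      also have "\<dots> \<le> exp 1 ^ 5" using exp_ge_add_one_self[of 1] by (intro power_mono) auto
      finally show "(24::real) \<le> exp 5" by (simp flip: exp_of_nat_mult)
    qed simp
    finally show ?thesis by (simp add: mult.commute flip: exp_of_nat_mult)
  qed
  moreover have "exp (- x\<^sup>2 / (2 * v * w)) \<le> exp (- (5 * real d) - L)"
  proof -
    have "x\<^sup>2 = 64\<^sup>2 * v * ((real d)\<^sup>2 * real d) * L\<^sup>2"
      using v by (simp add: x_def power_mult_distrib)
    then have "x\<^sup>2 / (2 * v * w) = 32 * real d * L\<^sup>2" using v d by (simp add: w_def field_simps)
    moreover have "5 * real d \<le> 20 * (real d * L\<^sup>2)"
    proof -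
      have "(1/2)\<^sup>2 \<le> L\<^sup>2" using L by (intro power_mono) auto
      then have "real d * (1/4) \<le> real d * L\<^sup>2" by (intro mult_left_mono) (auto simp: power2_eq_square)
      then show ?thesis by simp
    qed
    moreover have "L \<le> 2 * (real d * L\<^sup>2)"
    proof -
      have "L \<le> L * (2 * L)" using L mult_left_mono[of 1 "2 * L" L] by simp
      also have "\<dots> = 1 * (2 * L\<^sup>2)" by (simp add: power2_eq_square)
      also have "\<dots> \<le> real d * (2 * L\<^sup>2)" using d by (intro mult_right_mono) auto
      finally show ?thesis by simp
    qed
    moreover have "0 \<le> real d * L\<^sup>2" by simp
    ultimately show ?thesis by simp
  qed
  ultimately have tail: "2 * real (card J) * exp (- x\<^sup>2 / (2 * v * w)) \<le> 2 * exp (- L)"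
  proof -
    assume 1: "real (card J) \<le> exp (5 * real d)" and 2: "exp (- x\<^sup>2 / (2 * v * w)) \<le> exp (- (5 * real d) - L)"
    have "real (card J) * exp (- x\<^sup>2 / (2 * v * w)) \<le> exp (5 * real d) * exp (- (5 * real d) - L)"
      using 1 2 by (intro mult_mono) auto
    also have "\<dots> = exp (- L)" by (simp add: mult_exp_exp)
    finally show ?thesis by simp
  qed
  obtain E where E: "E \<in> sets ?Q" "1 - 2 * real (card J) * exp (- x\<^sup>2 / (2 * v * w)) \<le> measure ?Q E"
    "\<And>g a. g \<in> E \<Longrightarrow> a \<in> J \<Longrightarrow> \<bar>\<Sum>p\<in>?I. a p * g p\<bar> \<le> x"
    using normal_prod_union_bound[OF finite_upper_index v finJ Jw w x] by blast
  show ?thesis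
  proof (intro bexI[OF _ E(1)] conjI ballI)
    show "1 - 2 * exp (- L) \<le> measure ?Q E" using E(2) tail by linarith
    fix g and u :: "real vec" assume g: "g \<in> E" and u: "u \<in> carrier_vec d"
    show "\<bar>u \<bullet> (sym_mat_of d g *\<^sub>v u)\<bar> \<le> B * (u \<bullet> u)"
    proof (cases "u \<bullet> u = 0")
      case True
      then have "u = 0\<^sub>v d" using u scalar_prod_self_eq_0_iff by blast
      then show ?thesis
        using mult_mat_vec_carrier[OF sym_matsD(1)[OF sym_mat_of_sym] u] by simp
    next
      case False
      \<comment> \<open>Scaling to squared norm \<open>d\<close>: the diagonal and off-diagonal
        parts contribute \<open>x\<close> each, and 2 x c equals \<open>B\<close> times
        \<open>u \<bullet> u\<close>.\<close>
      define c where "c = u \<bullet> u / real d"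
      have c: "c > 0" using False scalar_prod_self_nonneg[of u] d by (simp add: c_def)
      define y where "y i = u $ i / sqrt c" for i
      have uy: "u $ i = sqrt c * y i" for i using c by (simp add: y_def)
      have y2: "(\<Sum>i<d. (y i)\<^sup>2) = real d"
      proof -
        have "(\<Sum>i<d. (y i)\<^sup>2) = (u \<bullet> u) / c"
          unfolding scalar_prod_sum[OF u] using c by (simp add: y_def power_divide sum_divide_distrib power2_eq_square)
        then show ?thesis using False d by (simp add: c_def)
      qed
      let ?F = "\<lambda>z g. \<Sum>p\<in>?I. offdiag_coeff z p * g p"
      have Fz: "\<bar>?F (\<lambda>i. real_of_int (z i)) g\<bar> \<le> x" if "z \<in> T" for z
        using that g by (intro E(3)) (auto simp: J_def)
      have "?F y g \<le> x"
        using offdiag_rounding[OF y2, of g] Fz by (force simp: T_def)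
      moreover have "- ?F y g \<le> x"
      proof -
        obtain z where "z \<in> T" "?F y (\<lambda>p. - g p) \<le> ?F (\<lambda>i. real_of_int (z i)) (\<lambda>p. - g p)"
          using offdiag_rounding[OF y2, of "\<lambda>p. - g p"] by (auto simp: T_def)
        then show ?thesis using Fz[of z] by (simp add: sum_negf)
      qed
      ultimately have off: "\<bar>?F y g\<bar> \<le> x" by linarith
      have diag: "\<bar>g (i, i)\<bar> \<le> x / real d" if "i < d" for i
      proof -
        have "\<bar>\<Sum>p\<in>?I. (if p = (i, i) then real d else 0) * g p\<bar> \<le> x"
          using that g by (intro E(3)) (auto simp: J_def)
        also have "(\<Sum>p\<in>?I. (if p = (i, i) then real d else 0) * g p) = (\<Sum>p\<in>?I. if p = (i, i) then real d * g (i, i) else 0)"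
          by (intro sum.cong) auto
        also have "\<dots> = real d * g (i, i)" using that by simp
        finally show ?thesis using d by (simp add: abs_mult field_simps)
      qed
      have "\<bar>\<Sum>i<d. g (i, i) * (y i)\<^sup>2\<bar> \<le> (\<Sum>i<d. x / real d * (y i)\<^sup>2)"
      proof (intro order_trans[OF sum_abs] sum_mono)
        fix i assume "i \<in> {..<d}"
        then have "\<bar>g (i, i)\<bar> * (y i)\<^sup>2 \<le> x / real d * (y i)\<^sup>2"
          using diag[of i] by (intro mult_right_mono) auto
        then show "\<bar>g (i, i) * (y i)\<^sup>2\<bar> \<le> x / real d * (y i)\<^sup>2" by (simp add: abs_mult)
      qed
      also have "\<dots> = x" unfolding sum_distrib_left[symmetric] y2 using d by simp
      finally have "\<bar>(\<Sum>i<d. g (i, i) * (y i)\<^sup>2) + ?F y g\<bar> \<le> 2 * x" using off by linarith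
      moreover have "u \<bullet> (sym_mat_of d g *\<^sub>v u) = c * ((\<Sum>i<d. g (i, i) * (y i)\<^sup>2) + ?F y g)"
      proof -
        have off: "offdiag_coeff (\<lambda>i. u $ i) p = c * offdiag_coeff y p" for p
        proof -
          have "sqrt c * (sqrt c * t) = c * t" for t using c by (simp flip: mult.assoc)
          then show ?thesis by (auto simp: offdiag_coeff_def uy mult_ac split: prod.split)
        qed
        have "?F (\<lambda>i. u $ i) g = c * ?F y g"
          unfolding off sum_distrib_left by (simp only: mult.assoc)
        moreover have "(\<Sum>i<d. g (i, i) * (u $ i)\<^sup>2) = c * (\<Sum>i<d. g (i, i) * (y i)\<^sup>2)"
          unfolding sum_distrib_left using c by (intro sum.cong refl) (simp add: uy power_mult_distrib)
        ultimately show ?thesis unfolding sym_mat_of_quadratic_form[OF u] by (simp only: distrib_left)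
      qed
      ultimately have "\<bar>u \<bullet> (sym_mat_of d g *\<^sub>v u)\<bar> \<le> c * (2 * x)"
        using c by (simp add: abs_mult)
      also have "\<dots> = B * (u \<bullet> u)" using d by (simp add: c_def x_def B_def)
      finally show ?thesis .
    qed
  qed
qed

section \<open>Deterministic accuracy\<close>

abbreviation bform :: "real mat \<Rightarrow> real vec \<Rightarrow> real vec \<Rightarrow> real" where
  "bform A x y \<equiv> x \<bullet> (A *\<^sub>v y)"

lemma bform_add_mat:
  assumes "A \<in> carrier_mat d d" "B \<in> carrier_mat d d" "x \<in> carrier_vec d" "y \<in> carrier_vec d"
  shows "bform (A + B) x y = bform A x y + bform B x y"
  using assms by (simp add: add_mult_distrib_mat_vec[of _ d d] scalar_prod_add_distrib[of _ d])

lemma bform_minus_mat: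
  assumes "A \<in> carrier_mat d d" "B \<in> carrier_mat d d" "x \<in> carrier_vec d" "y \<in> carrier_vec d"
  shows "bform (A - B) x y = bform A x y - bform B x y"
  using assms by (simp add: minus_mult_distrib_mat_vec[of _ d d] scalar_prod_minus_distrib[of _ d])

lemma bform_smult_one:
  assumes "x \<in> carrier_vec d" "y \<in> carrier_vec d"
  shows "bform (c \<cdot>\<^sub>m 1\<^sub>m d) x y = c * (x \<bullet> y)"
proof -
  have "(c \<cdot>\<^sub>m 1\<^sub>m d) *\<^sub>v y = c \<cdot>\<^sub>v y"
    using assms(2) by (intro eq_vecI) (auto simp: smult_scalar_prod_distrib[of _ d])
  then show ?thesis using assms by simp
qed

lemma bform_sym:
  assumes "A \<in> sym_mats d" "x \<in> carrier_vec d" "y \<in> carrier_vec d"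
  shows "bform A x y = bform A y x"
  using sym_mats_scalar_prod[OF assms] assms sym_matsD(1)[OF assms(1)]
  by (metis comm_scalar_prod mult_mat_vec_carrier)

lemma bform_add_add:
  assumes A: "A \<in> sym_mats d" and x: "x \<in> carrier_vec d" and y: "y \<in> carrier_vec d"
  shows "bform A (s \<cdot>\<^sub>v x + t \<cdot>\<^sub>v y) (s \<cdot>\<^sub>v x + t \<cdot>\<^sub>v y)
    = s\<^sup>2 * bform A x x + 2 * s * t * bform A x y + t\<^sup>2 * bform A y y"
proof -
  note Ac = sym_matsD(1)[OF A]
  have "A *\<^sub>v (s \<cdot>\<^sub>v x + t \<cdot>\<^sub>v y) = s \<cdot>\<^sub>v (A *\<^sub>v x) + t \<cdot>\<^sub>v (A *\<^sub>v y)"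
    using x y Ac by (simp add: mult_add_distrib_mat_vec[of _ d d] mult_mat_vec[of _ d d])
  moreover have "A *\<^sub>v x \<in> carrier_vec d" "A *\<^sub>v y \<in> carrier_vec d"
    using Ac x y by (auto intro!: mult_mat_vec_carrier)
  ultimately show ?thesis
    using x y bform_sym[OF A x y]
    by (simp add: scalar_prod_add_distrib[of _ d] add_scalar_prod_distrib[of _ d] power2_eq_square algebra_simps)
qed

lemma smult_one_sym [simp]: "c \<cdot>\<^sub>m 1\<^sub>m d \<in> sym_mats d"
  by (auto simp: sym_mats_index)

lemma one_sym [simp]: "1\<^sub>m d \<in> sym_mats d"
  by (auto simp: sym_mats_index)

lemma loewner_le_iff:
  "loewner_le d A B \<longleftrightarrow> A \<in> sym_mats d \<and> B \<in> sym_mats d \<and> (\<forall>x\<in>carrier_vec d. bform A x x \<le> bform B x x)"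
  using sym_mats_diff[of B d A] sym_matsD(1)[of A d] sym_matsD(1)[of B d]
  by (auto simp: loewner_le_def psd_cone_def bform_minus_mat[of _ d])

lemma sandwich_sym:
  assumes A: "A \<in> sym_mats d" and S: "S \<in> sym_mats d"
  shows "A * S * A \<in> sym_mats d"
proof -
  note A' = sym_matsD[OF A] and S' = sym_matsD[OF S]
  have AS: "A * S \<in> carrier_mat d d" using A'(1) S'(1) by (rule mult_carrier_mat)
  have "(A * S * A)\<^sup>T = A * (S * A)"
    by (simp only: transpose_mult[OF AS A'(1)] transpose_mult[OF A'(1) S'(1)] A'(2) S'(2))
  also have "\<dots> = A * S * A" by (rule assoc_mult_mat[OF A'(1) S'(1) A'(1), symmetric])
  finally show ?thesis using mult_carrier_mat[OF AS A'(1)] by (simp add: sym_mats_def)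
qed

lemma bform_sandwich:
  assumes A: "A \<in> sym_mats d" and S: "S \<in> sym_mats d" and x: "x \<in> carrier_vec d"
  shows "bform (A * S * A) x x = bform S (A *\<^sub>v x) (A *\<^sub>v x)"
proof -
  note Ac = sym_matsD(1)[OF A] and Sc = sym_matsD(1)[OF S]
  have "A *\<^sub>v x \<in> carrier_vec d" "S *\<^sub>v (A *\<^sub>v x) \<in> carrier_vec d" using Ac Sc x by auto
  then show ?thesis
    using sym_mats_scalar_prod[OF A x, of "S *\<^sub>v (A *\<^sub>v x)"] Ac Sc x
    by (simp add: assoc_mult_mat_vec[of _ d d _ d] mult_carrier_mat[of _ d d _ d])
qed

text \<open>Polarisation with the vectors t x + y/t and t x - y/t, where t^2 = s. The free weight
  \<open>s\<close> balances two vectors of different lengths.\<close>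

lemma bform_bilinear_bound:
  assumes N: "N \<in> sym_mats d" and bound: "\<And>x. x \<in> carrier_vec d \<Longrightarrow> \<bar>bform N x x\<bar> \<le> B * (x \<bullet> x)"
    and x: "x \<in> carrier_vec d" and y: "y \<in> carrier_vec d" and s: "s > 0"
  shows "2 * \<bar>bform N x y\<bar> \<le> B * (s * (x \<bullet> x) + (y \<bullet> y) / s)"
proof -
  have *: "- 2 * e * bform N x y \<le> B * (s * (x \<bullet> x) + (y \<bullet> y) / s)" if e: "e = 1 \<or> e = - 1" for e :: real
  proof -
    define t where "t = sqrt s"
    have t: "t > 0" "t * t = s" using s by (simp_all add: t_def)
    let ?p = "t \<cdot>\<^sub>v x + (e / t) \<cdot>\<^sub>v y" and ?q = "t \<cdot>\<^sub>v x + (- e / t) \<cdot>\<^sub>v y"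
    have pq: "?p \<in> carrier_vec d" "?q \<in> carrier_vec d" using x y by auto
    have ee: "e * e = 1" using e by auto
    have "bform N ?q ?q - bform N ?p ?p = - 4 * e * bform N x y"
      unfolding bform_add_add[OF N x y] using t by (simp add: field_simps power2_eq_square)
    moreover have "(?p \<bullet> ?p) + (?q \<bullet> ?q) = 2 * (s * (x \<bullet> x) + (y \<bullet> y) / s)"
    proof -
      have "?p \<bullet> ?p = bform (1\<^sub>m d) ?p ?p" "?q \<bullet> ?q = bform (1\<^sub>m d) ?q ?q" using pq by simp_all
      moreover have "bform (1\<^sub>m d) ?p ?p + bform (1\<^sub>m d) ?q ?q = 2 * (t\<^sup>2 * (x \<bullet> x)) + 2 * ((e / t)\<^sup>2 * (y \<bullet> y))"
        unfolding bform_add_add[OF one_sym x y] using x y by (simp add: power2_eq_square)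
      moreover have "t\<^sup>2 = s" "(e / t)\<^sup>2 = 1 / s" using t ee by (simp_all add: power2_eq_square)
      ultimately show ?thesis by simp
    qed
    moreover have "bform N ?q ?q - bform N ?p ?p \<le> B * ((?p \<bullet> ?p) + (?q \<bullet> ?q))"
      using bound[OF pq(1)] bound[OF pq(2)] by (simp add: distrib_left)
    ultimately have "- 4 * e * bform N x y \<le> B * (2 * (s * (x \<bullet> x) + (y \<bullet> y) / s))"
      by (simp only:)
    also have "\<dots> = 2 * (B * (s * (x \<bullet> x) + (y \<bullet> y) / s))" by (rule mult.left_commute)
    finally show ?thesis by linarith
  qed
  from *[of 1] *[of "- 1"] show ?thesis by simp
qed

section \<open>Second moments and the sample conditions\<close>

lemma bform_second_moment:
  assumes X: "\<And>k. k \<in> S \<Longrightarrow> X k \<in> carrier_vec d" and x: "x \<in> carrier_vec d"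
  shows "bform (second_moment d n S X) x x = (\<Sum>k\<in>S. (X k \<bullet> x)\<^sup>2) / real n"
proof -
  have "bform (second_moment d n S X) x x = (\<Sum>i<d. \<Sum>j<d. \<Sum>k\<in>S. (X k $ i * x $ i) * (X k $ j * x $ j) / real n)"
  proof -
    have "bform (second_moment d n S X) x x = (\<Sum>i<d. \<Sum>j<d. second_moment d n S X $$ (i, j) * x $ i * x $ j)"
      using x by (intro scalar_prod_mat_sum) (auto simp: second_moment_def)
    also have "\<dots> = (\<Sum>i<d. \<Sum>j<d. \<Sum>k\<in>S. (X k $ i * x $ i) * (X k $ j * x $ j) / real n)"
    proof (intro sum.cong refl)
      fix i j assume "i \<in> {..<d}" "j \<in> {..<d}"
      then have "second_moment d n S X $$ (i, j) * x $ i * x $ j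
        = (\<Sum>k\<in>S. X k $ i * X k $ j / real n * x $ i * x $ j)"
        by (simp add: second_moment_def sum_divide_distrib sum_distrib_right)
      then show "second_moment d n S X $$ (i, j) * x $ i * x $ j
        = (\<Sum>k\<in>S. (X k $ i * x $ i) * (X k $ j * x $ j) / real n)"
        by (simp add: mult_ac)
    qed
    finally show ?thesis .
  qed
  also have "\<dots> = (\<Sum>i<d. \<Sum>k\<in>S. \<Sum>j<d. (X k $ i * x $ i) * (X k $ j * x $ j) / real n)"
    by (intro sum.cong refl sum.swap)
  also have "\<dots> = (\<Sum>k\<in>S. \<Sum>i<d. \<Sum>j<d. (X k $ i * x $ i) * (X k $ j * x $ j) / real n)"
    by (rule sum.swap)
  also have "\<dots> = (\<Sum>k\<in>S. (X k \<bullet> x)\<^sup>2 / real n)"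
    by (simp add: scalar_prod_sum[OF x] power2_eq_square sum_product sum_divide_distrib)
  finally show ?thesis by (simp add: sum_divide_distrib)
qed

lemma psd_sqrt:
  assumes "A \<in> psd_cone d"
  shows "psd_sqrt d A \<in> sym_mats d" "psd_sqrt d A * psd_sqrt d A = A"
proof -
  obtain u l where "eigen_system d A u l" using spectral_theorem psd_coneD assms by blast
  then interpret eigen_system d A u l .
  have "smap sqrt * smap sqrt = smap (\<lambda>x. x)"
    unfolding smap_mult by (rule smap_cong) (simp add: psd_eigenvalue[OF assms])
  then show "psd_sqrt d A \<in> sym_mats d" "psd_sqrt d A * psd_sqrt d A = A"
    by (simp_all add: psd_sqrt_eq[OF assms] smap_id)
qed

lemma inv_sqrt:
  assumes A: "loewner_le d (1\<^sub>m d) A"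
  shows "inv_sqrt d A \<in> carrier_mat d d" "psd_sqrt d A * inv_sqrt d A = 1\<^sub>m d" "A \<in> psd_cone d"
proof -
  have ge: "x \<bullet> x \<le> bform A x x" if "x \<in> carrier_vec d" for x
    using A that by (auto simp: loewner_le_iff)
  have sym: "A \<in> sym_mats d" using A by (simp add: loewner_le_def)
  show psd: "A \<in> psd_cone d"
    using sym order_trans[OF scalar_prod_self_nonneg ge] by (simp add: psd_cone_def)
  obtain u l where "eigen_system d A u l" using spectral_theorem sym by blast
  then interpret eigen_system d A u l .
  have l: "1 \<le> l k" if "k < d" for k
    using ge[OF u_carrier[OF that]] eigenvalue_eq[OF that] orthonormal[OF that that] by simp
  let ?B = "psd_sqrt d A" and ?C = "smap (\<lambda>x. 1 / sqrt x)"
  have "smap sqrt * ?C = smap (\<lambda>_. 1)" "?C * smap sqrt = smap (\<lambda>_. 1)"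
    unfolding smap_mult by (rule smap_cong; use l in force)+
  then have "?B * ?C = 1\<^sub>m d" "?C * ?B = 1\<^sub>m d" by (simp_all add: psd_sqrt_eq[OF psd] smap_1)
  moreover have Bc: "?B \<in> carrier_mat d d" using psd_sqrt(1)[OF psd] by (rule sym_matsD)
  ultimately have "?B \<in> Units (ring_mat TYPE(real) d ())"
    by (auto simp: Units_def ring_mat_simps intro!: bexI[of _ ?C])
  then obtain R where R: "mat_inverse ?B = Some R" using mat_inverse(1)[OF Bc, where b = "()"] by (cases "mat_inverse ?B") auto
  then show "inv_sqrt d A \<in> carrier_mat d d" "?B * inv_sqrt d A = 1\<^sub>m d"
    using mat_inverse(2)[OF Bc R] by (simp_all add: inv_sqrt_def)
qed

text \<open>Substituting X = \<open>psd_sqrt d \<Sigma>\<close> Y replaces the identity in condition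
  (ii) by \<open>\<Sigma>\<close>, since the squared norm of the root applied to x is the quadratic
  form of \<open>\<Sigma>\<close> at x. The same identity together with \<Sigma> \<preceq> \<kappa>
  I gives the factor \<kappa> in the truncation threshold.\<close>

lemma sample_conditions_imp:
  assumes S: "loewner_le d (1\<^sub>m d) \<Sigma>" "loewner_le d \<Sigma> (\<kappa> \<cdot>\<^sub>m 1\<^sub>m d)" and \<kappa>: "\<kappa> > 0"
    and X: "\<And>i. i < n \<Longrightarrow> X i \<in> carrier_vec d"
    and sc: "sample_conditions c\<^sub>1 c\<^sub>2 c\<^sub>3 \<beta> d n \<Sigma> X"
  defines "r \<equiv> c\<^sub>2 * sqrt ((real d + ln (1 / \<beta>)) / real n)"
  shows "trunc_set c\<^sub>1 \<beta> \<kappa> d n X = {..<n}"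
    and "\<And>x. x \<in> carrier_vec d \<Longrightarrow> (1 - r) * bform \<Sigma> x x \<le> bform (second_moment d n {..<n} X) x x"
    and "\<And>x. x \<in> carrier_vec d \<Longrightarrow> bform (second_moment d n {..<n} X) x x \<le> (1 + r) * bform \<Sigma> x x"
proof -
  let ?B = "psd_sqrt d \<Sigma>"
  note R = inv_sqrt[OF S(1)]
  note B = psd_sqrt[OF R(3)]
  note Bc = sym_matsD(1)[OF B(1)]
  define Y where "Y i = inv_sqrt d \<Sigma> *\<^sub>v X i" for i
  have Yc: "Y i \<in> carrier_vec d" if "i < n" for i using X[OF that] R(1) by (simp add: Y_def)
  have BY: "?B *\<^sub>v Y i = X i" if "i < n" for i
    using X[OF that] R Bc by (simp add: Y_def flip: assoc_mult_mat_vec[of _ d d _ d])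
  have BB: "(?B *\<^sub>v x) \<bullet> (?B *\<^sub>v x) = bform \<Sigma> x x" if "x \<in> carrier_vec d" for x
    using sym_mats_scalar_prod[OF B(1) that, of "?B *\<^sub>v x"] that Bc B(2)
    by (simp flip: assoc_mult_mat_vec[of _ d d _ d])
  have cond: "\<And>i. i < n \<Longrightarrow> Y i \<bullet> Y i \<le> c\<^sub>1 * (real d * ln (real n / \<beta>))"
    "loewner_le d ((1 - r) \<cdot>\<^sub>m 1\<^sub>m d) (second_moment d n {..<n} Y)"
    "loewner_le d (second_moment d n {..<n} Y) ((1 + r) \<cdot>\<^sub>m 1\<^sub>m d)"
    using sc unfolding sample_conditions_def Let_def Y_def[symmetric] r_def[symmetric] by auto
  have "X i \<bullet> X i \<le> c\<^sub>1 * (real d * \<kappa> * ln (real n / \<beta>))" if i: "i < n" for i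
  proof -
    have "X i \<bullet> X i = bform \<Sigma> (Y i) (Y i)" using BB[OF Yc[OF i]] BY[OF i] by simp
    also have "\<dots> \<le> \<kappa> * (Y i \<bullet> Y i)" using S(2) Yc[OF i] by (auto simp: loewner_le_iff bform_smult_one)
    also have "\<dots> \<le> \<kappa> * (c\<^sub>1 * (real d * ln (real n / \<beta>)))" using cond(1)[OF i] \<kappa> by simp
    finally show ?thesis by (simp add: mult_ac)
  qed
  then show "trunc_set c\<^sub>1 \<beta> \<kappa> d n X = {..<n}" by (auto simp: trunc_set_def)
  fix x :: "real vec" assume x: "x \<in> carrier_vec d"
  let ?z = "?B *\<^sub>v x"
  have z: "?z \<in> carrier_vec d" using Bc x by simp
  have "bform (second_moment d n {..<n} X) x x = bform (second_moment d n {..<n} Y) ?z ?z"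
  proof -
    have "X k \<bullet> x = Y k \<bullet> ?z" if "k < n" for k
      using sym_mats_scalar_prod[OF B(1) Yc[OF that] x] BY[OF that] by simp
    moreover have "bform (second_moment d n {..<n} X) x x = (\<Sum>k<n. (X k \<bullet> x)\<^sup>2) / real n"
      using X x by (intro bform_second_moment) auto
    moreover have "bform (second_moment d n {..<n} Y) ?z ?z = (\<Sum>k<n. (Y k \<bullet> ?z)\<^sup>2) / real n"
      using Yc z by (intro bform_second_moment) auto
    ultimately show ?thesis by simp
  qed
  then show "(1 - r) * bform \<Sigma> x x \<le> bform (second_moment d n {..<n} X) x x"
    "bform (second_moment d n {..<n} X) x x \<le> (1 + r) * bform \<Sigma> x x"
    using cond(2,3) z BB[OF x] by (auto simp: loewner_le_iff bform_smult_one)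
qed

text \<open>Projecting to the PSD cone only replaces negative eigenvalues by 0, and both lie below
  the positive threshold \<kappa>/2. The preconditioner is thus a function of the unprojected matrix
  \<open>M\<close>, which is signal plus noise.\<close>

lemma weak_output_snd:
  assumes "eigen_system d M u l" "\<kappa> > 0"
  shows "snd (weak_output d \<kappa> K M) = spectral_map d u l (\<lambda>x. if \<kappa> / 2 \<le> x then 1 / sqrt K else 1)"
proof -
  interpret eigen_system d M u l by fact
  interpret P: eigen_system d "smap (\<lambda>x. max x 0)" u "\<lambda>k. max (l k) 0"
    by (rule eigen_system_smap)
  have "snd (weak_output d \<kappa> K M) = P.smap (\<lambda>x. if \<kappa> / 2 \<le> x then 1 / sqrt K else 1)"
    by (simp add: weak_output_def Let_def psd_proj_eq P.precond_eq)
  also have "\<dots> = smap (\<lambda>x. if \<kappa> / 2 \<le> x then 1 / sqrt K else 1)"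
    using assms(2) by (auto simp: spectral_map_def max_def intro!: sum.cong eq_matI)
  finally show ?thesis .
qed

section \<open>Perturbation analysis for one realisation of the noise\<close>

locale noisy_covariance = eigen_system d M u l
  for d :: nat and M :: "real mat" and u :: "nat \<Rightarrow> real vec" and l :: "nat \<Rightarrow> real" +
  fixes \<Sigma> S N :: "real mat" and \<kappa> K r \<eta> :: real
  assumes M_def: "M = S + N"
    and \<Sigma>_sym: "\<Sigma> \<in> sym_mats d" and S_sym: "S \<in> sym_mats d" and N_sym: "N \<in> sym_mats d"
    and \<Sigma>_ge: "\<And>x. x \<in> carrier_vec d \<Longrightarrow> x \<bullet> x \<le> bform \<Sigma> x x"
    and \<Sigma>_le: "\<And>x. x \<in> carrier_vec d \<Longrightarrow> bform \<Sigma> x x \<le> \<kappa> * (x \<bullet> x)"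
    and S_ge: "\<And>x. x \<in> carrier_vec d \<Longrightarrow> (1 - r) * bform \<Sigma> x x \<le> bform S x x"
    and S_le: "\<And>x. x \<in> carrier_vec d \<Longrightarrow> bform S x x \<le> (1 + r) * bform \<Sigma> x x"
    and N_le: "\<And>x. x \<in> carrier_vec d \<Longrightarrow> \<bar>bform N x x\<bar> \<le> \<eta> * \<kappa> * (x \<bullet> x)"
    and pos: "\<kappa> > 0" "K > 0" "r \<ge> 0" "\<eta> \<ge> 0"
begin

definition wt :: "real \<Rightarrow> real" where
  "wt t = (if \<kappa> / 2 \<le> t then 1 / sqrt K else 1)"

lemma wt_sq: "(wt t)\<^sup>2 = (if \<kappa> / 2 \<le> t then 1 / K else 1)"
  using pos by (simp add: wt_def power_divide)

lemma bform_M: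
  "x \<in> carrier_vec d \<Longrightarrow> y \<in> carrier_vec d \<Longrightarrow> bform M x y = bform S x y + bform N x y"
  unfolding M_def using S_sym N_sym by (intro bform_add_mat) (auto dest: sym_matsD)

lemma norm_sq: "x \<in> carrier_vec d \<Longrightarrow> x \<bullet> x = (\<Sum>k<d. (u k \<bullet> x)\<^sup>2)"
  by (simp add: parseval power2_eq_square)

lemma smap_vec_carrier: "x \<in> carrier_vec d \<Longrightarrow> smap f *\<^sub>v x \<in> carrier_vec d"
  by (rule mult_mat_vec_carrier[OF spectral_map_carrier])

text \<open>\<open>M\<close> is diagonal in the basis used by \<open>smap wt\<close>, so in the main
  case \<open>\<Sigma>\<close> is reached through S = M - N and the bound is checked one
  eigendirection at a time. The noise enters once through \<open>l k\<close> and once through the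
  subtraction, whence 2 \<eta> \<le> \<phi>.\<close>

lemma upper_bound:
  assumes x: "x \<in> carrier_vec d" and \<psi>: "8 * r \<le> \<psi>" and \<phi>: "2 * \<eta> \<le> \<phi>"
  shows "bform (smap wt * \<Sigma> * smap wt) x x \<le> (1 + \<psi>) * \<kappa> * (max (1 / K) (1/2) + \<phi>) * (x \<bullet> x)"
proof -
  define y where "y = smap wt *\<^sub>v x"
  have y: "y \<in> carrier_vec d" using x by (simp add: y_def smap_vec_carrier)
  have yk: "(u k \<bullet> y)\<^sup>2 = (wt (l k))\<^sup>2 * (u k \<bullet> x)\<^sup>2" if "k < d" for k
    using that x by (simp add: y_def coeff_smap power_mult_distrib)
  have eq: "bform (smap wt * \<Sigma> * smap wt) x x = bform \<Sigma> y y"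
    unfolding y_def using \<Sigma>_sym x by (intro bform_sandwich) auto
  let ?m = "max (1 / K) (1 / 2)"
  have x0: "0 \<le> x \<bullet> x" by (rule scalar_prod_self_nonneg)
  have crude: "bform \<Sigma> y y \<le> \<kappa> * (w * (x \<bullet> x))" if "1 / K \<le> w" "1 \<le> w" for w
  proof -
    have "y \<bullet> y \<le> w * (x \<bullet> x)"
      unfolding norm_sq[OF y] norm_sq[OF x] sum_distrib_left
    proof (rule sum_mono)
      fix k assume "k \<in> {..<d}"
      moreover have "(wt (l k))\<^sup>2 \<le> w" using that by (simp add: wt_sq)
      ultimately show "(u k \<bullet> y)\<^sup>2 \<le> w * (u k \<bullet> x)\<^sup>2" by (simp add: yk mult_right_mono)
    qed
    then show ?thesis using order_trans[OF \<Sigma>_le[OF y]] pos by simp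
  qed
  have rhs: "b * \<kappa> * c * (x \<bullet> x) \<le> (1 + \<psi>) * \<kappa> * (?m + \<phi>) * (x \<bullet> x)"
    if "0 \<le> b" "b \<le> 1 + \<psi>" "0 \<le> c" "c \<le> ?m + \<phi>" for b c
    using that pos x0 by (intro mult_right_mono mult_mono) auto
  \<comment> \<open>For K \<le> 1 the largest squared weight 1/K already occurs in the maximum. For
    r > 1/2 the hypothesis on \<psi> pushes 1 + \<psi> above 2, which compensates the 1/2 in the
    maximum.\<close>
  consider "K \<le> 1" | "K > 1" "r > 1/2" | "K > 1" "r \<le> 1/2" by linarith
  then show ?thesis
  proof cases
    case 1
    then have "bform \<Sigma> y y \<le> 1 * \<kappa> * (1 / K) * (x \<bullet> x)"
      using crude[of "1 / K"] pos by (simp add: mult_ac)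
    also have "\<dots> \<le> (1 + \<psi>) * \<kappa> * (?m + \<phi>) * (x \<bullet> x)"
      using pos \<psi> \<phi> by (intro rhs) auto
    finally show ?thesis using eq by simp
  next
    case 2
    then have "bform \<Sigma> y y \<le> 2 * \<kappa> * (1 / 2) * (x \<bullet> x)"
      using crude[of 1] pos by (simp add: mult_ac)
    also have "\<dots> \<le> (1 + \<psi>) * \<kappa> * (?m + \<phi>) * (x \<bullet> x)"
      using pos \<psi> \<phi> 2 by (intro rhs) auto
    finally show ?thesis using eq by simp
  next
    case 3
    let ?c = "(1 + r) * (?m + 2 * \<eta>)"
    have "bform S y y = bform M y y - bform N y y" using bform_M[OF y y] by simp
    also have "\<dots> \<le> (\<Sum>k<d. l k * (u k \<bullet> y)\<^sup>2) + \<eta> * \<kappa> * (\<Sum>k<d. (u k \<bullet> y)\<^sup>2)"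
      using N_le[OF y] quadratic_form[OF y] norm_sq[OF y] by simp
    also have "\<dots> = (\<Sum>k<d. (l k + \<eta> * \<kappa>) * (wt (l k))\<^sup>2 * (u k \<bullet> x)\<^sup>2)"
      unfolding sum_distrib_left sum.distrib[symmetric]
      by (intro sum.cong refl) (simp add: yk algebra_simps)
    also have "\<dots> \<le> (\<Sum>k<d. \<kappa> * ?c * (u k \<bullet> x)\<^sup>2)"
    proof (intro sum_mono mult_right_mono)
      fix k assume "k \<in> {..<d}"
      then have k: "k < d" by simp
      note uk = u_carrier[OF k]
      have uu: "u k \<bullet> u k = 1" using orthonormal[OF k k] by simp
      have "l k = bform S (u k) (u k) + bform N (u k) (u k)"
        using eigenvalue_eq[OF k] bform_M[OF uk uk] by simp
      also have "bform S (u k) (u k) \<le> (1 + r) * \<kappa>"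
        using order_trans[OF S_le[OF uk] mult_left_mono[OF \<Sigma>_le[OF uk]]] pos uu by simp
      finally have lk: "l k \<le> (1 + r) * \<kappa> + \<eta> * \<kappa>" using N_le[OF uk] uu by simp
      have m: "1 / 2 \<le> ?m" by simp
      then have "1 * (?m + 2 * \<eta>) \<le> ?c" using pos by (intro mult_right_mono) auto
      then have c1: "?m + 2 * \<eta> \<le> ?c" by (simp only: mult_1_left)
      have c2: "1 / 2 + \<eta> \<le> ?m + 2 * \<eta>" using m pos by linarith
      \<comment> \<open>High eigenvalues reach about (1 + r) \<kappa> but carry squared weight 1/K;
        low ones carry weight 1 but lie below \<kappa>/2. These are the two entries of the
        maximum.\<close>
      show "(l k + \<eta> * \<kappa>) * (wt (l k))\<^sup>2 \<le> \<kappa> * ?c"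
      proof (cases "\<kappa> / 2 \<le> l k")
        case True
        have "(l k + \<eta> * \<kappa>) * (1 / K) \<le> ((1 + r) * \<kappa> + 2 * \<eta> * \<kappa>) * (1 / K)"
          using lk pos by (intro mult_right_mono) auto
        also have "\<dots> = \<kappa> * ((1 + r) * (1 / K) + 2 * \<eta> * (1 / K))" by (simp add: algebra_simps add_divide_distrib)
        also have "\<dots> \<le> \<kappa> * ((1 + r) * ?m + (1 + r) * (2 * \<eta>))"
        proof -
          have "1 / K \<le> 1 + r" using 3 pos by (simp add: add_increasing2)
          then have "2 * \<eta> * (1 / K) \<le> (1 + r) * (2 * \<eta>)"
            using pos mult_left_mono[of "1 / K" "1 + r" "2 * \<eta>"] by (simp add: mult_ac)
          then show ?thesis using pos by (intro mult_left_mono add_mono) auto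
        qed
        finally show ?thesis using True by (simp add: wt_sq distrib_left)
      next
        case False
        then have "l k + \<eta> * \<kappa> \<le> \<kappa> * (1 / 2 + \<eta>)" by (simp add: algebra_simps)
        also have "\<dots> \<le> \<kappa> * ?c" using order_trans[OF c2 c1] pos by (intro mult_left_mono) auto
        finally show ?thesis using False by (simp add: wt_sq)
      qed
    qed simp
    also have "\<dots> = \<kappa> * ?c * (x \<bullet> x)" by (simp add: norm_sq[OF x] sum_distrib_left)
    finally have SY: "bform S y y \<le> \<kappa> * ?c * (x \<bullet> x)" .
    have \<Sigma>0: "0 \<le> bform \<Sigma> y y" using order_trans[OF scalar_prod_self_nonneg \<Sigma>_ge[OF y]] .
    \<comment> \<open>For r \<le> 1/2 the factor 1 + 2r undoes the loss 1 - r of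
      \<open>S_ge\<close>; multiplied by the 1 + r inside \<open>?c\<close> it stays at most 1 +
      8r.\<close>
    have "1 \<le> (1 + 2 * r) * (1 - r)"
      using 3 pos mult_left_mono[of r "1/2" r] by (simp add: algebra_simps)
    then have "1 * bform \<Sigma> y y \<le> ((1 + 2 * r) * (1 - r)) * bform \<Sigma> y y" using \<Sigma>0 by (rule mult_right_mono)
    also have "\<dots> \<le> (1 + 2 * r) * bform S y y"
      using mult_left_mono[OF S_ge[OF y], of "1 + 2 * r"] pos by (simp add: mult.assoc)
    also have "\<dots> \<le> (1 + 2 * r) * (\<kappa> * ?c * (x \<bullet> x))"
      using SY pos by (intro mult_left_mono) auto
    also have "\<dots> = ((1 + 2 * r) * (1 + r)) * \<kappa> * (?m + 2 * \<eta>) * (x \<bullet> x)" by (simp add: mult_ac)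
    also have "\<dots> \<le> (1 + \<psi>) * \<kappa> * (?m + \<phi>) * (x \<bullet> x)"
    proof (rule rhs)
      show "(1 + 2 * r) * (1 + r) \<le> 1 + \<psi>"
        using 3 pos \<psi> mult_left_mono[of r "1/2" r] by (simp add: algebra_simps)
    qed (use pos \<phi> in \<open>auto simp: max_def\<close>)
    finally show ?thesis using eq by simp
  qed
qed

text \<open>The two entries of \<open>err_\<Gamma>\<close> have separate uses. The first, when below
  1, makes half of the quadratic form on the top eigenspace at least K |a|^2; the second is K / R^2
  for the length ratio \<open>R\<close> up to which the cross term consumes no more than the other
  half.\<close>

lemma lower_bound:
  assumes x: "x \<in> carrier_vec d" and \<psi>: "r \<le> \<psi>" "\<psi> \<le> 1" and \<phi>: "\<eta> \<le> \<phi>" "0 < \<phi>" "\<phi> \<noteq> 1/2"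
  shows "(1 - \<psi>)\<^sup>2 * (1 - err_\<Gamma> K \<kappa> \<phi>) * (x \<bullet> x) \<le> bform (smap wt * \<Sigma> * smap wt) x x"
proof -
  define y where "y = smap wt *\<^sub>v x"
  have y: "y \<in> carrier_vec d" using x by (simp add: y_def smap_vec_carrier)
  have yk: "u k \<bullet> y = wt (l k) * (u k \<bullet> x)" if "k < d" for k
    using that x by (simp add: y_def coeff_smap)
  have eq: "bform (smap wt * \<Sigma> * smap wt) x x = bform \<Sigma> y y"
    unfolding y_def using \<Sigma>_sym x by (intro bform_sandwich) auto
  define \<Gamma> where "\<Gamma> = err_\<Gamma> K \<kappa> \<phi>"
  have \<Gamma>1: "2 * K / ((1/2 - \<phi>) * \<kappa>) \<le> \<Gamma>" and \<Gamma>2: "16 * K * \<phi>\<^sup>2 / (1/2 - \<phi>)\<^sup>2 \<le> \<Gamma>"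
    by (simp_all add: \<Gamma>_def err_\<Gamma>_def)
  have \<Gamma>0: "0 < \<Gamma>"
    using \<Gamma>2 pos \<phi> by (intro less_le_trans[OF _ \<Gamma>2]) (auto intro!: divide_pos_pos)
  have x0: "0 \<le> x \<bullet> x" by (rule scalar_prod_self_nonneg)
  have \<psi>sq: "0 \<le> (1 - \<psi>)\<^sup>2" "(1 - \<psi>)\<^sup>2 \<le> 1" using \<psi> pos by (auto intro!: power_le_one)
  have scale: "(1 - \<psi>)\<^sup>2 * t \<le> t" if "0 \<le> t" for t using mult_right_mono[OF \<psi>sq(2) that] by simp
  have "(1 - \<psi>)\<^sup>2 * (1 - \<Gamma>) * (x \<bullet> x) \<le> bform \<Sigma> y y"
  proof (cases "\<Gamma> \<ge> 1")
    case True
    then have "(1 - \<psi>)\<^sup>2 * (1 - \<Gamma>) * (x \<bullet> x) \<le> 0"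
      using x0 \<psi>sq by (intro mult_nonpos_nonneg mult_nonneg_nonpos) auto
    also have "0 \<le> bform \<Sigma> y y" using order_trans[OF scalar_prod_self_nonneg \<Sigma>_ge[OF y]] .
    finally show ?thesis .
  next
    case \<Gamma>lt: False
    show ?thesis
    proof (cases "K \<le> 1")
      case True
      have "x \<bullet> x \<le> y \<bullet> y"
        unfolding norm_sq[OF y] norm_sq[OF x]
      proof (rule sum_mono)
        fix k assume "k \<in> {..<d}"
        then have "(u k \<bullet> y)\<^sup>2 = (wt (l k))\<^sup>2 * (u k \<bullet> x)\<^sup>2" by (simp add: yk power_mult_distrib)
        moreover have "1 \<le> (wt (l k))\<^sup>2" using True pos by (simp add: wt_sq)
        ultimately show "(u k \<bullet> x)\<^sup>2 \<le> (u k \<bullet> y)\<^sup>2"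
          using mult_right_mono[of 1 "(wt (l k))\<^sup>2" "(u k \<bullet> x)\<^sup>2"] by simp
      qed
      moreover have "(1 - \<psi>)\<^sup>2 * (1 - \<Gamma>) * (x \<bullet> x) \<le> x \<bullet> x"
      proof -
        have "(1 - \<psi>)\<^sup>2 * ((1 - \<Gamma>) * (x \<bullet> x)) \<le> (1 - \<Gamma>) * (x \<bullet> x)"
          using \<Gamma>lt x0 by (intro scale) auto
        also have "\<dots> \<le> x \<bullet> x" using \<Gamma>0 x0 mult_right_mono[of "1 - \<Gamma>" 1 "x \<bullet> x"] by simp
        finally show ?thesis by (simp only: mult.assoc)
      qed
      ultimately show ?thesis using \<Sigma>_ge[OF y] by linarith
    next
      case False
      then have K: "K > 1" by simp
      \<comment> \<open>Above 1/2 the distance |1/2 - \<phi>| is at most \<phi>, so the second entry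
        of \<Gamma> would be at least 16 K, contradicting \<Gamma> < 1.\<close>
      have \<phi>lt: "\<phi> < 1/2"
      proof (rule ccontr)
        assume "\<not> \<phi> < 1/2"
        then have "\<phi> > 1/2" using \<phi> by simp
        then have "(1/2 - \<phi>)\<^sup>2 \<le> \<phi>\<^sup>2" "(1/2 - \<phi>)\<^sup>2 > 0" by (auto simp: abs_le_square_iff[symmetric])
        then have "1 \<le> \<phi>\<^sup>2 / (1/2 - \<phi>)\<^sup>2" by simp
        then have "16 * K * 1 \<le> 16 * K * (\<phi>\<^sup>2 / (1/2 - \<phi>)\<^sup>2)" using pos by (intro mult_left_mono) auto
        then show False using \<Gamma>2 \<Gamma>lt K by simp
      qed
      let ?top = "\<lambda>k. \<kappa> / 2 \<le> l k"
      define a where "a = smap (\<lambda>t. of_bool (\<kappa> / 2 \<le> t)) *\<^sub>v y"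
      define b where "b = smap (\<lambda>t. of_bool (\<not> \<kappa> / 2 \<le> t)) *\<^sub>v y"
      have a: "a \<in> carrier_vec d" and b: "b \<in> carrier_vec d" using y by (simp_all add: a_def b_def smap_vec_carrier)
      have ak: "u k \<bullet> a = of_bool (?top k) * (u k \<bullet> y)" and bk: "u k \<bullet> b = of_bool (\<not> ?top k) * (u k \<bullet> y)"
        if "k < d" for k using that y by (simp_all add: a_def b_def coeff_smap)
      have yab: "y = 1 \<cdot>\<^sub>v a + 1 \<cdot>\<^sub>v b"
        using y a b u_carrier by (intro vec_eqI) (auto simp: scalar_prod_add_distrib[of _ d] ak bk)
      \<comment> \<open>On \<open>V\<close> the map \<open>smap wt\<close> divides by sqrt K, so
        \<open>p\<close> and \<open>q\<close> are the two parts of the squared norm of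
        \<open>x\<close>, whereas that of \<open>y\<close> splits into \<open>a \<bullet> a\<close>
        and \<open>q\<close>.\<close>
      define p where "p = K * (a \<bullet> a)"
      define q where "q = b \<bullet> b"
      have pq0: "0 \<le> a \<bullet> a" "0 \<le> q" by (simp_all add: q_def scalar_prod_self_nonneg)
      have xpq: "x \<bullet> x = p + q"
        unfolding p_def q_def norm_sq[OF x] norm_sq[OF a] norm_sq[OF b] sum_distrib_left sum.distrib[symmetric]
        using pos by (intro sum.cong) (auto simp: ak bk yk power_mult_distrib wt_sq)
      have ypq: "y \<bullet> y = a \<bullet> a + q"
        unfolding q_def norm_sq[OF y] norm_sq[OF a] norm_sq[OF b] sum.distrib[symmetric]
        by (intro sum.cong) (auto simp: ak bk)
      show ?thesis
      proof (cases "p \<le> \<Gamma> * q")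
        case True
        \<comment> \<open>The low part dominates here: the norm of \<open>x\<close> costs a factor 1
          + \<Gamma> over \<open>q\<close>, and (1 - \<Gamma>)(1 + \<Gamma>) \<le> 1.\<close>
        have "(1 - \<Gamma>) * (x \<bullet> x) \<le> (1 - \<Gamma>) * ((1 + \<Gamma>) * q)"
          unfolding xpq using True \<Gamma>lt by (intro mult_left_mono) (auto simp: algebra_simps)
        also have "\<dots> = q - \<Gamma>\<^sup>2 * q" by (simp add: power2_eq_square algebra_simps)
        also have "\<dots> \<le> y \<bullet> y"
        proof -
          have "0 \<le> \<Gamma>\<^sup>2 * q" using pq0 by (intro mult_nonneg_nonneg) auto
          then show ?thesis using ypq pq0 by linarith
        qed
        also have "\<dots> \<le> bform \<Sigma> y y" by (rule \<Sigma>_ge[OF y])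
        finally have "(1 - \<Gamma>) * (x \<bullet> x) \<le> bform \<Sigma> y y" .
        moreover have "(1 - \<psi>)\<^sup>2 * ((1 - \<Gamma>) * (x \<bullet> x)) \<le> (1 - \<Gamma>) * (x \<bullet> x)"
          using \<Gamma>lt x0 by (intro scale) auto
        ultimately show ?thesis by (simp add: mult.assoc)
      next
        case False
        \<comment> \<open>Chosen so that 2 \<phi> R is half of 1/2 - \<phi>. In the present case |b|
          \<le> R |a|, and \<open>R\<close> is also the weight used in the bilinear noise
          bound.\<close>
        define R where "R = (1/2 - \<phi>) / (4 * \<phi>)"
        have R: "R > 0" using \<phi> \<phi>lt by (simp add: R_def)
        have qR: "q \<le> R\<^sup>2 * (a \<bullet> a)"
        proof -
          have "16 * K * \<phi>\<^sup>2 / (1/2 - \<phi>)\<^sup>2 = K / R\<^sup>2" using \<phi> \<phi>lt by (simp add: R_def power_divide power_mult_distrib)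
          then have "(K / R\<^sup>2) * q \<le> p"
            using mult_right_mono[OF \<Gamma>2 pq0(2)] False by simp
          then show ?thesis using R pos by (simp add: p_def field_simps)
        qed
        have cross: "2 * \<bar>bform N a b\<bar> \<le> \<kappa> * (a \<bullet> a) * ((1/2 - \<phi>) / 2)"
        proof -
          have "2 * \<bar>bform N a b\<bar> \<le> \<eta> * \<kappa> * (R * (a \<bullet> a) + q / R)"
            unfolding q_def by (rule bform_bilinear_bound[OF N_sym N_le a b R])
          also have "q / R \<le> R * (a \<bullet> a)" using qR R by (simp add: power2_eq_square field_simps)
          then have "\<eta> * \<kappa> * (R * (a \<bullet> a) + q / R) \<le> \<eta> * \<kappa> * (R * (a \<bullet> a) + R * (a \<bullet> a))"
            using pos by (intro mult_left_mono add_left_mono) auto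
          also have "\<dots> = \<eta> * (\<kappa> * (2 * (R * (a \<bullet> a))))" by simp
          also have "\<dots> \<le> \<phi> * (\<kappa> * (2 * (R * (a \<bullet> a))))"
            using \<phi> pos R pq0 by (intro mult_right_mono) auto
          also have "\<dots> = \<kappa> * (a \<bullet> a) * (2 * (\<phi> * R))" by (simp add: mult_ac)
          also have "2 * (\<phi> * R) = (1/2 - \<phi>) / 2" using \<phi> by (simp add: R_def)
          finally show ?thesis .
        qed
        \<comment> \<open>Both parts lie in complementary spectral subspaces of \<open>M\<close>, so
          the cross term of \<open>S\<close> is minus that of \<open>N\<close>.\<close>
        have Mab: "bform M a b = 0"
          using scalar_prod_smap[OF a b, of "\<lambda>t. t"] by (simp add: smap_id ak bk)
        have Maa: "\<kappa> / 2 * (a \<bullet> a) \<le> bform M a a"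
          unfolding quadratic_form[OF a] norm_sq[OF a] sum_distrib_left
        proof (rule sum_mono)
          fix k assume "k \<in> {..<d}"
          moreover have "\<kappa> / 2 * (u k \<bullet> y)\<^sup>2 \<le> l k * (u k \<bullet> y)\<^sup>2" if "?top k"
            using that by (intro mult_right_mono) auto
          ultimately show "\<kappa> / 2 * (u k \<bullet> a)\<^sup>2 \<le> l k * (u k \<bullet> a)\<^sup>2" by (cases "?top k") (simp_all add: ak)
        qed
        have Saa: "\<kappa> * (a \<bullet> a) * (1/2 - \<phi>) \<le> bform S a a"
        proof -
          have "\<eta> * (\<kappa> * (a \<bullet> a)) \<le> \<phi> * (\<kappa> * (a \<bullet> a))" using \<phi> pos pq0 by (intro mult_right_mono) auto
          then have "bform N a a \<le> \<phi> * \<kappa> * (a \<bullet> a)" using N_le[OF a] by (simp add: mult.assoc)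
          then show ?thesis using Maa bform_M[OF a a] by (simp add: algebra_simps)
        qed
        have Sbb: "(1 - r) * q \<le> bform S b b"
        proof -
          have "(1 - r) * q \<le> (1 - r) * bform \<Sigma> b b"
            using \<psi> \<Sigma>_ge[OF b] by (intro mult_left_mono) (auto simp: q_def)
          then show ?thesis using S_ge[OF b] by linarith
        qed
        have Kk: "2 * K \<le> (1/2 - \<phi>) * \<kappa>"
        proof -
          have "2 * K / ((1/2 - \<phi>) * \<kappa>) \<le> 1" using \<Gamma>1 \<Gamma>lt by linarith
          then show ?thesis using \<phi>lt pos by (simp add: divide_le_eq)
        qed
        have "bform S y y = bform S a a + 2 * bform S a b + bform S b b"
          by (subst (1 2) yab) (simp only: bform_add_add[OF S_sym a b] power2_eq_square mult_1_left mult_1_right)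
        also have "bform S a b = - bform N a b" using Mab bform_M[OF a b] by simp
        finally have "bform S y y \<ge> \<kappa> * (a \<bullet> a) * (1/2 - \<phi>) - \<kappa> * (a \<bullet> a) * ((1/2 - \<phi>) / 2) + (1 - r) * q"
          using Saa Sbb cross by linarith
        also have "\<kappa> * (a \<bullet> a) * (1/2 - \<phi>) - \<kappa> * (a \<bullet> a) * ((1/2 - \<phi>) / 2) = ((1/2 - \<phi>) * \<kappa>) * ((a \<bullet> a) / 2)"
          by (simp add: field_simps)
        finally have "bform S y y \<ge> ((1/2 - \<phi>) * \<kappa>) * ((a \<bullet> a) / 2) + (1 - r) * q" .
        moreover have "(2 * K) * ((a \<bullet> a) / 2) \<le> ((1/2 - \<phi>) * \<kappa>) * ((a \<bullet> a) / 2)"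
          using Kk pq0 by (intro mult_right_mono) auto
        ultimately have "p + (1 - r) * q \<le> bform S y y" by (simp add: p_def)
        moreover have "(1 - r) * p \<le> p" using pos pq0 mult_right_mono[of "1 - r" 1 p] by (simp add: p_def)
        ultimately have Sy: "(1 - r) * (x \<bullet> x) \<le> bform S y y" by (simp add: xpq distrib_left)
        have "(1 - \<psi>)\<^sup>2 * (1 - \<Gamma>) * (x \<bullet> x) \<le> (1 - \<psi>)\<^sup>2 * 1 * (x \<bullet> x)"
          using \<psi>sq \<Gamma>0 x0 by (intro mult_right_mono mult_left_mono) auto
        also have "\<dots> \<le> (1 - r)\<^sup>2 * (x \<bullet> x)" using \<psi> x0 by (simp add: mult_right_mono power_mono)
        also have "\<dots> \<le> bform \<Sigma> y y"
        proof -
          \<comment> \<open>Returning from \<open>S\<close> to \<open>\<Sigma>\<close> costs a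
            division by 1 + r; since (1 + r)(1 - r) \<le> 1, this is no worse than a second factor 1
            - r.\<close>
          have "(1 + r) * ((1 - r)\<^sup>2 * (x \<bullet> x)) = (1 - r\<^sup>2) * ((1 - r) * (x \<bullet> x))"
            by (simp add: power2_eq_square algebra_simps)
          also have "\<dots> \<le> 1 * ((1 - r) * (x \<bullet> x))" using \<psi> x0 by (intro mult_right_mono) auto
          also have "\<dots> \<le> (1 + r) * bform \<Sigma> y y" using Sy S_le[OF y] by linarith
          finally show ?thesis using pos by simp
        qed
        finally show ?thesis .
      qed
    qed
  qed
  then show ?thesis using eq by (simp add: \<Gamma>_def)
qed

end

section \<open>Accuracy with high probability\<close>

lemma measurable_snd_output: "snd \<in> output_space d \<rightarrow>\<^sub>M sym_borel d"
  by (rule measurable_snd)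

lemma sym_mats_smult: "A \<in> sym_mats d \<Longrightarrow> c \<cdot>\<^sub>m A \<in> sym_mats d"
  by (auto simp: sym_mats_index)

lemma measurable_smult_sym:
  "(\<lambda>A. c \<cdot>\<^sub>m A) \<in> sym_borel d \<rightarrow>\<^sub>M sym_borel d"
proof (rule measurable_sym_borelI)
  fix i j assume ij: "i < d" "j < d"
  have "(\<lambda>A. (c \<cdot>\<^sub>m A) $$ (i, j)) \<in> borel_measurable (sym_borel d)
    \<longleftrightarrow> (\<lambda>A. c * A $$ (i, j)) \<in> borel_measurable (sym_borel d)"
    using ij by (intro measurable_cong) (auto simp: sym_mats_def)
  also have "\<dots>" using ij by (intro borel_measurable_times) auto
  finally show "(\<lambda>A. (c \<cdot>\<^sub>m A) $$ (i, j)) \<in> borel_measurable (sym_borel d)" .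
qed (simp add: sym_mats_smult)

lemma measurable_sandwich:
  assumes S: "S \<in> sym_mats d"
  shows "(\<lambda>A. A * S * A) \<in> sym_borel d \<rightarrow>\<^sub>M sym_borel d"
proof (rule measurable_sym_borelI)
  fix i j assume ij: "i < d" "j < d"
  have "(\<lambda>A. (A * S * A) $$ (i, j)) \<in> borel_measurable (sym_borel d)
    \<longleftrightarrow> (\<lambda>A. \<Sum>k<d. A $$ (i, k) * (\<Sum>m<d. S $$ (k, m) * A $$ (m, j))) \<in> borel_measurable (sym_borel d)"
  proof (rule measurable_cong)
    fix A assume "A \<in> space (sym_borel d)"
    then show "(A * S * A) $$ (i, j) = (\<Sum>k<d. A $$ (i, k) * (\<Sum>m<d. S $$ (k, m) * A $$ (m, j)))"
      using ij sym_matsD(1)[OF S] sym_matsD(1)[of A d]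
      by (auto simp: scalar_prod_def atLeast0LessThan)
  qed
  also have "\<dots>"
    using ij by (intro borel_measurable_sum borel_measurable_times) auto
  finally show "(\<lambda>A. (A * S * A) $$ (i, j)) \<in> borel_measurable (sym_borel d)" .
qed (use S sandwich_sym in auto)

lemma sets_loewner_le:
  assumes f: "f \<in> N \<rightarrow>\<^sub>M sym_borel d" and g: "g \<in> N \<rightarrow>\<^sub>M sym_borel d"
  shows "{x \<in> space N. loewner_le d (f x) (g x)} \<in> sets N"
proof -
  have sym: "f x \<in> sym_mats d" "g x \<in> sym_mats d" if "x \<in> space N" for x
    using that f g by (auto dest: measurable_space)
  have "(\<lambda>x. g x - f x) \<in> N \<rightarrow>\<^sub>M sym_borel d"
  proof (rule measurable_sym_borelI)
    fix i j assume ij: "i < d" "j < d"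
    have "(\<lambda>x. (g x - f x) $$ (i, j)) \<in> borel_measurable N
      \<longleftrightarrow> (\<lambda>x. g x $$ (i, j) - f x $$ (i, j)) \<in> borel_measurable N"
    proof (rule measurable_cong)
      fix x assume "x \<in> space N"
      then have "f x \<in> carrier_mat d d" using sym by (blast dest: sym_matsD)
      then show "(g x - f x) $$ (i, j) = g x $$ (i, j) - f x $$ (i, j)"
        using ij by (intro index_minus_mat) auto
    qed
    also have "\<dots>" using ij f g by (intro borel_measurable_diff measurable_sym_borel_index)
    finally show "(\<lambda>x. (g x - f x) $$ (i, j)) \<in> borel_measurable N" .
  qed (use sym sym_mats_diff in auto)
  from measurable_sets[OF this sets_psd_cone]
  have "(\<lambda>x. g x - f x) -` psd_cone d \<inter> space N \<in> sets N" .
  also have "(\<lambda>x. g x - f x) -` psd_cone d \<inter> space N = {x \<in> space N. loewner_le d (f x) (g x)}"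
    using sym by (auto simp: loewner_le_def)
  finally show ?thesis .
qed

lemma smult_sandwich:
  fixes A S :: "real mat"
  assumes A: "A \<in> carrier_mat d d" and S: "S \<in> carrier_mat d d"
  shows "(c \<cdot>\<^sub>m A) * S * (c \<cdot>\<^sub>m A) = (c * c) \<cdot>\<^sub>m (A * S * A)"
proof -
  have AS: "A * S \<in> carrier_mat d d" using A S by (rule mult_carrier_mat)
  have "(c \<cdot>\<^sub>m A) * S * (c \<cdot>\<^sub>m A) = c \<cdot>\<^sub>m ((c \<cdot>\<^sub>m (A * S)) * A)"
    using A S AS by (simp add: mult_smult_assoc_mat[OF A S] mult_smult_distrib[of _ d d])
  also have "\<dots> = c \<cdot>\<^sub>m (c \<cdot>\<^sub>m (A * S * A))" by (simp only: mult_smult_assoc_mat[OF AS A])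
  also have "\<dots> = (c * c) \<cdot>\<^sub>m (A * S * A)" by (intro eq_matI) auto
  finally show ?thesis .
qed

lemma bform_smult_mat:
  assumes "A \<in> carrier_mat d d" "x \<in> carrier_vec d" "y \<in> carrier_vec d"
  shows "bform (c \<cdot>\<^sub>m A) x y = c * bform A x y"
  using assms by (subst (1 2) scalar_prod_mat_sum[of _ d d]) (auto simp: sum_distrib_left mult.assoc)

text \<open>The obstacle is that \<open>n\<close> also occurs inside ln(n/\<beta>). Writing n = m D
  with D = d^(3/2) / sqrt \<rho> isolates ln m, which is at most 2 sqrt m, while the size assumption
  gives \<open>G * \<l> \<le> sqrt m\<close>. The square of the logarithm in the assumption pays for
  the two logarithms in \<open>err_\<phi>\<close>.\<close>

lemma sufficient_sample_size:
  fixes d n :: nat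
  assumes d: "d > 0" and n: "n > 0" and \<rho>: "0 < \<rho>" "\<rho> \<le> 1" and \<beta>: "0 < \<beta>" "\<beta> < 1/2"
    and c: "c\<phi> > 0" "c\<psi> > 0"
    and size: "real n \<ge> (1 + 450 * c\<phi> + 60 * c\<psi>)\<^sup>2 * (real d powr (3/2) * ln (real d / (\<rho> * \<beta>)) ^ 2 / sqrt \<rho>)"
  shows "err_\<phi> c\<phi> \<rho> \<beta> d n \<le> 1/100" "err_\<psi> c\<psi> \<beta> d n \<le> 1/20"
proof -
  define G where "G = 1 + 450 * c\<phi> + 60 * c\<psi>"
  define \<l> where "\<l> = ln (real d / (\<rho> * \<beta>))"
  define L where "L = ln (1 / \<beta>)"
  define D where "D = real d powr (3/2) / sqrt \<rho>"
  define m where "m = real n / D"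
  have G: "G \<ge> 1" "G \<ge> 450 * c\<phi>" "G \<ge> 60 * c\<psi>" "G > 0" using c by (simp_all add: G_def)
  have d1: "real d \<ge> 1" using d by simp
  have \<l>_eq: "\<l> = ln (real d) + ln (1 / \<rho>) + L"
    using d \<rho> \<beta> by (simp add: \<l>_def L_def ln_div ln_mult)
  have ln0: "0 \<le> ln (real d)" "0 \<le> ln (1 / \<rho>)" using d1 \<rho> by simp_all
  have "ln 2 \<le> L" using \<beta> unfolding L_def by (intro ln_mono) (auto simp: field_simps)
  then have L: "1/2 \<le> L" using ln2_ge_two_thirds by linarith
  have Ll: "L \<le> \<l>" "1/2 \<le> \<l>" using \<l>_eq ln0 L by linarith+
  have dp: "1 \<le> real d powr (3/2)" using d1 by (simp add: ge_one_powr_ge_zero)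
  have s\<rho>: "0 < sqrt \<rho>" "sqrt \<rho> \<le> 1" using \<rho> by simp_all
  have "sqrt \<rho> \<le> real d powr (3/2)" using dp s\<rho>(2) by linarith
  then have D1: "1 \<le> D" using \<rho>(1) by (simp add: D_def le_divide_eq)
  have lnD: "ln D \<le> 3/2 * \<l>"
  proof -
    have "ln D = 3/2 * ln (real d) + ln (1 / \<rho>) / 2"
      using d \<rho> by (simp add: D_def ln_div ln_powr ln_sqrt)
    then show ?thesis using \<l>_eq ln0 L by linarith
  qed
  have nm: "real n = m * D" using D1 by (simp add: m_def)
  have mpos: "m > 0" using n D1 by (simp add: m_def)
  have mG: "G\<^sup>2 * \<l>\<^sup>2 \<le> m"
  proof -
    have "G\<^sup>2 * \<l>\<^sup>2 * D \<le> real n" using size by (simp add: G_def \<l>_def D_def mult_ac)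
    then show ?thesis using D1 by (simp add: m_def field_simps)
  qed
  have Gl: "G * \<l> \<le> sqrt m"
  proof (rule real_le_rsqrt)
    show "(G * \<l>)\<^sup>2 \<le> m" using mG by (simp add: power_mult_distrib)
  qed
  have lnm: "ln m \<le> 2 * sqrt m"
  proof -
    have "ln m = 2 * ln (sqrt m)" using mpos by (simp add: ln_sqrt)
    also have "\<dots> \<le> 2 * sqrt m" using ln_le_minus_one[of "sqrt m"] mpos by simp
    finally show ?thesis .
  qed
  show "err_\<phi> c\<phi> \<rho> \<beta> d n \<le> 1/100"
  proof -
    have "ln (real n / \<beta>) = ln m + ln D + L"
      using n \<beta> mpos D1 nm by (simp add: L_def ln_div ln_mult)
    also have "\<dots> \<le> 2 * sqrt m + 5/2 * \<l>" using lnm lnD Ll by linarith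
    also have "\<dots> \<le> 2 * sqrt m + 5/2 * sqrt m"
    proof -
      have "1 * \<l> \<le> G * \<l>" using G Ll by (intro mult_right_mono) auto
      then show ?thesis using Gl by linarith
    qed
    \<comment> \<open>The 9/2 explains the 450 in \<open>G\<close>: with \<open>c\<phi> * L\<close>
      at most sqrt m / 450, the product with this bound is m/100.\<close>
    finally have T: "ln (real n / \<beta>) \<le> 9/2 * sqrt m" by simp
    have "450 * c\<phi> * L \<le> sqrt m"
    proof -
      have "450 * c\<phi> * L \<le> G * \<l>" using G Ll L c by (intro mult_mono) auto
      then show ?thesis using Gl by simp
    qed
    then have cL: "c\<phi> * L \<le> sqrt m / 450" by simp
    have "err_\<phi> c\<phi> \<rho> \<beta> d n = (c\<phi> * L) * ln (real n / \<beta>) * (D / real n)"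
      by (simp add: err_\<phi>_def D_def L_def field_simps)
    also have "D / real n = 1 / m" using D1 by (simp add: m_def)
    also have "(c\<phi> * L) * ln (real n / \<beta>) * (1 / m) \<le> (sqrt m / 450) * (9/2 * sqrt m) * (1 / m)"
    proof (rule mult_right_mono)
      have "(c\<phi> * L) * ln (real n / \<beta>) \<le> (c\<phi> * L) * (9/2 * sqrt m)"
        using T c L by (intro mult_left_mono) auto
      also have "\<dots> \<le> (sqrt m / 450) * (9/2 * sqrt m)"
        using cL mpos by (intro mult_right_mono) auto
      finally show "(c\<phi> * L) * ln (real n / \<beta>) \<le> (sqrt m / 450) * (9/2 * sqrt m)" .
    qed (use mpos in simp)
    also have "\<dots> = 1/100" using mpos by (simp add: field_simps)
    finally show ?thesis .
  qed
  show "err_\<psi> c\<psi> \<beta> d n \<le> 1/20"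
  proof -
    have l2: "1/4 \<le> \<l>\<^sup>2" "\<l> \<le> 2 * \<l>\<^sup>2"
      using Ll mult_left_mono[of "1/2" \<l> \<l>] power_mono[of "1/2" \<l> 2] by (simp_all add: power2_eq_square)
    \<comment> \<open>As \<open>\<l>\<close> is at least 1/2, its square absorbs constants and first
      powers. With sqrt 6 \<le> 3, the 60 in \<open>G\<close> then yields 1/20.\<close>
    have "real d + L \<le> 6 * (real d * \<l>\<^sup>2)"
    proof -
      have "real d * 1 \<le> real d * (4 * \<l>\<^sup>2)" using l2 by (intro mult_left_mono) auto
      moreover have "1 * (2 * \<l>\<^sup>2) \<le> real d * (2 * \<l>\<^sup>2)" using d1 by (intro mult_right_mono) auto
      moreover have "real d * (4 * \<l>\<^sup>2) = 4 * (real d * \<l>\<^sup>2)" "real d * (2 * \<l>\<^sup>2) = 2 * (real d * \<l>\<^sup>2)"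
        by simp_all
      ultimately show ?thesis using Ll l2 by linarith
    qed
    moreover have "real d * (G\<^sup>2 * \<l>\<^sup>2) \<le> real n"
    proof -
      have "real d powr 1 \<le> real d powr (3/2)" using d1 by (intro powr_mono) auto
      then have "real d \<le> real d powr (3/2)" using d by simp
      also have "\<dots> \<le> D" using dp s\<rho> by (simp add: D_def le_divide_eq mult_left_le)
      finally have "real d * (G\<^sup>2 * \<l>\<^sup>2) \<le> D * m" using mG d by (intro mult_mono) auto
      then show ?thesis using nm by (simp add: mult.commute)
    qed
    ultimately have "G\<^sup>2 * (real d + L) \<le> 6 * real n"
      using mult_left_mono[of "real d + L" "6 * (real d * \<l>\<^sup>2)" "G\<^sup>2"] by (simp add: mult_ac)
    then have "(real d + L) / real n \<le> 6 / G\<^sup>2" using n G by (simp add: field_simps)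
    then have "sqrt ((real d + L) / real n) \<le> sqrt (6 / G\<^sup>2)" by simp
    also have "\<dots> = sqrt 6 / G" using G by (simp add: real_sqrt_divide)
    also have "sqrt 6 \<le> 3" by (rule real_le_lsqrt) auto
    then have "sqrt 6 / G \<le> 3 / G" using G by (simp add: divide_right_mono)
    finally have "err_\<psi> c\<psi> \<beta> d n \<le> c\<psi> * (3 / G)"
      using c unfolding err_\<psi>_def L_def by (intro mult_left_mono) auto
    also have "\<dots> \<le> 1/20" using G by (simp add: field_simps)
    finally show ?thesis .
  qed
qed

text \<open>Stated for any measurable \<open>P\<close> implied by the two matrix bounds, so that the
  general estimate and its constant-factor form come from the same noise event. \<beta> < 1/2 yields
  L \<ge> 1/2 and a positive noise scale, as \<open>gaussian_operator_norm\<close> requires.\<close>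

lemma WeakPPC_accuracy:
  assumes c: "c\<^sub>1 > 0" "c\<^sub>2 > 0" and pos: "d > 0" "n > 0" "\<rho> > 0" "\<beta> > 0" "\<beta> < 1/2" "\<kappa> > 0"
    and \<Sigma>: "loewner_le d (1\<^sub>m d) \<Sigma>" "loewner_le d \<Sigma> (\<kappa> \<cdot>\<^sub>m 1\<^sub>m d)"
    and X: "\<And>i. i < n \<Longrightarrow> X i \<in> carrier_vec d"
    and sc: "sample_conditions c\<^sub>1 c\<^sub>2 c\<^sub>3 \<beta> d n \<Sigma> X" and K: "K > 0"
    and \<phi>: "\<phi> = err_\<phi> (512 * c\<^sub>1) \<rho> \<beta> d n" and \<psi>: "\<psi> = err_\<psi> (8 * c\<^sub>2) \<beta> d n"
    and P: "{w \<in> space (output_space d). P (snd w)} \<in> sets (output_space d)"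
    and imp: "\<And>A. A \<in> sym_mats d \<Longrightarrow>
      (\<psi> \<le> 1 \<and> \<phi> \<noteq> 1/2 \<Longrightarrow> loewner_le d (((1 - \<psi>)\<^sup>2 * (1 - err_\<Gamma> K \<kappa> \<phi>)) \<cdot>\<^sub>m 1\<^sub>m d) (A * \<Sigma> * A)) \<Longrightarrow>
      loewner_le d (A * \<Sigma> * A) (((1 + \<psi>) * \<kappa> * (max (1 / K) (1/2) + \<phi>)) \<cdot>\<^sub>m 1\<^sub>m d) \<Longrightarrow> P A"
  shows "measure (WeakPPC c\<^sub>1 (2 * c\<^sub>1) \<rho> \<beta> \<kappa> K d n X)
    {(V, A) \<in> space (WeakPPC c\<^sub>1 (2 * c\<^sub>1) \<rho> \<beta> \<kappa> K d n X). P A} \<ge> 1 - 2 * \<beta>"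
proof -
  define L where "L = ln (1 / \<beta>)"
  define T where "T = ln (real n / \<beta>)"
  define r where "r = c\<^sub>2 * sqrt ((real d + L) / real n)"
  have "ln 2 \<le> L" using pos unfolding L_def by (intro ln_mono) (auto simp: field_simps)
  then have L: "1/2 \<le> L" using ln2_ge_two_thirds by linarith
  have "\<beta> < real n" using pos by linarith
  then have T: "0 < T" using pos by (simp add: T_def)
  have r: "0 \<le> r" "8 * r = \<psi>" using c L by (simp_all add: r_def \<psi> err_\<psi>_def L_def)
  let ?\<sigma> = "noise_scale (2 * c\<^sub>1) \<rho> \<beta> \<kappa> d n"
  have \<sigma>: "0 < ?\<sigma>" using c pos T by (simp add: noise_scale_def T_def[symmetric])
  have dpow: "real d powr (3/2) = real d * sqrt (real d)"
  proof -
    have "real d powr (3/2) = real d powr (1 + 1/2)" by simp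
    also have "\<dots> = real d powr 1 * real d powr (1/2)" by (rule powr_add)
    finally show ?thesis using pos by (simp add: powr_half_sqrt)
  qed
  \<comment> \<open>The operator norm factor 128 times the noise constant 2 \<open>c\<^sub>1\<close>
    is 256 \<open>c\<^sub>1\<close>, half the constant in \<phi>; the noise is thus bounded by
    \<phi>/2 times \<kappa>.\<close>
  define \<eta> where "\<eta> = \<phi> / 2"
  have noise: "128 * sqrt (?\<sigma>\<^sup>2) * sqrt (real d) * L = \<eta> * \<kappa>"
  proof -
    have s: "sqrt (?\<sigma>\<^sup>2) = ?\<sigma>" using \<sigma> by simp
    show ?thesis unfolding s unfolding \<eta>_def \<phi> err_\<phi>_def dpow noise_scale_def by (simp add: L_def mult_ac)
  qed
  have \<phi>0: "0 < \<phi>"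
    using c pos T L unfolding \<phi> err_\<phi>_def L_def[symmetric] T_def[symmetric] by simp
  let ?Q = "normal_prod (upper_index d) (?\<sigma>\<^sup>2)"
  let ?S = "second_moment d n {..<n} X"
  have trunc: "trunc_set c\<^sub>1 \<beta> \<kappa> d n X = {..<n}"
    by (rule sample_conditions_imp(1)[OF \<Sigma> pos(6) X sc])
  have S_ge: "(1 - r) * bform \<Sigma> x x \<le> bform ?S x x" and S_le: "bform ?S x x \<le> (1 + r) * bform \<Sigma> x x"
    if "x \<in> carrier_vec d" for x
    unfolding r_def L_def
    by (rule sample_conditions_imp(2,3)[OF \<Sigma> pos(6) X sc that], assumption)+
  interpret Q: prob_space ?Q by (rule prob_space_normal_prod) simp
  obtain E where E: "E \<in> sets ?Q" "1 - 2 * exp (- L) \<le> measure ?Q E"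
    "\<And>g u. g \<in> E \<Longrightarrow> u \<in> carrier_vec d \<Longrightarrow> \<bar>bform (sym_mat_of d g) u u\<bar> \<le> \<eta> * \<kappa> * (u \<bullet> u)"
    using gaussian_operator_norm[OF pos(1) _ L, of "?\<sigma>\<^sup>2"] \<sigma> unfolding noise by (auto simp: zero_less_power)
  have expL: "exp (- L) = \<beta>" using pos by (simp add: L_def ln_div)
  let ?F = "\<lambda>g. weak_output d \<kappa> K (?S + sym_mat_of d g)"
  have F: "?F \<in> ?Q \<rightarrow>\<^sub>M output_space d" by (rule measurable_noisy_output) simp
  have W: "WeakPPC c\<^sub>1 (2 * c\<^sub>1) \<rho> \<beta> \<kappa> K d n X = distr ?Q (output_space d) ?F"
    unfolding WeakPPC_eq trunc ..
  have P_F: "P (snd (?F g))" if g: "g \<in> E" for g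
  proof -
    let ?N = "sym_mat_of d g"
    have Msym: "?S + ?N \<in> sym_mats d" by (intro sym_mats_add) auto
    then obtain u l where es: "eigen_system d (?S + ?N) u l" using spectral_theorem by blast
    have "noisy_covariance d (?S + ?N) u l \<Sigma> ?S ?N \<kappa> K r \<eta>"
    proof (intro noisy_covariance.intro es noisy_covariance_axioms.intro)
      show "0 \<le> \<eta>" using \<phi>0 by (simp add: \<eta>_def)
      show "0 \<le> r" by fact
    qed (use \<Sigma> S_ge S_le E(3)[OF g] pos K in \<open>auto simp: loewner_le_iff bform_smult_one\<close>)
    then interpret noisy_covariance d "?S + ?N" u l \<Sigma> ?S ?N \<kappa> K r \<eta> .
    have A: "snd (?F g) = smap wt"
      using weak_output_snd[OF es \<open>\<kappa> > 0\<close>] unfolding wt_def[abs_def] .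
    show ?thesis unfolding A
    proof (rule imp)
      have sym: "smap wt * \<Sigma> * smap wt \<in> sym_mats d" using \<Sigma>_sym by (intro sandwich_sym) auto
      show "loewner_le d (smap wt * \<Sigma> * smap wt) (((1 + \<psi>) * \<kappa> * (max (1 / K) (1/2) + \<phi>)) \<cdot>\<^sub>m 1\<^sub>m d)"
        using sym upper_bound[of _ \<psi> \<phi>] r by (auto simp: loewner_le_iff bform_smult_one \<eta>_def)
      assume "\<psi> \<le> 1 \<and> \<phi> \<noteq> 1/2"
      then show "loewner_le d (((1 - \<psi>)\<^sup>2 * (1 - err_\<Gamma> K \<kappa> \<phi>)) \<cdot>\<^sub>m 1\<^sub>m d) (smap wt * \<Sigma> * smap wt)"
        using sym lower_bound[of _ \<psi> \<phi>] r \<phi>0 by (auto simp: loewner_le_iff bform_smult_one \<eta>_def)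
    qed simp
  qed
  have set_eq: "{(V, A) \<in> space (WeakPPC c\<^sub>1 (2 * c\<^sub>1) \<rho> \<beta> \<kappa> K d n X). P A} = {w \<in> space (output_space d). P (snd w)}"
    unfolding W by auto
  have "1 - 2 * \<beta> \<le> measure ?Q E" using E(2) expL by simp
  also have "\<dots> \<le> measure ?Q (?F -` {w \<in> space (output_space d). P (snd w)} \<inter> space ?Q)"
  proof (rule Q.finite_measure_mono)
    show "E \<subseteq> ?F -` {w \<in> space (output_space d). P (snd w)} \<inter> space ?Q"
      using P_F measurable_space[OF F] sets.sets_into_space[OF E(1)] by auto
  qed (rule measurable_sets[OF F P])
  also have "\<dots> = measure (WeakPPC c\<^sub>1 (2 * c\<^sub>1) \<rho> \<beta> \<kappa> K d n X) {(V, A) \<in> space (WeakPPC c\<^sub>1 (2 * c\<^sub>1) \<rho> \<beta> \<kappa> K d n X). P A}"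
    unfolding set_eq unfolding W by (rule measure_distr[OF F P, symmetric])
  finally show ?thesis .
qed

lemma WeakPPC_accuracy_general:
  assumes c: "c\<^sub>1 > 0" "c\<^sub>2 > 0" and pos: "d > 0" "n > 0" "\<rho> > 0" "\<beta> > 0" "\<kappa> > 0"
    and \<Sigma>: "loewner_le d (1\<^sub>m d) \<Sigma>" "loewner_le d \<Sigma> (\<kappa> \<cdot>\<^sub>m 1\<^sub>m d)"
    and X: "\<And>i. i < n \<Longrightarrow> X i \<in> carrier_vec d"
    and sc: "sample_conditions c\<^sub>1 c\<^sub>2 c\<^sub>3 \<beta> d n \<Sigma> X" and K: "K > 0"
    and \<phi>: "\<phi> = err_\<phi> (512 * c\<^sub>1) \<rho> \<beta> d n" and \<psi>: "\<psi> = err_\<psi> (8 * c\<^sub>2) \<beta> d n"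
    and M: "M = WeakPPC c\<^sub>1 (2 * c\<^sub>1) \<rho> \<beta> \<kappa> K d n X"
  shows "measure M {(V, A) \<in> space M.
       (\<psi> \<le> 1 \<and> \<phi> \<noteq> 1/2 \<longrightarrow>
         loewner_le d (((1 - \<psi>)\<^sup>2 * (1 - err_\<Gamma> K \<kappa> \<phi>)) \<cdot>\<^sub>m 1\<^sub>m d) (A * \<Sigma> * A)) \<and>
       loewner_le d (A * \<Sigma> * A) (((1 + \<psi>) * \<kappa> * (max (1 / K) (1/2) + \<phi>)) \<cdot>\<^sub>m 1\<^sub>m d)} \<ge> 1 - 2 * \<beta>"
proof (cases "\<beta> < 1/2")
  case True
  have "\<Sigma> \<in> sym_mats d" using \<Sigma> by (simp add: loewner_le_def)
  note f = measurable_compose[OF measurable_snd_output measurable_sandwich[OF this]]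
  have const: "(\<lambda>_. c \<cdot>\<^sub>m 1\<^sub>m d) \<in> output_space d \<rightarrow>\<^sub>M sym_borel d" for c
    by (rule measurable_const) simp
  show ?thesis unfolding M
  proof (rule WeakPPC_accuracy[OF c pos(1-4) True pos(5) \<Sigma> X sc K \<phi> \<psi>])
    show "{w \<in> space (output_space d).
       (\<psi> \<le> 1 \<and> \<phi> \<noteq> 1/2 \<longrightarrow>
         loewner_le d (((1 - \<psi>)\<^sup>2 * (1 - err_\<Gamma> K \<kappa> \<phi>)) \<cdot>\<^sub>m 1\<^sub>m d) (snd w * \<Sigma> * snd w)) \<and>
       loewner_le d (snd w * \<Sigma> * snd w) (((1 + \<psi>) * \<kappa> * (max (1 / K) (1/2) + \<phi>)) \<cdot>\<^sub>m 1\<^sub>m d)} \<in> sets (output_space d)"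
      by (intro sets.sets_Collect_conj sets.sets_Collect_imp sets.sets_Collect_const sets_loewner_le f const)
  qed auto
next
  case False
  then have "1 - 2 * \<beta> \<le> 0" by simp
  then show ?thesis using measure_nonneg order_trans by blast
qed

text \<open>K = 2 is where 1/K meets the other entry of the maximum: a larger \<open>K\<close> would
  not improve the upper bound, while both entries of \<open>err_\<Gamma>\<close> are proportional to
  \<open>K\<close>.\<close>

lemma WeakPPC_accuracy_constant_factor:
  assumes c: "c\<^sub>1 > 0" "c\<^sub>2 > 0" and pos: "d > 0" "n > 0" "\<rho> > 0" "\<beta> > 0" "\<kappa> > 0"
    and \<Sigma>: "loewner_le d (1\<^sub>m d) \<Sigma>" "loewner_le d \<Sigma> (\<kappa> \<cdot>\<^sub>m 1\<^sub>m d)"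
    and X: "\<And>i. i < n \<Longrightarrow> X i \<in> carrier_vec d"
    and sc: "sample_conditions c\<^sub>1 c\<^sub>2 c\<^sub>3 \<beta> d n \<Sigma> X"
    and \<rho>: "\<rho> \<le> 1" and \<kappa>: "\<kappa> > 1000"
    and size: "real n \<ge> (1 + 450 * (512 * c\<^sub>1) + 60 * (8 * c\<^sub>2))\<^sup>2 * (real d powr (3/2) * ln (real d / (\<rho> * \<beta>)) ^ 2 / sqrt \<rho>)"
    and M: "M = WeakPPC c\<^sub>1 (2 * c\<^sub>1) \<rho> \<beta> \<kappa> 2 d n X"
  shows "measure M {(V, A) \<in> space M.
      loewner_le d (1\<^sub>m d) ((1.1 \<cdot>\<^sub>m A) * \<Sigma> * (1.1 \<cdot>\<^sub>m A)) \<and>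
      loewner_le d ((1.1 \<cdot>\<^sub>m A) * \<Sigma> * (1.1 \<cdot>\<^sub>m A)) ((7/10 * \<kappa>) \<cdot>\<^sub>m 1\<^sub>m d)} \<ge> 1 - 2 * \<beta>"
proof (cases "\<beta> < 1/2")
  case True
  define \<phi> where "\<phi> = err_\<phi> (512 * c\<^sub>1) \<rho> \<beta> d n"
  define \<psi> where "\<psi> = err_\<psi> (8 * c\<^sub>2) \<beta> d n"
  have small: "\<phi> \<le> 1/100" "\<psi> \<le> 1/20"
    unfolding \<phi>_def \<psi>_def using c
    by (intro sufficient_sample_size[OF pos(1-3) \<rho> pos(4) True _ _ size]; simp)+
  have ln0: "0 \<le> ln (1 / \<beta>)" "0 \<le> ln (real n / \<beta>)" using True pos by simp_all
  have nonneg: "0 \<le> \<phi>" "0 \<le> \<psi>"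
    using c ln0 pos by (simp_all add: \<phi>_def \<psi>_def err_\<phi>_def err_\<psi>_def)
  have \<Sigma>_sym: "\<Sigma> \<in> sym_mats d" using \<Sigma> by (simp add: loewner_le_def)
  note f = measurable_compose[OF measurable_compose[OF measurable_snd_output measurable_smult_sym] measurable_sandwich[OF \<Sigma>_sym]]
  have const: "(\<lambda>_. A) \<in> output_space d \<rightarrow>\<^sub>M sym_borel d" if "A \<in> sym_mats d" for A
    by (rule measurable_const) (use that in simp)
  \<comment> \<open>With \<phi> \<le> 1/100 the first entry is at most 4/490, by \<kappa> > 1000,
    and the second at most 0.0032 / 0.2401; both are below 0.017.\<close>
  have \<Gamma>: "err_\<Gamma> 2 \<kappa> \<phi> \<le> 17/1000"
  proof -
    have "49/100 \<le> 1/2 - \<phi>" using small by simp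
    then have "490 \<le> (1/2 - \<phi>) * \<kappa>" using mult_mono[of "49/100" "1/2 - \<phi>" 1000 \<kappa>] \<kappa> by simp
    then have 1: "2 * 2 / ((1/2 - \<phi>) * \<kappa>) \<le> 17/1000" by (simp add: divide_le_eq)
    have "\<phi>\<^sup>2 \<le> (1/100)\<^sup>2" "(49/100)\<^sup>2 \<le> (1/2 - \<phi>)\<^sup>2"
      using small nonneg by (intro power_mono; simp)+
    then have "16 * 2 * \<phi>\<^sup>2 \<le> 17/1000 * (1/2 - \<phi>)\<^sup>2" by (simp add: power2_eq_square)
    moreover have "0 < (1/2 - \<phi>)\<^sup>2" using small by simp
    ultimately have 2: "16 * 2 * \<phi>\<^sup>2 / (1/2 - \<phi>)\<^sup>2 \<le> 17/1000" by (simp add: pos_divide_le_eq)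
    show ?thesis unfolding err_\<Gamma>_def using 1 2 by simp
  qed
  \<comment> \<open>121/100 is the square of 1.1. The product of 1.21, 0.9025 and 0.983 exceeds 1,
    and in \<open>upper\<close> the product of 1.21, 1.05 and 0.51 stays below 0.7.\<close>
  have lower: "1 \<le> 121/100 * ((1 - \<psi>)\<^sup>2 * (1 - err_\<Gamma> 2 \<kappa> \<phi>))"
  proof -
    have "(19/20)\<^sup>2 \<le> (1 - \<psi>)\<^sup>2" using small by (intro power_mono) auto
    then have "(19/20)\<^sup>2 * (983/1000) \<le> (1 - \<psi>)\<^sup>2 * (1 - err_\<Gamma> 2 \<kappa> \<phi>)"
      using \<Gamma> by (intro mult_mono) auto
    then show ?thesis by (simp add: power2_eq_square)
  qed
  have upper: "121/100 * ((1 + \<psi>) * \<kappa> * (max (1 / 2) (1/2) + \<phi>)) \<le> 7/10 * \<kappa>"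
  proof -
    have "(1 + \<psi>) * (1/2 + \<phi>) \<le> (21/20) * (51/100)" using small nonneg by (intro mult_mono) auto
    then have "121/100 * ((1 + \<psi>) * (1/2 + \<phi>)) * \<kappa> \<le> 7/10 * \<kappa>" using \<kappa> by (intro mult_right_mono) auto
    then show ?thesis by (simp add: mult_ac)
  qed
  show ?thesis unfolding M
  proof (rule WeakPPC_accuracy[OF c pos(1-4) True pos(5) \<Sigma> X sc _ \<phi>_def \<psi>_def])
    show "{w \<in> space (output_space d). loewner_le d (1\<^sub>m d) ((1.1 \<cdot>\<^sub>m snd w) * \<Sigma> * (1.1 \<cdot>\<^sub>m snd w)) \<and>
      loewner_le d ((1.1 \<cdot>\<^sub>m snd w) * \<Sigma> * (1.1 \<cdot>\<^sub>m snd w)) ((7/10 * \<kappa>) \<cdot>\<^sub>m 1\<^sub>m d)} \<in> sets (output_space d)"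
      by (intro sets.sets_Collect_conj sets_loewner_le f const) auto
  next
    fix A
    assume A: "A \<in> sym_mats d"
      and low: "\<psi> \<le> 1 \<and> \<phi> \<noteq> 1/2 \<Longrightarrow> loewner_le d (((1 - \<psi>)\<^sup>2 * (1 - err_\<Gamma> 2 \<kappa> \<phi>)) \<cdot>\<^sub>m 1\<^sub>m d) (A * \<Sigma> * A)"
      and up: "loewner_le d (A * \<Sigma> * A) (((1 + \<psi>) * \<kappa> * (max (1 / 2) (1/2) + \<phi>)) \<cdot>\<^sub>m 1\<^sub>m d)"
    have S: "A * \<Sigma> * A \<in> sym_mats d" using A \<Sigma>_sym by (rule sandwich_sym)
    have eq: "(1.1 \<cdot>\<^sub>m A) * \<Sigma> * (1.1 \<cdot>\<^sub>m A) = (121/100) \<cdot>\<^sub>m (A * \<Sigma> * A)"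
      using smult_sandwich[OF sym_matsD(1)[OF A] sym_matsD(1)[OF \<Sigma>_sym], of "1.1"] by simp
    have sym: "(121/100) \<cdot>\<^sub>m (A * \<Sigma> * A) \<in> sym_mats d"
      using S by (rule sym_mats_smult)
    have b: "bform ((121/100) \<cdot>\<^sub>m (A * \<Sigma> * A)) x x = 121/100 * bform (A * \<Sigma> * A) x x" if "x \<in> carrier_vec d" for x
      using bform_smult_mat[OF sym_matsD(1)[OF S] that that] .
    have low': "loewner_le d (((1 - \<psi>)\<^sup>2 * (1 - err_\<Gamma> 2 \<kappa> \<phi>)) \<cdot>\<^sub>m 1\<^sub>m d) (A * \<Sigma> * A)"
      using small by (intro low) auto
    have "x \<bullet> x \<le> bform ((121/100) \<cdot>\<^sub>m (A * \<Sigma> * A)) x x \<and>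
        bform ((121/100) \<cdot>\<^sub>m (A * \<Sigma> * A)) x x \<le> 7/10 * \<kappa> * (x \<bullet> x)" if x: "x \<in> carrier_vec d" for x
    proof -
      have 1: "((1 - \<psi>)\<^sup>2 * (1 - err_\<Gamma> 2 \<kappa> \<phi>)) * (x \<bullet> x) \<le> bform (A * \<Sigma> * A) x x"
        using low' x by (auto simp: loewner_le_iff bform_smult_one)
      have 2: "bform (A * \<Sigma> * A) x x \<le> ((1 + \<psi>) * \<kappa> * (max (1 / 2) (1/2) + \<phi>)) * (x \<bullet> x)"
        using up x by (auto simp: loewner_le_iff bform_smult_one)
      note x0 = scalar_prod_self_nonneg[of x]
      have "x \<bullet> x \<le> 121/100 * (((1 - \<psi>)\<^sup>2 * (1 - err_\<Gamma> 2 \<kappa> \<phi>)) * (x \<bullet> x))"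
        using mult_right_mono[OF lower x0] by (simp only: mult.assoc mult_1_left)
      moreover have "121/100 * (((1 + \<psi>) * \<kappa> * (max (1 / 2) (1/2) + \<phi>)) * (x \<bullet> x)) \<le> 7/10 * \<kappa> * (x \<bullet> x)"
        using mult_right_mono[OF upper x0] by (simp only: mult.assoc)
      moreover note mult_left_mono[OF 1, of "121/100"] mult_left_mono[OF 2, of "121/100"]
      ultimately show ?thesis unfolding b[OF x] by linarith
    qed
    then show "loewner_le d (1\<^sub>m d) ((1.1 \<cdot>\<^sub>m A) * \<Sigma> * (1.1 \<cdot>\<^sub>m A)) \<and>
      loewner_le d ((1.1 \<cdot>\<^sub>m A) * \<Sigma> * (1.1 \<cdot>\<^sub>m A)) ((7/10 * \<kappa>) \<cdot>\<^sub>m 1\<^sub>m d)"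
      unfolding eq using sym by (auto simp: loewner_le_iff bform_smult_one)
  qed auto
next
  case False
  then have "1 - 2 * \<beta> \<le> 0" by simp
  then show ?thesis using measure_nonneg order_trans by blast
qed

theorem theorem3p8:
  fixes c\<^sub>1 c\<^sub>2 c\<^sub>3 :: real
  assumes "c\<^sub>1 > 0" "c\<^sub>2 > 0" "c\<^sub>3 > 0"
  shows "\<exists>cS>0. \<exists>c\<sigma>>0.
    (\<forall>(d::nat) (n::nat) \<rho> \<beta> \<kappa> K. d > 0 \<and> n > 0 \<and> \<rho> > 0 \<and> \<beta> > 0 \<and> \<kappa> > 0 \<and> K > 0 \<longrightarrow>
       zCDP \<rho> n (carrier_vec d) (WeakPPC cS c\<sigma> \<rho> \<beta> \<kappa> K d n)) \<and>
    (\<exists>c\<phi>>0. \<exists>c\<psi>>0. \<exists>c\<beta>>0. \<exists>K\<^sub>0>0. \<exists>c\<^sub>n>0. \<exists>k::nat.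
      \<forall>(d::nat) (n::nat) \<rho> \<beta> \<kappa> \<Sigma>.
        d > 0 \<and> n > 0 \<and> \<rho> > 0 \<and> \<beta> > 0 \<and> \<kappa> > 0 \<and>
        loewner_le d (1\<^sub>m d) \<Sigma> \<and> loewner_le d \<Sigma> (\<kappa> \<cdot>\<^sub>m 1\<^sub>m d) \<longrightarrow>
        (AE X in \<Pi>\<^sub>M i\<in>{..<n}. mv_normal d \<Sigma>. sample_conditions c\<^sub>1 c\<^sub>2 c\<^sub>3 \<beta> d n \<Sigma> X \<longrightarrow>
          (\<forall>K>0.
            let M = WeakPPC cS c\<sigma> \<rho> \<beta> \<kappa> K d n X;
                \<phi> = err_\<phi> c\<phi> \<rho> \<beta> d n;
                \<psi> = err_\<psi> c\<psi> \<beta> d n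
            in measure M {(V, A) \<in> space M.
                 (\<psi> \<le> 1 \<and> \<phi> \<noteq> 1/2 \<longrightarrow>
                   loewner_le d (((1 - \<psi>)\<^sup>2 * (1 - err_\<Gamma> K \<kappa> \<phi>)) \<cdot>\<^sub>m 1\<^sub>m d) (A * \<Sigma> * A)) \<and>
                 loewner_le d (A * \<Sigma> * A)
                   (((1 + \<psi>) * \<kappa> * (max (1 / K) (1/2) + \<phi>)) \<cdot>\<^sub>m 1\<^sub>m d)}
               \<ge> 1 - c\<beta> * \<beta>) \<and>
          (\<rho> \<le> 1 \<and> \<kappa> > 1000 \<and>
           real n \<ge> c\<^sub>n * (real d powr (3/2) * ln (real d / (\<rho> * \<beta>)) ^ k / sqrt \<rho>) \<longrightarrow>
            (let M = WeakPPC cS c\<sigma> \<rho> \<beta> \<kappa> K\<^sub>0 d n X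
             in measure M {(V, A) \<in> space M.
                  loewner_le d (1\<^sub>m d) ((1.1 \<cdot>\<^sub>m A) * \<Sigma> * (1.1 \<cdot>\<^sub>m A)) \<and>
                  loewner_le d ((1.1 \<cdot>\<^sub>m A) * \<Sigma> * (1.1 \<cdot>\<^sub>m A)) ((7/10 * \<kappa>) \<cdot>\<^sub>m 1\<^sub>m d)}
                \<ge> 1 - c\<beta> * \<beta>))))"
\<comment> \<open>\<open>cS\<close> is the constant of condition (i), and \<open>c\<sigma>\<close>
  is twice that, the calibration of \<open>WeakPPC_zCDP\<close>.\<close>
proof (rule exI[of _ "c\<^sub>1"], rule conjI[OF assms(1)], rule exI[of _ "2 * c\<^sub>1"],
    rule conjI, use assms in simp, rule conjI, goal_cases)
  case 1
  show ?case by (intro allI impI WeakPPC_zCDP) (use assms in auto)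
next
  case 2
  have cn: "(1 + 450 * (512 * c\<^sub>1) + 60 * (8 * c\<^sub>2))\<^sup>2 > 0"
    using assms by (intro zero_less_power) auto
  \<comment> \<open>\<open>AE_I2\<close> will reduce the almost sure claim to the points of the
    product space; membership there supplies the dimension of each sample vector.\<close>
  have space: "X i \<in> carrier_vec d"
    if "X \<in> space (\<Pi>\<^sub>M i\<in>{..<n}. mv_normal d \<Sigma>)" "i < n" for X i and n d :: nat and \<Sigma>
    using that by (auto simp: space_PiM mv_normal_def vec_borel_def PiE_iff)
  show ?case
  proof (rule exI[of _ "512 * c\<^sub>1"], rule conjI, use assms in simp,
      rule exI[of _ "8 * c\<^sub>2"], rule conjI, use assms in simp,
      rule exI[of _ 2], rule conjI, simp, rule exI[of _ 2], rule conjI, simp,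
      rule exI[of _ "(1 + 450 * (512 * c\<^sub>1) + 60 * (8 * c\<^sub>2))\<^sup>2"], rule conjI[OF cn],
      rule exI[of _ 2], intro allI impI, elim conjE, intro AE_I2 impI conjI allI, unfold Let_def, goal_cases)
    case (1 d n \<rho> \<beta> \<kappa> \<Sigma> X K)
    then show ?case using space
      by (intro WeakPPC_accuracy_general[OF assms(1,2), where n = n and X = X]) auto
  next
    case (2 d n \<rho> \<beta> \<kappa> \<Sigma> X)
    then show ?case using space
      by (intro WeakPPC_accuracy_constant_factor[OF assms(1,2), where n = n and X = X]) auto
  qed
qed

end
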